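(* Let $0<\beta_*<1/3$, and let $(T_{\alpha_n})_{n\ge 1}$ be an admissible sequence of intermittent maps, i.e. $0\le\alpha_n\le\beta_*$ for all $n\ge1$. Let $Z\sim\mathcal{N}(0,1)$. Let $\mu$ be a Borel probability measure on $[0,1]$ whose density (with respect to Lebesgue measure) belongs to $\mathcal{C}_*(\beta_* )$, and let $f:[0,1]\to\mathbb{R}$ be Lipschitz continuous. Assume that there are $C_0>0$ and $0\le\varepsilon\le1$ such that $\mathrm{Var}(S)\ge C_0N^{\varepsilon}$ for all $N\ge2$, where $S=S(N)$. Then there is a constant $C>0$, independent of $N$, such that for every integer $N\ge2$, $$d_{\mathscr{W}}\left(\frac{S}{\sqrt{\mathrm{Var}(S)}},Z\right)\le C N^{1-\frac32\varepsilon+\beta_*}(\log N)^{\frac1{\beta_*}}.$$ In particular, if $\varepsilon>\frac23(1+\beta_* )$, then $S/\sqrt{\mathrm{Var}(S)}$ converges in distribution to $\mathcal{N}(0,1)$ as $N\to\infty$.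
   Context: For $\alpha\in[0,1)$, $T_\alpha:[0,1]\to[0,1]$ is defined by $T_\alpha(x)=x(1+2^\alpha x^\alpha)$ for $x\in[0,1/2)$ and $T_\alpha(x)=2x-1$ for $x\in[1/2,1]$ (for $\alpha=0$ this is the angle-doubling map). Let $m$ be Lebesgue measure on $[0,1]$. For $\alpha\in(0,1)$, $$\mathcal{C}_*(\alpha)=\{g\in C((0,1])\cap L^1(m): g\ge0,\ g\text{ decreasing},\ x^{\alpha+1}g\text{ increasing},\ g(x)\le 2^\alpha(2+\alpha)x^{-\alpha}m(g)\}$$ (monotonicity non-strict, $m(g)=\int g\,dm$). Write $\mu(g)=\int g\,d\mu$, $T_n=T_{\alpha_n}$, $\widetilde T_n=T_n\circ\cdots\circ T_1$, $\widetilde T_0=\mathrm{id}$, and $$S=S(N)=\sum_{i=0}^{N-1}\bigl(f\circ\widetilde T_i-\mu(f\circ\widetilde T_i)\bigr),\qquad \mathrm{Var}(S)=\mu(S^2),$$ with $S$ regarded as a random variable on $([0,1],\mu)$. The Wasserstein distance of two real random variables is $d_{\mathscr{W}}(Y_1,Y_2)=\sup_{h}|\mathbb{E}\,h(Y_1)-\mathbb{E}\,h(Y_2)|$, the supremum being over all $h:\mathbb{R}\to\mathbb{R}$ with $|h(x)-h(y)|\le|x-y|$. *)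

theory Defs
  imports "HOL-Probability.Probability"
begin

definition lebesgue01 :: "real measure" where
  "lebesgue01 = restrict_space lborel {0..1}"

text \<open>
  Only the values on \<open>{0..1}\<close> are meaningful. For \<open>\<alpha> = 0\<close> the first branch is \<open>2 * x\<close> on all of
  \<open>[0,1/2)\<close>: the convention \<open>0 powr 0 = 0\<close> is harmless at \<open>x = 0\<close> because of the outer factor.
\<close>
definition intermittent_map :: "real \<Rightarrow> real \<Rightarrow> real" where
  "intermittent_map \<alpha> x = (if x < 1/2 then x * (1 + 2 powr \<alpha> * x powr \<alpha>) else 2 * x - 1)"

text \<open>Parameters are indexed from 1; \<open>\<alpha> 0\<close> is never used.\<close>
primrec iterated_map :: "(nat \<Rightarrow> real) \<Rightarrow> nat \<Rightarrow> real \<Rightarrow> real" where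
  "iterated_map \<alpha> 0 = id"
| "iterated_map \<alpha> (Suc n) = intermittent_map (\<alpha> (Suc n)) \<circ> iterated_map \<alpha> n"

text \<open>
  Elements are functions on \<open>(0,1]\<close>, represented by total functions whose values outside \<open>(0,1]\<close>
  are irrelevant (the point 0 is a null set).
\<close>
definition cone_star :: "real \<Rightarrow> (real \<Rightarrow> real) set" where
  "cone_star \<alpha> = {g.
     continuous_on {0<..1} g \<and>
     integrable lebesgue01 g \<and>
     (\<forall>x\<in>{0<..1}. 0 \<le> g x) \<and>
     antimono_on {0<..1} g \<and>
     mono_on {0<..1} (\<lambda>x. x powr (\<alpha> + 1) * g x) \<and>
     (\<forall>x\<in>{0<..1}. g x \<le> 2 powr \<alpha> * (2 + \<alpha>) * x powr (- \<alpha>) * (\<integral>y. g y \<partial>lebesgue01))}"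

definition centred_sum :: "real measure \<Rightarrow> (nat \<Rightarrow> real) \<Rightarrow> (real \<Rightarrow> real) \<Rightarrow> nat \<Rightarrow> real \<Rightarrow> real" where
  "centred_sum \<mu> \<alpha> f N x =
     (\<Sum>i<N. f (iterated_map \<alpha> i x) - (\<integral>y. f (iterated_map \<alpha> i y) \<partial>\<mu>))"

text \<open>The second moment is the variance because the sum is centred.\<close>
definition var_sum :: "real measure \<Rightarrow> (nat \<Rightarrow> real) \<Rightarrow> (real \<Rightarrow> real) \<Rightarrow> nat \<Rightarrow> real" where
  "var_sum \<mu> \<alpha> f N = (\<integral>x. (centred_sum \<mu> \<alpha> f N x)\<^sup>2 \<partial>\<mu>)"

definition normalised_sum :: "real measure \<Rightarrow> (nat \<Rightarrow> real) \<Rightarrow> (real \<Rightarrow> real) \<Rightarrow> nat \<Rightarrow> real \<Rightarrow> real" where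
  "normalised_sum \<mu> \<alpha> f N x = centred_sum \<mu> \<alpha> f N x / sqrt (var_sum \<mu> \<alpha> f N)"

text \<open>
  Distance between \<open>Y1\<close> on the probability space \<open>M1\<close> and \<open>Y2\<close> on \<open>M2\<close>, with values in \<open>ennreal\<close>
  so that the supremum always exists. Meaningful for integrable random variables only, since
  the Bochner integral of a non-integrable function is 0.
\<close>
definition wasserstein_dist ::
    "'a measure \<Rightarrow> ('a \<Rightarrow> real) \<Rightarrow> 'b measure \<Rightarrow> ('b \<Rightarrow> real) \<Rightarrow> ennreal" where
  "wasserstein_dist M1 Y1 M2 Y2 =
     (SUP h\<in>{h :: real \<Rightarrow> real. \<forall>x y. \<bar>h x - h y\<bar> \<le> \<bar>x - y\<bar>}.
        ennreal \<bar>(\<integral>w. h (Y1 w) \<partial>M1) - (\<integral>w. h (Y2 w) \<partial>M2)\<bar>)"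

end

theory Submission
  imports Defs "HOL-Real_Asymp.Real_Asymp"
begin

text \<open>
  Transfer operators preserve decreasing densities, and a decreasing density stays decreasing when a
  constant is subtracted. Two decreasing densities of equal mass can therefore be coupled by cancelling
  a common constant after every block of iterates, once the mass in \<open>[0, e]\<close>, controlled by the invariant
  bound \<open>const * x powr - \<beta>\<close>, is set aside. With logarithmically many blocks this yields memory loss at rate
  \<open>n powr (1 - 1/\<beta>) * ln n powr (1/\<beta>)\<close>. Functionals of the past fit into the same scheme: on cylinders a
  Birkhoff sum has bounded variation, so a Lipschitz functional of it is a combination of decreasing
  densities. The normal approximation is Stein's method, leaving out a window of \<open>K = N powr \<beta>\<close> indices
  around each summand; memory loss between the window and the rest costs \<open>N powr \<beta>\<close> up to logarithms.
\<close>

section \<open>Branches and transfer operators\<close>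

text \<open>The parameters change with time, so there is no invariant density and no single operator
  with a spectral gap. The cone of the statement is not stable under what Stein's method does to a
  density: weighting by a function of the past, and subtracting constants. Monotonicity survives
  both, once the weight is split into indicators of initial intervals. The scales fit as follows. A
  point near e needs about \<open>e powr - \<beta>\<close> steps to escape, which fixes the block
  length, and the mass set aside per block is of order \<open>e powr (1 - \<beta>)\<close>. With k
  blocks in n steps, e is about \<open>(k / n) powr (1 / \<beta>)\<close> and the total set aside is
  about \<open>k powr (1 / \<beta>) * n powr (1 - 1 / \<beta>)\<close>; since k is of order
  \<open>ln n\<close>, this is the origin of the logarithmic factor. In Stein's method the Taylor
  remainder costs N K / \<sigma>^3 and the gap costs N r(K) / \<sigma>, where r(K) is
  \<open>K powr (1 - 1 / \<beta>)\<close> up to logarithms. For K = \<open>N powr \<beta>\<close>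
  the second is \<open>N powr \<beta> / \<sigma>\<close>, which \<sigma>^2 = O(N) brings to the
  order of the first.\<close>

definition branch_pow :: "real \<Rightarrow> real \<Rightarrow> real" where
  "branch_pow a y = (if a = 0 then 1 else (2 * \<bar>y\<bar>) powr a)"

text \<open>Extending the left branch to an odd function makes it a \<open>C\<^sup>1\<close> bijection of the line.\<close>
definition left_branch :: "real \<Rightarrow> real \<Rightarrow> real" where
  "left_branch a y = y * (1 + branch_pow a y)"

definition left_deriv :: "real \<Rightarrow> real \<Rightarrow> real" where
  "left_deriv a y = 1 + (1 + a) * branch_pow a y"

definition left_inv :: "real \<Rightarrow> real \<Rightarrow> real" where
  "left_inv a = inv (left_branch a)"

definition transfer :: "real \<Rightarrow> (real \<Rightarrow> real) \<Rightarrow> real \<Rightarrow> real" where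
  "transfer a h x = h (left_inv a x) / left_deriv a (left_inv a x) + h ((x + 1) / 2) / 2"

lemma branch_pow_nonneg: "0 \<le> branch_pow a y"
  by (simp add: branch_pow_def)

lemma branch_pow_le_1: "0 \<le> a \<Longrightarrow> 0 \<le> y \<Longrightarrow> y \<le> 1/2 \<Longrightarrow> branch_pow a y \<le> 1"
  by (simp add: branch_pow_def powr_le1)

lemma branch_pow_mono: "0 \<le> a \<Longrightarrow> \<bar>y\<bar> \<le> \<bar>z\<bar> \<Longrightarrow> branch_pow a y \<le> branch_pow a z"
  by (simp add: branch_pow_def powr_mono2)

lemma branch_pow_uminus [simp]: "branch_pow a (- y) = branch_pow a y"
  by (simp add: branch_pow_def)

lemma left_branch_uminus [simp]: "left_branch a (- y) = - left_branch a y"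
  by (simp add: left_branch_def)

lemma left_branch_0 [simp]: "left_branch a 0 = 0"
  by (simp add: left_branch_def)

lemma left_branch_half [simp]: "left_branch a (1/2) = 1"
  by (simp add: left_branch_def branch_pow_def)

text \<open>The separate value 1 of \<open>branch_pow\<close> for \<open>a = 0\<close> is what saves
  continuity at 0, where \<open>0 powr 0 = 0\<close>.\<close>

lemma continuous_branch_pow: "0 \<le> a \<Longrightarrow> continuous_on A (branch_pow a)"
  unfolding branch_pow_def by (cases "a = 0") (auto intro!: continuous_intros continuous_on_powr')

lemma continuous_left_branch: "0 \<le> a \<Longrightarrow> continuous_on A (left_branch a)"
  unfolding left_branch_def by (intro continuous_intros continuous_branch_pow)

lemma continuous_left_deriv: "0 \<le> a \<Longrightarrow> continuous_on A (left_deriv a)"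
  unfolding left_deriv_def by (intro continuous_intros continuous_branch_pow)

lemma left_deriv_ge_1: "0 \<le> a \<Longrightarrow> 1 \<le> left_deriv a y"
  by (simp add: left_deriv_def branch_pow_nonneg)

lemma left_deriv_le: "0 \<le> a \<Longrightarrow> 0 \<le> y \<Longrightarrow> y \<le> 1/2 \<Longrightarrow> left_deriv a y \<le> 2 + a"
  using mult_left_mono[OF branch_pow_le_1, of a y "1 + a"] by (simp add: left_deriv_def)

lemma left_deriv_mono: "0 \<le> a \<Longrightarrow> \<bar>y\<bar> \<le> \<bar>z\<bar> \<Longrightarrow> left_deriv a y \<le> left_deriv a z"
  using branch_pow_mono[of a y z] by (simp add: left_deriv_def mult_left_mono)

text \<open>At 0 the difference quotient is exactly \<open>1 + branch_pow a h\<close>, so the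
  derivative is read off from continuity; it agrees with \<open>left_deriv\<close> because
  \<open>branch_pow a 0\<close> vanishes unless \<open>a = 0\<close>. For positive y the absolute
  value disappears locally and the power rule applies.\<close>

lemma left_branch_has_derivative:
  assumes "0 \<le> a" "0 \<le> y"
  shows "(left_branch a has_real_derivative left_deriv a y) (at y)"
proof (cases "y = 0")
  case True
  have "isCont (branch_pow a) 0"
    using continuous_branch_pow[OF assms(1), of UNIV] by (simp add: continuous_on_eq_continuous_within)
  then have "(branch_pow a \<longlongrightarrow> branch_pow a 0) (at 0)" by (simp add: isCont_def)
  then have "((\<lambda>h. 1 + branch_pow a h) \<longlongrightarrow> 1 + branch_pow a 0) (at 0)" by (intro tendsto_intros)
  moreover have "\<forall>\<^sub>F h in at 0. 1 + branch_pow a h = (left_branch a (0 + h) - left_branch a 0) / h"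
    by (auto simp: eventually_at_filter left_branch_def)
  ultimately have "((\<lambda>h. (left_branch a (0 + h) - left_branch a 0) / h) \<longlongrightarrow> 1 + branch_pow a 0) (at 0)"
    by (rule Lim_transform_eventually)
  moreover have "left_deriv a 0 = 1 + branch_pow a 0 \<or> a = 0"
    by (auto simp: left_deriv_def branch_pow_def)
  moreover have "a = 0 \<Longrightarrow> left_deriv a 0 = 1 + branch_pow a 0"
    by (auto simp: left_deriv_def branch_pow_def)
  ultimately show ?thesis using True by (auto simp: DERIV_def)
next
  case False
  then have y: "y > 0" using assms by auto
  show ?thesis
  proof (cases "a = 0")
    case True
    have "((\<lambda>y. y * 2) has_real_derivative 2) (at y)" by (auto intro!: derivative_eq_intros)
    moreover have "left_branch a = (\<lambda>y. y * 2)" using True by (auto simp: left_branch_def branch_pow_def)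
    ultimately show ?thesis using True by (simp add: left_deriv_def branch_pow_def)
  next
    case a: False
    have p: "y powr (a - 1) * y = y powr a" using y by (simp add: powr_diff)
    have "((\<lambda>y. y + 2 powr a * (y * y powr a)) has_real_derivative
        1 + 2 powr a * (y powr a + y * (a * y powr (a - 1)))) (at y)"
      using y by (auto intro!: derivative_eq_intros)
    moreover have "1 + 2 powr a * (y powr a + y * (a * y powr (a - 1))) = left_deriv a y"
      using y a p by (simp add: left_deriv_def branch_pow_def powr_mult algebra_simps)
    moreover have "\<forall>\<^sub>F z in nhds y. y > 0 \<longrightarrow> z + 2 powr a * (z * z powr a) = left_branch a z"
      using eventually_gt_at_top eventually_nhds_in_open[of "{0<..}" y] y a
      by (auto elim!: eventually_mono simp: left_branch_def branch_pow_def powr_mult algebra_simps)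
    ultimately show ?thesis using y by (subst DERIV_cong_ev[OF refl _ refl, symmetric]) auto
  qed
qed

lemma left_branch_ge: "0 \<le> y \<Longrightarrow> y \<le> left_branch a y"
  by (simp add: left_branch_def branch_pow_nonneg mult_le_cancel_left1)

lemma left_branch_le: "0 \<le> a \<Longrightarrow> 0 \<le> y \<Longrightarrow> y \<le> 1/2 \<Longrightarrow> left_branch a y \<le> 2 * y"
  using mult_left_mono[OF branch_pow_le_1[of a y], of y] by (simp add: left_branch_def algebra_simps)

lemma strict_mono_left_branch:
  assumes "0 \<le> a" shows "strict_mono (left_branch a)"
proof -
  have pos: "left_branch a y < left_branch a z" if "0 \<le> y" "y < z" for y z
  proof -
    have "y * (1 + branch_pow a y) \<le> y * (1 + branch_pow a z)"
      using that assms by (intro mult_left_mono add_left_mono branch_pow_mono) auto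
    also have "\<dots> < z * (1 + branch_pow a z)"
      using that branch_pow_nonneg[of a z] by (intro mult_strict_right_mono) auto
    finally show ?thesis by (simp add: left_branch_def)
  qed
  show ?thesis
  proof (rule strict_monoI)
    fix y z :: real assume yz: "y < z"
    consider "0 \<le> y" | "z \<le> 0" | "y < 0" "0 < z" by linarith
    then show "left_branch a y < left_branch a z"
    proof cases
      case 1 then show ?thesis using pos yz by auto
    next
      case 2 then show ?thesis using pos[of "- z" "- y"] yz by auto
    next
      case 3
      have "0 < left_branch a z" "left_branch a y < 0"
        using pos[of 0 z] pos[of 0 "- y"] 3 by auto
      then show ?thesis by linarith
    qed
  qed
qed

lemma surj_left_branch: assumes "0 \<le> a" shows "surj (left_branch a)"
proof -
  have "\<exists>y. left_branch a y = x" for x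
  proof -
    have "left_branch a (- \<bar>x\<bar>) \<le> x" "x \<le> left_branch a \<bar>x\<bar>"
      using left_branch_ge[of "\<bar>x\<bar>" a] by auto
    moreover have "continuous_on {- \<bar>x\<bar>..\<bar>x\<bar>} (left_branch a)"
      by (rule continuous_left_branch[OF assms])
    ultimately show ?thesis using IVT'[of "left_branch a" "- \<bar>x\<bar>" x "\<bar>x\<bar>"] by force
  qed
  then show ?thesis by (metis surj_def)
qed

lemma left_branch_inv [simp]: "0 \<le> a \<Longrightarrow> left_branch a (left_inv a x) = x"
  unfolding left_inv_def by (rule surj_f_inv_f[OF surj_left_branch])

lemma left_inv_branch [simp]: "0 \<le> a \<Longrightarrow> left_inv a (left_branch a y) = y"
  unfolding left_inv_def
  by (rule inv_f_f[OF strict_mono_imp_inj_on[OF strict_mono_left_branch]])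

lemma left_inv_mono: "0 \<le> a \<Longrightarrow> x \<le> y \<Longrightarrow> left_inv a x \<le> left_inv a y"
  using strict_mono_less_eq[OF strict_mono_left_branch, of a "left_inv a x" "left_inv a y"] by simp

lemma left_inv_0 [simp]: "0 \<le> a \<Longrightarrow> left_inv a 0 = 0"
  using left_inv_branch[of a 0] by simp

lemma left_inv_1 [simp]: "0 \<le> a \<Longrightarrow> left_inv a 1 = 1/2"
  using left_inv_branch[of a "1/2"] by simp

lemma left_inv_less: "0 \<le> a \<Longrightarrow> x < y \<Longrightarrow> left_inv a x < left_inv a y"
  using strict_mono_less[OF strict_mono_left_branch, of a "left_inv a x" "left_inv a y"] by simp

lemma left_inv_pos: "0 \<le> a \<Longrightarrow> 0 < x \<Longrightarrow> 0 < left_inv a x"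
  using left_inv_less[of a 0 x] by simp

lemma left_inv_le_half: "0 \<le> a \<Longrightarrow> x \<le> 1 \<Longrightarrow> left_inv a x \<le> 1/2"
  using left_inv_mono[of a x 1] by simp

lemma left_inv_nonneg: "0 \<le> a \<Longrightarrow> 0 \<le> x \<Longrightarrow> 0 \<le> left_inv a x"
  using left_inv_mono[of a 0 x] by simp

lemma left_inv_le: "0 \<le> a \<Longrightarrow> 0 \<le> x \<Longrightarrow> left_inv a x \<le> x"
  using left_branch_ge[OF left_inv_nonneg, of a x a] by simp

lemma left_inv_ge: "0 \<le> a \<Longrightarrow> 0 \<le> x \<Longrightarrow> x \<le> 1 \<Longrightarrow> x \<le> 2 * left_inv a x"
  using left_branch_le[OF _ left_inv_nonneg left_inv_le_half, of a a x] by simp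

lemma measurable_left_inv [measurable]:
  assumes "0 \<le> a" shows "left_inv a \<in> borel_measurable borel"
  by (rule borel_measurable_mono) (auto simp: mono_def intro: left_inv_mono[OF assms])

lemma measurable_left_deriv [measurable]:
  assumes "0 \<le> a" shows "left_deriv a \<in> borel_measurable borel"
  by (rule borel_measurable_continuous_onI[OF continuous_left_deriv[OF assms]])

lemma measurable_transfer [measurable]:
  assumes [measurable]: "h \<in> borel_measurable borel" and a: "0 \<le> a"
  shows "transfer a h \<in> borel_measurable borel"
proof -
  note [measurable] = measurable_left_inv[OF a] measurable_left_deriv[OF a]
  show ?thesis unfolding transfer_def[abs_def] by measurable
qed

lemma measurable_intermittent_map [measurable]: "intermittent_map a \<in> borel_measurable borel"
  unfolding intermittent_map_def[abs_def] by measurable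

lemma intermittent_map_left:
  "0 \<le> a \<Longrightarrow> 0 \<le> y \<Longrightarrow> y < 1/2 \<Longrightarrow> intermittent_map a y = left_branch a y"
  by (auto simp: intermittent_map_def left_branch_def branch_pow_def powr_mult)

text \<open>The endpoint \<open>x = 1\<close> is excluded because its left preimage 1/2 belongs to
  the right branch.\<close>

lemma intermittent_map_left_inv:
  assumes "0 \<le> a" "0 \<le> x" "x < 1" shows "intermittent_map a (left_inv a x) = x"
proof -
  have "left_inv a x < 1/2" using left_inv_less[of a x 1] assms by simp
  then show ?thesis using assms by (simp add: intermittent_map_left left_inv_nonneg)
qed

lemma intermittent_map_right_inv: "0 \<le> x \<Longrightarrow> intermittent_map a ((x + 1) / 2) = x"
  by (simp add: intermittent_map_def field_simps)

lemma intermittent_map_in: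
  assumes "0 \<le> a" "x \<in> {0..1}" shows "intermittent_map a x \<in> {0..1}"
proof (cases "x < 1/2")
  case True
  have "0 \<le> left_branch a x" using left_branch_ge[of x a] assms by auto
  moreover have "left_branch a x \<le> 2 * x" using True assms by (intro left_branch_le) auto
  ultimately show ?thesis using True assms by (simp add: intermittent_map_left)
qed (use assms in \<open>auto simp: intermittent_map_def\<close>)

section \<open>Lebesgue measure on the unit interval and preservation of mass\<close>

lemma space_lebesgue01 [simp]: "space lebesgue01 = {0..1}"
  by (simp add: lebesgue01_def space_restrict_space)

lemma borel_measurable_lebesgue01: "h \<in> borel_measurable borel \<Longrightarrow> h \<in> borel_measurable lebesgue01"
  unfolding lebesgue01_def by (intro measurable_restrict_space1) simp

lemma emeasure_lebesgue01: "emeasure lebesgue01 {0..1} = 1"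
  by (simp add: lebesgue01_def emeasure_restrict_space)

interpretation lebesgue01: prob_space lebesgue01
  by (rule prob_spaceI) (simp add: emeasure_lebesgue01)

lemma nn_integral_lebesgue01:
  "(\<integral>\<^sup>+x. F x \<partial>lebesgue01) = (\<integral>\<^sup>+x. F x * indicator {0..1} x \<partial>lborel)"
  unfolding lebesgue01_def by (rule nn_integral_restrict_space) simp

lemma AE_lebesgue01: "AE x in lebesgue01. 0 < x \<and> x < 1"
proof -
  have "AE x in lborel. x \<noteq> 0 \<and> x \<noteq> (1::real)"
    using AE_lborel_singleton[of "0::real"] AE_lborel_singleton[of "1::real"] by auto
  then have "AE x in lborel. x \<in> {0..1} \<longrightarrow> 0 < x \<and> x < (1::real)"
    by eventually_elim auto
  then show ?thesis
    unfolding lebesgue01_def by (subst AE_restrict_space_iff) auto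
qed

text \<open>Change of variables on the two branches: the unit interval is pulled back to
  \<open>{0..1/2}\<close> and to \<open>{1/2..1}\<close>, and the shared point 1/2 is null.
  Non-negativity makes \<open>ennreal\<close> additive over the two terms of
  \<open>transfer\<close>.\<close>

lemma nn_integral_transfer:
  assumes [measurable]: "Q \<in> borel_measurable borel" and a: "0 \<le> a"
    and Q: "\<And>x. 0 \<le> x \<Longrightarrow> x \<le> 1 \<Longrightarrow> 0 \<le> Q x"
  shows "(\<integral>\<^sup>+x. transfer a Q x \<partial>lebesgue01) = (\<integral>\<^sup>+x. Q x \<partial>lebesgue01)"
proof -
  note [measurable] = measurable_left_inv[OF a] measurable_left_deriv[OF a]
  let ?F = "\<lambda>x. Q (left_inv a x) / left_deriv a (left_inv a x)"
  let ?R = "\<lambda>x. Q ((x + 1) / 2) / 2"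
  have D: "0 < left_deriv a y" for y using left_deriv_ge_1[OF a, of y] by simp
  have [simp]: "left_deriv a y \<noteq> 0" for y using D[of y] by simp
  have "(\<integral>\<^sup>+x. ennreal (?F x * indicator {left_branch a 0..left_branch a (1/2)} x) \<partial>lborel) =
      (\<integral>\<^sup>+x. ennreal (?F (left_branch a x) * left_deriv a x * indicator {0..1/2} x) \<partial>lborel)"
    by (rule nn_integral_substitution[where f = ?F and g = "left_branch a" and g' = "left_deriv a"])
      (auto simp: set_borel_measurable_def a D less_imp_le
        intro!: left_branch_has_derivative continuous_left_deriv)
  then have l: "(\<integral>\<^sup>+x. ennreal (?F x * indicator {0..1} x) \<partial>lborel) =
      (\<integral>\<^sup>+x. ennreal (Q x * indicator {0..1/2} x) \<partial>lborel)"
    by (simp add: a)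
  have "(\<integral>\<^sup>+x. ennreal (?R x * indicator {2 * (1/2) - 1..2 * 1 - 1} x) \<partial>lborel) =
      (\<integral>\<^sup>+x. ennreal (?R (2 * x - 1) * 2 * indicator {1/2..1} x) \<partial>lborel)"
    by (rule nn_integral_substitution[where f = ?R and g = "\<lambda>x. 2 * x - 1" and g' = "\<lambda>_. 2"])
      (auto simp: set_borel_measurable_def intro!: derivative_eq_intros)
  then have r: "(\<integral>\<^sup>+x. ennreal (?R x * indicator {0..1} x) \<partial>lborel) =
      (\<integral>\<^sup>+x. ennreal (Q x * indicator {1/2..1} x) \<partial>lborel)"
    by simp
  have "(\<integral>\<^sup>+x. transfer a Q x \<partial>lebesgue01) =
      (\<integral>\<^sup>+x. ennreal (?F x * indicator {0..1} x) + ennreal (?R x * indicator {0..1} x) \<partial>lborel)"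
    unfolding nn_integral_lebesgue01
  proof (intro nn_integral_cong)
    fix x :: real
    show "ennreal (transfer a Q x) * indicator {0..1} x =
        ennreal (?F x * indicator {0..1} x) + ennreal (?R x * indicator {0..1} x)"
    proof (cases "x \<in> {0..1}")
      case True
      then have "0 \<le> Q (left_inv a x)"
        using left_inv_le_half[OF a, of x] by (intro Q) (auto simp: a left_inv_nonneg)
      moreover have "0 \<le> Q ((x + 1) / 2)" using True by (intro Q) auto
      ultimately show ?thesis using True
        by (simp add: transfer_def D less_imp_le ennreal_plus[symmetric] del: ennreal_plus)
    qed simp
  qed
  also have "\<dots> = (\<integral>\<^sup>+x. ennreal (Q x * indicator {0..1/2} x) + ennreal (Q x * indicator {1/2..1} x) \<partial>lborel)"
    by (subst nn_integral_add, measurable, subst nn_integral_add, measurable) (simp only: l r)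
  also have "\<dots> = (\<integral>\<^sup>+x. ennreal (Q x) * indicator {0..1} x \<partial>lborel)"
  proof (rule nn_integral_cong_AE)
    show "AE x in lborel. ennreal (Q x * indicator {0..1/2} x) + ennreal (Q x * indicator {1/2..1} x) =
        ennreal (Q x) * indicator {0..1} x"
      using AE_lborel_singleton[of "1/2::real"] by eventually_elim (auto simp: indicator_def)
  qed
  finally show ?thesis by (simp add: nn_integral_lebesgue01)
qed

lemma transfer_diff: "transfer a (\<lambda>x. h x - u x) x = transfer a h x - transfer a u x"
  by (simp add: transfer_def diff_divide_distrib)

lemma transfer_add: "transfer a (\<lambda>x. h x + u x) x = transfer a h x + transfer a u x"
  by (simp add: transfer_def add_divide_distrib)

lemma transfer_cmult: "transfer a (\<lambda>x. c * h x) x = c * transfer a h x"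
  by (simp add: transfer_def distrib_left)

lemma transfer_mono:
  assumes "0 \<le> a" "0 < x" "x \<le> 1" "\<And>x. 0 < x \<Longrightarrow> x \<le> 1 \<Longrightarrow> h x \<le> u x"
  shows "transfer a h x \<le> transfer a u x"
proof -
  have "h (left_inv a x) \<le> u (left_inv a x)"
    using left_inv_pos[of a x] left_inv_le_half[of a x] assms by (intro assms(4)) auto
  moreover have "h ((x + 1) / 2) \<le> u ((x + 1) / 2)" using assms by (intro assms(4)) auto
  ultimately show ?thesis unfolding transfer_def
    using left_deriv_ge_1[of a "left_inv a x"] assms by (intro add_mono divide_right_mono) auto
qed

lemma integral_transfer_nonneg:
  assumes [measurable]: "Q \<in> borel_measurable borel" and a: "0 \<le> a"
    and Q: "\<And>x. 0 \<le> Q x" and int: "integrable lebesgue01 Q"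
  shows "integrable lebesgue01 (transfer a Q)" "(\<integral>x. transfer a Q x \<partial>lebesgue01) = (\<integral>x. Q x \<partial>lebesgue01)"
proof -
  have pos: "0 \<le> transfer a Q x" for x
    using Q left_deriv_ge_1[OF a, of "left_inv a x"] by (auto simp: transfer_def)
  note meas [measurable] = borel_measurable_lebesgue01[OF measurable_transfer[OF assms(1) a]]
  have nn: "(\<integral>\<^sup>+x. transfer a Q x \<partial>lebesgue01) = (\<integral>\<^sup>+x. Q x \<partial>lebesgue01)"
    by (rule nn_integral_transfer[OF assms(1) a]) (use Q in auto)
  have fin: "(\<integral>\<^sup>+x. Q x \<partial>lebesgue01) < \<infinity>"
    using int Q by (simp add: integrable_iff_bounded)
  show "integrable lebesgue01 (transfer a Q)"
    using fin nn pos by (intro integrableI_bounded) auto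
  show "(\<integral>x. transfer a Q x \<partial>lebesgue01) = (\<integral>x. Q x \<partial>lebesgue01)"
    using nn pos Q borel_measurable_lebesgue01[OF assms(1)]
    by (subst (1 2) integral_eq_nn_integral) auto
qed

text \<open>Signed functions occur because duality is applied to products of observables and
  densities; they are split into positive and negative parts.\<close>

lemma integral_transfer:
  assumes [measurable]: "Q \<in> borel_measurable borel" and a: "0 \<le> a" and int: "integrable lebesgue01 Q"
  shows "integrable lebesgue01 (transfer a Q)" "(\<integral>x. transfer a Q x \<partial>lebesgue01) = (\<integral>x. Q x \<partial>lebesgue01)"
proof -
  define p n where "p = (\<lambda>x. max 0 (Q x))" and "n = (\<lambda>x. max 0 (- Q x))"
  have [measurable]: "p \<in> borel_measurable borel" "n \<in> borel_measurable borel"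
    by (auto simp: p_def n_def)
  have Q: "Q = (\<lambda>x. p x - n x)" by (auto simp: p_def n_def max_def)
  have ip: "integrable lebesgue01 p" and "in": "integrable lebesgue01 n"
    using int by (auto simp: p_def n_def)
  have pos: "0 \<le> p x" "0 \<le> n x" for x by (auto simp: p_def n_def)
  note P = integral_transfer_nonneg[of p, OF _ a pos(1) ip]
  note N = integral_transfer_nonneg[of n, OF _ a pos(2) "in"]
  have t: "transfer a Q = (\<lambda>x. transfer a p x - transfer a n x)"
    by (simp add: Q transfer_diff fun_eq_iff)
  show "integrable lebesgue01 (transfer a Q)"
    unfolding t using P N by auto
  have "(\<integral>x. transfer a Q x \<partial>lebesgue01) = (\<integral>x. p x \<partial>lebesgue01) - (\<integral>x. n x \<partial>lebesgue01)"
    unfolding t using P N by simp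
  also have "\<dots> = (\<integral>x. Q x \<partial>lebesgue01)"
    unfolding Q using ip "in" by simp
  finally show "(\<integral>x. transfer a Q x \<partial>lebesgue01) = (\<integral>x. Q x \<partial>lebesgue01)" .
qed

section \<open>Decreasing densities\<close>

text \<open>Densities are neither normalised nor bounded, and 0 is left out because they may blow up
  there. The class is closed under transfer, under cutting to \<open>{..s}\<close> and under
  subtraction of a constant lying below the density, which are the operations of the
  coupling.\<close>

definition dec_dens :: "(real \<Rightarrow> real) \<Rightarrow> bool" where
  "dec_dens h \<longleftrightarrow> h \<in> borel_measurable borel \<and> integrable lebesgue01 h \<and>
     (\<forall>x. 0 < x \<longrightarrow> x \<le> 1 \<longrightarrow> 0 \<le> h x) \<and> (\<forall>x y. 0 < x \<longrightarrow> x \<le> y \<longrightarrow> y \<le> 1 \<longrightarrow> h y \<le> h x)"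

abbreviation mass :: "(real \<Rightarrow> real) \<Rightarrow> real" where
  "mass h \<equiv> (\<integral>x. h x \<partial>lebesgue01)"

lemma dec_densD:
  assumes "dec_dens h"
  shows "h \<in> borel_measurable borel" "h \<in> borel_measurable lebesgue01" "integrable lebesgue01 h"
    "\<And>x. 0 < x \<Longrightarrow> x \<le> 1 \<Longrightarrow> 0 \<le> h x"
    "\<And>x y. 0 < x \<Longrightarrow> x \<le> y \<Longrightarrow> y \<le> 1 \<Longrightarrow> h y \<le> h x"
  using assms by (auto simp: dec_dens_def borel_measurable_lebesgue01)

lemma AE_lebesgue01I: "(\<And>x. 0 < x \<Longrightarrow> x < 1 \<Longrightarrow> P x) \<Longrightarrow> AE x in lebesgue01. P x"
  using AE_lebesgue01 by eventually_elim auto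

lemma integral_lebesgue01_mono:
  fixes h u :: "real \<Rightarrow> real"
  assumes "integrable lebesgue01 h" "integrable lebesgue01 u" "\<And>x. 0 < x \<Longrightarrow> x < 1 \<Longrightarrow> h x \<le> u x"
  shows "mass h \<le> mass u"
  using assms by (intro integral_mono_AE AE_lebesgue01I) auto

lemma integral_lebesgue01_cong:
  fixes h u :: "real \<Rightarrow> real"
  assumes "h \<in> borel_measurable borel" "u \<in> borel_measurable borel" "\<And>x. 0 < x \<Longrightarrow> x < 1 \<Longrightarrow> h x = u x"
  shows "mass h = mass u"
  using assms by (intro integral_cong_AE AE_lebesgue01I) (auto simp: borel_measurable_lebesgue01)

lemma integral_lebesgue01_nonneg:
  fixes h :: "real \<Rightarrow> real"
  assumes "\<And>x. 0 < x \<Longrightarrow> x < 1 \<Longrightarrow> 0 \<le> h x" shows "0 \<le> mass h"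
  using assms by (intro integral_nonneg_AE AE_lebesgue01I) auto

lemma integrable_lebesgue01_bound:
  fixes h u :: "real \<Rightarrow> real"
  assumes "integrable lebesgue01 u" "h \<in> borel_measurable borel" "\<And>x. 0 < x \<Longrightarrow> x < 1 \<Longrightarrow> \<bar>h x\<bar> \<le> u x"
  shows "integrable lebesgue01 h"
  by (rule Bochner_Integration.integrable_bound[OF assms(1)])
    (use assms in \<open>fastforce intro!: AE_lebesgue01I simp: borel_measurable_lebesgue01\<close>)+

lemma mass_nonneg: "dec_dens h \<Longrightarrow> 0 \<le> mass h"
  by (rule integral_lebesgue01_nonneg) (auto dest: dec_densD)

lemma dec_dens_const: "0 \<le> c \<Longrightarrow> dec_dens (\<lambda>_. c)"
  by (simp add: dec_dens_def)

lemma dec_dens_min: "dec_dens h \<Longrightarrow> 0 \<le> c \<Longrightarrow> dec_dens (\<lambda>x. min (h x) c)"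
  by (auto simp: dec_dens_def min_le_iff_disj)

lemma dec_dens_mult:
  assumes h: "dec_dens h" and [measurable]: "b \<in> borel_measurable borel"
    and b: "\<And>x. 0 < x \<Longrightarrow> x \<le> 1 \<Longrightarrow> 0 \<le> b x" "\<And>x. 0 < x \<Longrightarrow> x \<le> 1 \<Longrightarrow> b x \<le> B"
      "\<And>x y. 0 < x \<Longrightarrow> x \<le> y \<Longrightarrow> y \<le> 1 \<Longrightarrow> b y \<le> b x"
  shows "dec_dens (\<lambda>x. b x * h x)"
proof -
  note [measurable] = dec_densD(1)[OF h]
  have "integrable lebesgue01 (\<lambda>x. b x * h x)"
    by (rule integrable_lebesgue01_bound[of "\<lambda>x. B * h x"])
      (use b dec_densD[OF h] in \<open>auto simp: abs_mult intro!: mult_right_mono\<close>)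
  then show ?thesis using b dec_densD[OF h]
    unfolding dec_dens_def by (auto intro!: mult_mono mult_nonneg_nonneg elim: order.trans)
qed

lemma dec_dens_indicator: "dec_dens h \<Longrightarrow> dec_dens (\<lambda>x. indicator {..s} x * h x)"
  by (rule dec_dens_mult[where B = 1]) (auto simp: indicator_def)

text \<open>The left inverse branch and \<open>left_deriv\<close> both increase, so the left summand
  has a decreasing numerator over an increasing denominator; the right one is an affine
  reparametrisation. The summands are also stated separately because \<open>past_coupling\<close>
  follows each branch on its own.\<close>

lemma dec_dens_left:
  assumes h: "dec_dens h" and a: "0 \<le> a"
  shows "dec_dens (\<lambda>x. h (left_inv a x) / left_deriv a (left_inv a x))"
    and "dec_dens (\<lambda>x. h ((x + 1) / 2) / 2)"
    and "dec_dens (transfer a h)"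
proof -
  note [measurable] = dec_densD(1)[OF h] measurable_left_inv[OF a] measurable_left_deriv[OF a]
  note D = left_deriv_ge_1[OF a]
  have i: "integrable lebesgue01 (transfer a h)"
    by (rule integral_transfer(1)[OF dec_densD(1)[OF h] a dec_densD(3)[OF h]])
  have p1: "0 \<le> h (left_inv a x) / left_deriv a (left_inv a x)" if "0 < x" "x \<le> 1" for x
    using D[of "left_inv a x"] dec_densD(4)[OF h, of "left_inv a x"] left_inv_pos[OF a that(1)]
      left_inv_le_half[OF a that(2)] by auto
  have p2: "0 \<le> h ((x + 1) / 2) / 2" if "0 < x" "x \<le> 1" for x
    using dec_densD(4)[OF h, of "(x + 1) / 2"] that by auto
  have m1: "h (left_inv a y) / left_deriv a (left_inv a y) \<le> h (left_inv a x) / left_deriv a (left_inv a x)"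
    if "0 < x" "x \<le> y" "y \<le> 1" for x y
  proof (intro frac_le)
    show "0 \<le> h (left_inv a x)" "h (left_inv a y) \<le> h (left_inv a x)"
      using left_inv_pos[OF a that(1)] left_inv_le_half[OF a, of x] left_inv_le_half[OF a, of y]
        left_inv_mono[OF a that(2)] that by (auto intro!: dec_densD(4,5)[OF h])
    show "0 < left_deriv a (left_inv a x)" using D[of "left_inv a x"] by simp
    show "left_deriv a (left_inv a x) \<le> left_deriv a (left_inv a y)"
      using left_inv_pos[OF a, of x] left_inv_mono[OF a that(2)] that by (intro left_deriv_mono[OF a]) auto
  qed
  have m2: "h ((y + 1) / 2) / 2 \<le> h ((x + 1) / 2) / 2" if "0 < x" "x \<le> y" "y \<le> 1" for x y
    using dec_densD(5)[OF h, of "(x + 1) / 2" "(y + 1) / 2"] that by auto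
  have i1: "integrable lebesgue01 (\<lambda>x. h (left_inv a x) / left_deriv a (left_inv a x))"
    by (rule integrable_lebesgue01_bound[OF i])
      (use p1 p2 in \<open>force simp: transfer_def simp del: abs_divide\<close>)+
  have i2: "integrable lebesgue01 (\<lambda>x. h ((x + 1) / 2) / 2)"
    by (rule integrable_lebesgue01_bound[OF i])
      (use p1 p2 in \<open>force simp: transfer_def simp del: abs_divide\<close>)+
  show "dec_dens (\<lambda>x. h (left_inv a x) / left_deriv a (left_inv a x))"
    unfolding dec_dens_def using i1 p1 m1 by auto
  show "dec_dens (\<lambda>x. h ((x + 1) / 2) / 2)"
    unfolding dec_dens_def using i2 p2 m2 by auto
  show "dec_dens (transfer a h)"
    unfolding dec_dens_def transfer_def using i p1 p2 m1 m2 measurable_transfer[OF dec_densD(1)[OF h] a]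
    by (auto simp: transfer_def[abs_def] intro!: add_nonneg_nonneg add_mono)
qed

lemma powr_integral_lebesgue01:
  fixes b e :: real
  assumes "b < 1" "0 \<le> e" "e \<le> 1"
  shows "integrable lebesgue01 (\<lambda>x. indicator {..e} x * x powr - b)"
    "(\<integral>x. indicator {..e} x * x powr - b \<partial>lebesgue01) = e powr (1 - b) / (1 - b)"
proof -
  have "((\<lambda>x. x powr (- b)) has_integral (e powr (- b + 1) / (- b + 1))) {0..e}"
    using assms by (intro has_integral_powr_from_0) auto
  then have "(\<integral>\<^sup>+x. ennreal (indicator {0..e} x * x powr (- b)) \<partial>lborel) = ennreal (e powr (- b + 1) / (- b + 1))"
    by (rule nn_integral_has_integral_lebesgue[rotated]) auto
  moreover have "indicator {0..e} x * (x powr (- b)) = indicator {..e} x * x powr (- b) * indicator {0..1} x" for x :: real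
    using assms by (auto simp: indicator_def)
  ultimately have nn: "(\<integral>\<^sup>+x. indicator {..e} x * x powr - b \<partial>lebesgue01) = ennreal (e powr (1 - b) / (1 - b))"
    by (simp add: nn_integral_lebesgue01 ennreal_indicator[symmetric] ennreal_mult''[symmetric] add.commute
        del: ennreal_indicator)
  have [measurable]: "(\<lambda>x. indicator {..e} x * x powr - b) \<in> borel_measurable lebesgue01"
    by (rule borel_measurable_lebesgue01) simp
  show "integrable lebesgue01 (\<lambda>x. indicator {..e} x * x powr - b)"
    using nn by (intro integrableI_bounded) auto
  show "(\<integral>x. indicator {..e} x * x powr - b \<partial>lebesgue01) = e powr (1 - b) / (1 - b)"
    using nn assms by (subst integral_eq_nn_integral) auto
qed

lemma indicator_integral_lebesgue01:
  assumes "0 \<le> e" "e \<le> 1"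
  shows "(\<integral>x. indicator {..e} x \<partial>lebesgue01) = e"
proof -
  have "(\<integral>x. indicator {..e} x \<partial>lebesgue01) = (\<integral>x. indicator {..e} x * x powr - 0 \<partial>lebesgue01)"
    by (rule integral_lebesgue01_cong) auto
  then show ?thesis using powr_integral_lebesgue01(2)[of 0 e] assms by simp
qed

text \<open>The rectangle of width x and height \<open>h x\<close> lies below the graph of a
  decreasing density.\<close>

lemma dec_dens_le_mass:
  assumes h: "dec_dens h" and x: "0 < x" "x \<le> 1"
  shows "x * h x \<le> mass h"
proof -
  note [measurable] = dec_densD(1)[OF h]
  have "x * h x = mass (\<lambda>y. indicator {..x} y * h x)"
    using indicator_integral_lebesgue01[of x] x by simp
  also have "\<dots> \<le> mass h"
    by (rule integral_lebesgue01_mono[OF integrable_lebesgue01_bound[of "\<lambda>_. \<bar>h x\<bar>"] dec_densD(3)[OF h]])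
      (use x in \<open>auto simp: indicator_def intro!: dec_densD[OF h]\<close>)
  finally show ?thesis .
qed

subsection \<open>Compositions along a parameter sequence\<close>

text \<open>\<open>orbit \<alpha> q s\<close> starts at time s, so its first parameter has index
  \<open>Suc s\<close>. The first map is peeled off, unlike in \<open>iterated_map\<close>, because
  the inductions advance the initial density by one transfer operator at a time.\<close>

primrec orbit :: "(nat \<Rightarrow> real) \<Rightarrow> nat \<Rightarrow> nat \<Rightarrow> real \<Rightarrow> real" where
  "orbit \<alpha> 0 s x = x"
| "orbit \<alpha> (Suc q) s x = orbit \<alpha> q (Suc s) (intermittent_map (\<alpha> (Suc s)) x)"

primrec transfers :: "(nat \<Rightarrow> real) \<Rightarrow> nat \<Rightarrow> nat \<Rightarrow> (real \<Rightarrow> real) \<Rightarrow> real \<Rightarrow> real" where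
  "transfers \<alpha> 0 s h = h"
| "transfers \<alpha> (Suc q) s h = transfers \<alpha> q (Suc s) (transfer (\<alpha> (Suc s)) h)"

lemma orbit_add: "orbit \<alpha> (q + r) s x = orbit \<alpha> r (s + q) (orbit \<alpha> q s x)"
  by (induction q arbitrary: s x) auto

lemma transfers_add: "transfers \<alpha> (q + r) s h = transfers \<alpha> r (s + q) (transfers \<alpha> q s h)"
  by (induction q arbitrary: s h) auto

lemma iterated_map_eq_orbit: "iterated_map \<alpha> n x = orbit \<alpha> n 0 x"
proof (induction n)
  case (Suc n)
  then show ?case using orbit_add[of \<alpha> n 1 0 x] by simp
qed simp

lemma measurable_orbit [measurable]: "orbit \<alpha> q s \<in> borel_measurable borel"
proof (induction q arbitrary: s)
  case (Suc q)
  have "orbit \<alpha> (Suc q) s = orbit \<alpha> q (Suc s) \<circ> intermittent_map (\<alpha> (Suc s))" by auto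
  then show ?case using Suc measurable_intermittent_map by (metis measurable_comp)
next
  case 0
  have "orbit \<alpha> 0 s = (\<lambda>x. x)" by auto
  then show ?case by simp
qed

lemma transfers_diff: "transfers \<alpha> q s (\<lambda>x. h x - u x) x = transfers \<alpha> q s h x - transfers \<alpha> q s u x"
proof (induction q arbitrary: s h u)
  case (Suc q)
  have "transfer (\<alpha> (Suc s)) (\<lambda>x. h x - u x) = (\<lambda>x. transfer (\<alpha> (Suc s)) h x - transfer (\<alpha> (Suc s)) u x)"
    by (simp add: transfer_diff fun_eq_iff)
  then show ?case by (simp add: Suc)
qed simp

lemma transfers_add_fun: "transfers \<alpha> q s (\<lambda>x. h x + u x) x = transfers \<alpha> q s h x + transfers \<alpha> q s u x"
proof (induction q arbitrary: s h u)
  case (Suc q)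
  have "transfer (\<alpha> (Suc s)) (\<lambda>x. h x + u x) = (\<lambda>x. transfer (\<alpha> (Suc s)) h x + transfer (\<alpha> (Suc s)) u x)"
    by (simp add: transfer_add fun_eq_iff)
  then show ?case by (simp add: Suc)
qed simp

lemma transfers_cmult: "transfers \<alpha> q s (\<lambda>x. c * h x) x = c * transfers \<alpha> q s h x"
proof (induction q arbitrary: s h)
  case (Suc q)
  have "transfer (\<alpha> (Suc s)) (\<lambda>x. c * h x) = (\<lambda>x. c * transfer (\<alpha> (Suc s)) h x)"
    by (simp add: transfer_cmult fun_eq_iff)
  then show ?case by (simp add: Suc)
qed simp

locale admissible =
  fixes \<beta> :: real and \<alpha> :: "nat \<Rightarrow> real"
  assumes beta: "0 < \<beta>" "\<beta> < 1/3"
    and alpha: "\<And>n. n \<ge> 1 \<Longrightarrow> 0 \<le> \<alpha> n \<and> \<alpha> n \<le> \<beta>"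
begin

lemma alpha_Suc: "0 \<le> \<alpha> (Suc n)" "\<alpha> (Suc n) \<le> \<beta>"
  using alpha[of "Suc n"] by auto

lemma orbit_in: "x \<in> {0..1} \<Longrightarrow> orbit \<alpha> q s x \<in> {0..1}"
  by (induction q arbitrary: s x) (use intermittent_map_in alpha_Suc(1) in auto)

lemma transfers_mono:
  assumes "0 < x" "x \<le> 1" "\<And>x. 0 < x \<Longrightarrow> x \<le> 1 \<Longrightarrow> h x \<le> u x"
  shows "transfers \<alpha> q s h x \<le> transfers \<alpha> q s u x"
  using assms
proof (induction q arbitrary: s h u)
  case (Suc q)
  then show ?case by (auto intro!: Suc.IH transfer_mono alpha_Suc)
qed simp

lemma dec_dens_transfers: "dec_dens h \<Longrightarrow> dec_dens (transfers \<alpha> q s h)"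
  by (induction q arbitrary: s h) (auto intro: dec_dens_left alpha_Suc)

lemma integral_transfers:
  assumes "h \<in> borel_measurable borel" "integrable lebesgue01 h"
  shows "integrable lebesgue01 (transfers \<alpha> q s h)" "mass (transfers \<alpha> q s h) = mass h"
proof -
  have "integrable lebesgue01 (transfers \<alpha> q s h) \<and> mass (transfers \<alpha> q s h) = mass h"
    using assms
  proof (induction q arbitrary: s h)
    case (Suc q)
    note * = measurable_transfer[OF Suc.prems(1) alpha_Suc(1)]
      integral_transfer[OF Suc.prems(1) alpha_Suc(1) Suc.prems(2)]
    show ?case using Suc.IH[OF *(1,2)] *(3) by simp
  qed auto
  then show "integrable lebesgue01 (transfers \<alpha> q s h)" "mass (transfers \<alpha> q s h) = mass h" by auto
qed

lemma mass_transfers: "dec_dens h \<Longrightarrow> mass (transfers \<alpha> q s h) = mass h"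
  by (intro integral_transfers dec_densD)

lemma integrable_bounded_mult:
  fixes h G :: "real \<Rightarrow> real"
  assumes [measurable]: "h \<in> borel_measurable borel" "G \<in> borel_measurable borel"
    and h: "integrable lebesgue01 h" and G: "\<And>x. x \<in> {0..1} \<Longrightarrow> \<bar>G x\<bar> \<le> B"
  shows "integrable lebesgue01 (\<lambda>x. G x * h x)"
  by (rule integrable_lebesgue01_bound[of "\<lambda>x. B * \<bar>h x\<bar>"])
    (use h G in \<open>auto simp: abs_mult intro!: mult_right_mono\<close>)

text \<open>A function of the orbit after the first map takes the same value at both preimages of a
  point, so it can be pulled out of the transfer operator; mass preservation then gives one step of
  the induction.\<close>

lemma transfers_dual:
  assumes h: "h \<in> borel_measurable borel" "integrable lebesgue01 h"
    and G: "G \<in> borel_measurable borel" "\<And>x. x \<in> {0..1} \<Longrightarrow> \<bar>G x\<bar> \<le> B"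
  shows "mass (\<lambda>x. G (orbit \<alpha> q s x) * h x) = mass (\<lambda>x. G x * transfers \<alpha> q s h x)"
  using h
proof (induction q arbitrary: s h)
  case (Suc q)
  let ?a = "\<alpha> (Suc s)"
  let ?Q = "\<lambda>x. G (orbit \<alpha> (Suc q) s x) * h x"
  note [measurable] = Suc.prems(1) G(1)
  note [measurable] = measurable_transfer[OF Suc.prems(1) alpha_Suc(1)[of s]]
  have Q: "?Q \<in> borel_measurable borel" by simp
  have iQ: "integrable lebesgue01 ?Q"
    by (rule integrable_bounded_mult[where B = B]) (use Suc.prems G orbit_in in \<open>auto simp del: orbit.simps\<close>)
  have "mass ?Q = mass (transfer ?a ?Q)"
    using integral_transfer(2)[OF Q alpha_Suc(1)[of s] iQ] by simp
  also have "\<dots> = mass (\<lambda>x. G (orbit \<alpha> q (Suc s) x) * transfer ?a h x)"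
  proof (rule integral_lebesgue01_cong)
    show "transfer ?a ?Q \<in> borel_measurable borel" by (rule measurable_transfer[OF Q alpha_Suc(1)])
    show "transfer ?a ?Q x = G (orbit \<alpha> q (Suc s) x) * transfer ?a h x" if "0 < x" "x < 1" for x
      using that alpha_Suc(1)[of s] intermittent_map_right_inv[of x "\<alpha> (Suc s)"]
      by (simp add: transfer_def intermittent_map_left_inv distrib_left)
  qed simp
  also have "\<dots> = mass (\<lambda>x. G x * transfers \<alpha> q (Suc s) (transfer ?a h) x)"
    by (rule Suc.IH) (use integral_transfer(1)[OF Suc.prems(1) alpha_Suc(1) Suc.prems(2)] in auto)
  finally show ?case by simp
qed simp

section \<open>A pointwise bound near 0 that every transfer operator preserves\<close>

text \<open>For numbers below 1 a smaller exponent gives a larger power, so the nonlinearity of any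
  admissible map is at least that of the slowest one. In the second form a gain proportional to
  \<open>branch_pow\<close> becomes a constant gain after multiplication by
  \<open>x powr - \<beta>\<close>.\<close>

lemma powr_branch_pow_ge:
  assumes x: "0 < x" "x \<le> 1" "x \<le> 2 * y" and a: "0 \<le> a" "a \<le> \<beta>"
  shows "x powr \<beta> \<le> branch_pow a y" "1 \<le> x powr - \<beta> * branch_pow a y"
proof -
  show le: "x powr \<beta> \<le> branch_pow a y"
  proof (cases "a = 0")
    case True
    then show ?thesis using x beta by (simp add: branch_pow_def powr_le1)
  next
    case False
    have "x powr \<beta> \<le> x powr a" using x a by (intro powr_mono') auto
    also have "\<dots> \<le> (2 * y) powr a" using x a by (intro powr_mono2) auto
    finally show ?thesis using False x by (simp add: branch_pow_def)
  qed
  show "1 \<le> x powr - \<beta> * branch_pow a y" using le x by (simp add: powr_minus divide_simps)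
qed

text \<open>Bernoulli's inequality, obtained as the weighted mean inequality for 1 + p and
  1.\<close>

lemma one_plus_powr_le:
  assumes "0 \<le> p" shows "(1 + p) powr \<beta> \<le> 1 + \<beta> * p"
  using Youngs_inequality_0[of \<beta> "1 - \<beta>" "1 + p" 1] beta assms by (simp add: algebra_simps)

text \<open>The right branch contributes at most m, by the rectangle bound at a point beyond 1/2.
  The left branch multiplies the bound by \<open>(1 + p) powr \<beta> / left_deriv a y\<close>,
  which is at most 1 - 2/7 p: the surplus 1 + a - \<beta> of the slope is at least 2/3, and the
  derivative is at most 7/3. Since \<open>x powr - \<beta> * p\<close> is at least 1, the saving 2/7
  of 7/2 m pays exactly for the right branch.\<close>

lemma tail_transfer:
  assumes h: "dec_dens h" and m: "mass h \<le> m"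
    and t: "\<And>x. 0 < x \<Longrightarrow> x \<le> 1 \<Longrightarrow> h x \<le> 7/2 * m * x powr - \<beta>"
    and a: "0 \<le> a" "a \<le> \<beta>" and x: "0 < x" "x \<le> 1"
  shows "transfer a h x \<le> 7/2 * m * x powr - \<beta>"
proof -
  have m0: "0 \<le> m" using mass_nonneg[OF h] m by simp
  define y where "y = left_inv a x"
  have y: "0 < y" "y \<le> 1/2" "left_branch a y = x"
    using x a left_inv_le_half[of a x] by (auto simp: y_def left_inv_pos)
  define p where "p = branch_pow a y"
  have p: "0 \<le> p" "p \<le> 1" using y a by (auto simp: p_def branch_pow_nonneg branch_pow_le_1)
  have xy: "x = y * (1 + p)" using y by (simp add: left_branch_def p_def)
  have D: "left_deriv a y = 1 + (1 + a) * p" by (simp add: left_deriv_def p_def)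
  have D1: "1 \<le> left_deriv a y" by (rule left_deriv_ge_1[OF a(1)])
  have D3: "left_deriv a y \<le> 7/3" using left_deriv_le[OF a(1), of y] y a beta by simp
  have "h ((x + 1) / 2) / 2 \<le> m"
  proof -
    have nn: "0 \<le> h ((x + 1) / 2)" using x by (intro dec_densD(4)[OF h]) auto
    have "h ((x + 1) / 2) / 2 \<le> (x + 1) / 2 * h ((x + 1) / 2)"
      using x nn by (simp add: field_simps)
    also have "\<dots> \<le> mass h" using x by (intro dec_dens_le_mass[OF h]) auto
    finally show ?thesis using m by simp
  qed
  moreover have "h y / left_deriv a y \<le> 7/2 * m * x powr - \<beta> - m"
  proof -
    have "(1 + p) powr \<beta> \<le> 1 + \<beta> * p" by (rule one_plus_powr_le[OF p(1)])
    then have "(1 + p) powr \<beta> / left_deriv a y \<le> (1 + \<beta> * p) / left_deriv a y"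
      using D1 by (intro divide_right_mono) auto
    also have "\<dots> \<le> 1 - 2/7 * p"
    proof -
      have "(2/3) * p \<le> (1 + a - \<beta>) * p" using p a beta by (intro mult_right_mono) auto
      moreover have "2/7 * p * left_deriv a y \<le> 2/7 * p * (7/3)" using p D3 by (intro mult_left_mono) auto
      moreover have "1 + \<beta> * p \<le> left_deriv a y - (1 + a - \<beta>) * p" by (simp add: D algebra_simps)
      ultimately have "1 + \<beta> * p \<le> (1 - 2/7 * p) * left_deriv a y" unfolding left_diff_distrib by linarith
      then show ?thesis using D1 by (simp add: divide_le_eq)
    qed
    finally have c: "(1 + p) powr \<beta> / left_deriv a y \<le> 1 - 2/7 * p" .
    have "x \<le> 2 * y" using xy p y by (simp add: algebra_simps)
    then have xp: "1 \<le> x powr - \<beta> * p" unfolding p_def by (rule powr_branch_pow_ge(2)[OF x _ a])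
    have "h y / left_deriv a y \<le> 7/2 * m * y powr - \<beta> / left_deriv a y"
      using t[of y] y D1 by (intro divide_right_mono) auto
    also have "y powr - \<beta> = x powr - \<beta> * (1 + p) powr \<beta>"
      using y p by (simp add: xy powr_mult powr_minus)
    also have "7/2 * m * (x powr - \<beta> * (1 + p) powr \<beta>) / left_deriv a y =
        7/2 * m * x powr - \<beta> * ((1 + p) powr \<beta> / left_deriv a y)" by simp
    also have "\<dots> \<le> 7/2 * m * x powr - \<beta> * (1 - 2/7 * p)"
      using m0 by (intro mult_left_mono[OF c]) auto
    also have "\<dots> = 7/2 * m * x powr - \<beta> - m * (x powr - \<beta> * p)" by (simp add: field_simps)
    also have "\<dots> \<le> 7/2 * m * x powr - \<beta> - m * 1"
      using m0 xp by (intro diff_left_mono mult_left_mono) auto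
    finally show ?thesis by simp
  qed
  ultimately show ?thesis unfolding transfer_def y_def by linarith
qed

lemma tail_transfers:
  assumes "dec_dens h" "mass h \<le> m" "\<And>x. 0 < x \<Longrightarrow> x \<le> 1 \<Longrightarrow> h x \<le> 7/2 * m * x powr - \<beta>" "0 < x" "x \<le> 1"
  shows "transfers \<alpha> q s h x \<le> 7/2 * m * x powr - \<beta>"
  using assms
proof (induction q arbitrary: s h)
  case (Suc q)
  let ?h = "transfer (\<alpha> (Suc s)) h"
  have "dec_dens ?h" by (rule dec_dens_left[OF Suc.prems(1) alpha_Suc(1)])
  moreover have "mass ?h \<le> m"
    using integral_transfer(2)[OF dec_densD(1) alpha_Suc(1) dec_densD(3)] Suc.prems(1,2) by simp
  moreover have "?h x \<le> 7/2 * m * x powr - \<beta>" if "0 < x" "x \<le> 1" for x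
    by (rule tail_transfer[OF Suc.prems(1-3)]) (use that alpha_Suc in auto)
  ultimately show ?case using Suc.IH[of ?h] Suc.prems by simp
qed simp

subsection \<open>Minorisation\<close>

text \<open>A Lyapunov functional: for the slowest map, \<open>x powr - \<beta>\<close> is of the
  order of the time a point x near 0 needs to get away from 0.\<close>

definition potential :: "(real \<Rightarrow> real) \<Rightarrow> real" where
  "potential h = mass (\<lambda>x. x powr - \<beta> * h x)"

text \<open>One step along the left branch lowers \<open>z powr - \<beta>\<close> by a fixed amount,
  wherever z is. The factor \<open>(1 + p) powr - \<beta>\<close> is at most 1 - \<beta> p / 4,
  through ln (1 + p) \<ge> p / 2 and exp (-t) \<le> 1 / (1 + t), and p times
  \<open>z powr - \<beta>\<close> is at least 1.\<close>

lemma left_branch_powr_le: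
  assumes z: "0 < z" "z \<le> 1/2" and a: "0 \<le> a" "a \<le> \<beta>"
  shows "left_branch a z powr - \<beta> \<le> z powr - \<beta> - \<beta> / 4"
proof -
  define p where "p = branch_pow a z"
  have p: "0 \<le> p" "p \<le> 1" using z a by (auto simp: p_def branch_pow_nonneg branch_pow_le_1)
  have "p / 2 \<le> ln (1 + p)"
  proof -
    have "ln (1 / (1 + p)) \<le> 1 / (1 + p) - 1" using p by (intro ln_le_minus_one) auto
    then have "1 - 1 / (1 + p) \<le> ln (1 + p)" using p by (simp add: ln_div)
    moreover have "p / 2 \<le> 1 - 1 / (1 + p)" using p mult_left_mono[of p 1 p] by (simp add: field_simps)
    ultimately show ?thesis by simp
  qed
  then have "\<beta> * (p / 2) \<le> \<beta> * ln (1 + p)" using beta by (intro mult_left_mono) auto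
  then have "(1 + p) powr - \<beta> \<le> exp (- (\<beta> * p / 2))" using p by (simp add: powr_def)
  also have "\<dots> \<le> 1 / (1 + \<beta> * p / 2)"
  proof -
    have "0 \<le> \<beta> * p" using p beta by simp
    then have "1 / exp (\<beta> * p / 2) \<le> 1 / (1 + \<beta> * p / 2)"
      using exp_ge_add_one_self[of "\<beta> * p / 2"] by (intro frac_le) auto
    then show ?thesis by (simp add: exp_minus inverse_eq_divide)
  qed
  also have "\<dots> \<le> 1 - \<beta> * p / 4"
  proof -
    have "\<beta> * p \<le> 1 * 1" using p beta by (intro mult_mono) auto
    moreover have "0 \<le> \<beta> * p" using p beta by auto
    ultimately have "1 \<le> (1 - \<beta> * p / 4) * (1 + \<beta> * p / 2)"
      using mult_left_mono[of "\<beta> * p" 1 "\<beta> * p"] by (simp add: field_simps)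
    then show ?thesis using \<open>0 \<le> \<beta> * p\<close> by (simp add: divide_le_eq)
  qed
  finally have le: "(1 + p) powr - \<beta> \<le> 1 - \<beta> * p / 4" .
  have zp: "1 \<le> z powr - \<beta> * p" unfolding p_def using z by (intro powr_branch_pow_ge a) auto
  have "left_branch a z powr - \<beta> = z powr - \<beta> * (1 + p) powr - \<beta>"
    using z p by (simp add: left_branch_def p_def[symmetric] powr_mult)
  also have "\<dots> \<le> z powr - \<beta> * (1 - \<beta> * p / 4)" by (intro mult_left_mono[OF le]) auto
  also have "\<dots> = z powr - \<beta> - \<beta> / 4 * (z powr - \<beta> * p)" by (simp add: field_simps)
  also have "\<dots> \<le> z powr - \<beta> - \<beta> / 4 * 1"
    using zp beta by (intro diff_left_mono mult_left_mono) auto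
  finally show ?thesis by simp
qed

lemma one_minus_beta_bound: "1 / (1 - \<beta>) \<le> 3/2"
  using beta by (simp add: field_simps)

lemma integrable_powr: "integrable lebesgue01 (\<lambda>x. x powr - \<beta>)"
  and integral_powr: "mass (\<lambda>x. x powr - \<beta>) \<le> 3/2"
proof -
  note P = powr_integral_lebesgue01[of \<beta> 1]
  show "integrable lebesgue01 (\<lambda>x. x powr - \<beta>)"
    by (rule integrable_lebesgue01_bound[OF P(1)]) (use beta in \<open>auto simp: indicator_def\<close>)
  have "mass (\<lambda>x. x powr - \<beta>) = mass (\<lambda>x. indicator {..1} x * x powr - \<beta>)"
    by (rule integral_lebesgue01_cong) (auto simp: indicator_def)
  then show "mass (\<lambda>x. x powr - \<beta>) \<le> 3/2"
    using P(2) one_minus_beta_bound beta by simp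
qed

lemma integrable_powr_mult:
  assumes [measurable]: "h \<in> borel_measurable borel" and h: "\<And>x. 0 < x \<Longrightarrow> x \<le> 1 \<Longrightarrow> \<bar>h x\<bar> \<le> B"
  shows "integrable lebesgue01 (\<lambda>x. x powr - \<beta> * h x)"
  by (rule integrable_lebesgue01_bound[of "\<lambda>x. x powr - \<beta> * B"])
    (use h in \<open>auto intro!: integrable_powr mult_left_mono simp: abs_mult\<close>)

lemma integrable_mult_indicator:
  fixes h :: "real \<Rightarrow> real"
  assumes [measurable]: "h \<in> borel_measurable borel" "A \<in> sets borel" and "integrable lebesgue01 h"
  shows "integrable lebesgue01 (\<lambda>x. indicator A x * h x)"
  by (rule integrable_lebesgue01_bound[of "\<lambda>x. \<bar>h x\<bar>"]) (use assms in \<open>auto simp: indicator_def\<close>)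

text \<open>To the right of 1/2 the density is at most \<open>h (1/2)\<close>, and the rectangle of
  that height over the left half fits below the graph.\<close>

lemma half_mass_left:
  assumes h: "dec_dens h"
  shows "mass h / 2 \<le> mass (\<lambda>x. indicator {..1/2} x * h x)"
proof -
  define I where "I = (indicator {..1/2} :: real \<Rightarrow> real)"
  note [measurable] = dec_densD(1)[OF h]
  have [measurable]: "I \<in> borel_measurable borel" by (simp add: I_def)
  have i: "integrable lebesgue01 (\<lambda>x. I x * h x)"
    unfolding I_def by (rule integrable_mult_indicator) (auto intro: dec_densD[OF h])
  have iI: "integrable lebesgue01 I"
    by (rule integrable_lebesgue01_bound[of "\<lambda>_. 1"]) (auto simp: I_def indicator_def)
  have I2: "mass I = 1/2"
    using indicator_integral_lebesgue01[of "1/2"] unfolding I_def by simp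
  have "mass h \<le> mass (\<lambda>x. I x * h x + (h (1/2) - I x * h (1/2)))"
  proof (rule integral_lebesgue01_mono)
    fix x :: real assume "0 < x" "x < 1"
    then show "h x \<le> I x * h x + (h (1/2) - I x * h (1/2))"
      by (auto simp: I_def indicator_def intro!: dec_densD(5)[OF h])
  qed (use i iI dec_densD(3)[OF h] in auto)
  also have "\<dots> = mass (\<lambda>x. I x * h x) + (h (1/2) - 1/2 * h (1/2))"
    using iI i I2 lebesgue01.prob_space by simp
  also have le: "h (1/2) - 1/2 * h (1/2) \<le> mass (\<lambda>x. I x * h x)"
    using dec_dens_le_mass[OF dec_dens_indicator[OF h, of "1/2"], of "1/2"] unfolding I_def by simp
  finally show ?thesis unfolding I_def by simp
qed

text \<open>A drift inequality. Every point of the left half loses \<beta>/4 of potential, and the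
  left half carries at least half of the mass, which gives \<beta>/8. The right branch reinjects
  mass with density at most \<open>h (1/2) / 2\<close>, whose potential is at most 3/2 times that
  number. The bound \<open>B\<close> makes the potentials finite.\<close>

lemma potential_transfer:
  assumes h: "dec_dens h" and B: "\<And>x. 0 < x \<Longrightarrow> x \<le> 1 \<Longrightarrow> h x \<le> B" and a: "0 \<le> a" "a \<le> \<beta>"
  shows "potential (transfer a h) \<le> potential h - \<beta> / 8 * mass h + 3/4 * h (1/2)"
proof -
  let ?I = "indicator {..1/2} :: real \<Rightarrow> real"
  \<comment> \<open>The left contribution with its drift is packed into one function supported on
    \<open>{..1/2}\<close>. At the right preimage of a positive x it vanishes, so
    \<open>transfer a q\<close> is the left term alone and its mass is that of
    \<open>q\<close>.\<close>
  define q where "q = (\<lambda>z. ?I z * (z powr - \<beta> * h z) - \<beta> / 4 * (?I z * h z))"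
  note [measurable] = dec_densD(1)[OF h]
  have h0: "0 \<le> h (1/2)" by (rule dec_densD(4)[OF h]) auto
  have absB: "\<bar>h x\<bar> \<le> B" if "0 < x" "x \<le> 1" for x using B[OF that] dec_densD(4)[OF h that] by simp
  have iV: "integrable lebesgue01 (\<lambda>x. x powr - \<beta> * h x)"
    by (rule integrable_powr_mult[where B = B]) (use absB in auto)
  have i1: "integrable lebesgue01 (\<lambda>z. ?I z * (z powr - \<beta> * h z))"
    by (rule integrable_mult_indicator) (use iV in auto)
  have i2: "integrable lebesgue01 (\<lambda>z. ?I z * h z)"
    by (rule integrable_mult_indicator) (use dec_densD(3)[OF h] in auto)
  have iq: "integrable lebesgue01 q" using i1 i2 by (simp add: q_def)
  have mq: "q \<in> borel_measurable borel" by (simp add: q_def)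
  have hl: "h y / left_deriv a y \<le> B" if "0 < y" "y \<le> 1" for y
  proof -
    have "h y / left_deriv a y \<le> h y / 1"
      using left_deriv_ge_1[OF a(1), of y] dec_densD(4)[OF h, of y] that by (intro divide_left_mono) auto
    then show ?thesis using B[of y] that by simp
  qed
  have tB: "\<bar>transfer a h x\<bar> \<le> B + B" if "0 < x" "x \<le> 1" for x
  proof -
    have "0 \<le> transfer a h x" using dec_densD(4)[OF dec_dens_left(3)[OF h a(1)] that] .
    moreover have "h ((x + 1) / 2) / 2 \<le> B"
      using B[of "(x + 1) / 2"] dec_densD(4)[OF h, of "(x + 1) / 2"] that by simp
    moreover have "h (left_inv a x) / left_deriv a (left_inv a x) \<le> B"
      using left_inv_pos[OF a(1), of x] left_inv_le_half[OF a(1), of x] that by (intro hl) auto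
    ultimately show ?thesis by (simp add: transfer_def)
  qed
  have "potential (transfer a h) \<le> mass (\<lambda>x. transfer a q x + x powr - \<beta> * (h (1/2) / 2))"
    unfolding potential_def
  proof (rule integral_lebesgue01_mono)
    show "integrable lebesgue01 (\<lambda>x. x powr - \<beta> * transfer a h x)"
      using tB by (intro integrable_powr_mult[where B = "B + B"]) (auto intro: measurable_transfer a)
    show "integrable lebesgue01 (\<lambda>x. transfer a q x + x powr - \<beta> * (h (1/2) / 2))"
      using integral_transfer(1)[OF mq a(1) iq] integrable_powr by auto
    fix x :: real assume x: "0 < x" "x < 1"
    define y where "y = left_inv a x"
    have y: "0 < y" "y \<le> 1/2" "left_branch a y = x"
      using x a left_inv_le_half[OF a(1), of x] by (auto simp: y_def left_inv_pos)
    have D: "0 < left_deriv a y" using left_deriv_ge_1[OF a(1), of y] by simp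
    have hy: "0 \<le> h y" using y by (intro dec_densD(4)[OF h]) auto
    have "x powr - \<beta> * (h y / left_deriv a y) \<le> (y powr - \<beta> - \<beta> / 4) * (h y / left_deriv a y)"
      using left_branch_powr_le[OF y(1,2) a] y(3) hy D by (intro mult_right_mono) auto
    also have "\<dots> = q y / left_deriv a y" using y by (simp add: q_def left_diff_distrib diff_divide_distrib)
    also have "\<dots> = transfer a q x"
      using x by (simp add: transfer_def y_def[symmetric]) (simp add: q_def)
    finally have 1: "x powr - \<beta> * (h y / left_deriv a y) \<le> transfer a q x" .
    have "x powr - \<beta> * (h ((x + 1) / 2) / 2) \<le> x powr - \<beta> * (h (1/2) / 2)"
      using x by (intro mult_left_mono divide_right_mono dec_densD(5)[OF h]) auto
    then show "x powr - \<beta> * transfer a h x \<le> transfer a q x + x powr - \<beta> * (h (1/2) / 2)"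
      using 1 by (simp add: transfer_def[of a h] y_def[symmetric] distrib_left)
  qed
  also have "\<dots> = mass q + mass (\<lambda>x. x powr - \<beta>) * (h (1/2) / 2)"
    using integral_transfer[OF mq a(1) iq] integrable_powr by simp
  also have "mass q = mass (\<lambda>z. ?I z * (z powr - \<beta> * h z)) - \<beta> / 4 * mass (\<lambda>z. ?I z * h z)"
    unfolding q_def using i1 i2 by simp
  also have "mass (\<lambda>z. ?I z * (z powr - \<beta> * h z)) \<le> potential h"
    unfolding potential_def
    by (rule integral_lebesgue01_mono[OF i1 iV]) (auto simp: indicator_def intro!: dec_densD[OF h])
  also have "mass (\<lambda>x. x powr - \<beta>) * (h (1/2) / 2) \<le> 3/2 * (h (1/2) / 2)"
    using integral_powr h0 by (intro mult_right_mono) auto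
  also have "potential h - \<beta> / 4 * mass (\<lambda>z. ?I z * h z) \<le> potential h - \<beta> / 4 * (mass h / 2)"
    using half_mass_left[OF h] beta by (intro diff_left_mono mult_left_mono) auto
  finally show ?thesis by simp
qed

text \<open>The growth by a factor 2 per step is crude; only finiteness matters, so that the drift
  inequality can be applied to every iterate.\<close>

lemma transfers_bounded:
  assumes "dec_dens h" "\<And>x. 0 < x \<Longrightarrow> x \<le> 1 \<Longrightarrow> h x \<le> B" "0 < x" "x \<le> 1"
  shows "transfers \<alpha> q s h x \<le> 2 ^ q * B"
  using assms
proof (induction q arbitrary: s h B)
  case (Suc q)
  let ?a = "\<alpha> (Suc s)" and ?h = "transfer (\<alpha> (Suc s)) h"
  note a = alpha_Suc(1)[of s]
  have "?h x \<le> 2 * B" if x: "0 < x" "x \<le> 1" for x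
  proof -
    have y: "0 < left_inv ?a x" "left_inv ?a x \<le> 1"
      using left_inv_pos[OF a x(1)] left_inv_le_half[OF a x(2)] by auto
    have "h (left_inv ?a x) / left_deriv ?a (left_inv ?a x) \<le> h (left_inv ?a x) / 1"
      using left_deriv_ge_1[OF a, of "left_inv ?a x"] dec_densD(4)[OF Suc.prems(1) y]
      by (intro divide_left_mono) auto
    moreover have "h ((x + 1) / 2) \<le> B" "0 \<le> h ((x + 1) / 2)"
      using x Suc.prems(2) dec_densD(4)[OF Suc.prems(1)] by auto
    ultimately show ?thesis using Suc.prems(2)[OF y] unfolding transfer_def by linarith
  qed
  then have "transfers \<alpha> q (Suc s) ?h x \<le> 2 ^ q * (2 * B)"
    by (intro Suc.IH dec_dens_left Suc.prems a) (use Suc.prems in auto)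
  then show ?case by simp
qed simp

text \<open>As long as the value at 1/2 stays below \<beta>/12 of the mass, the reinjected potential
  is at most 3/4 * \<beta>/12 = \<beta>/16 of the mass, and each step loses a net \<beta>/8 -
  \<beta>/16 = \<beta>/16. After more than 16 R / \<beta> such steps the potential would be
  negative.\<close>

lemma escape_from_zero:
  assumes h: "dec_dens h" and B: "\<And>x. 0 < x \<Longrightarrow> x \<le> 1 \<Longrightarrow> h x \<le> B"
    and R0: "0 \<le> R" and R: "potential h \<le> R * mass h" and n: "16 / \<beta> * R < real n"
  shows "\<exists>j<n. \<beta> / 12 * mass h \<le> transfers \<alpha> j s h (1/2)"
proof (rule ccontr)
  assume "\<not> ?thesis"
  then have small: "transfers \<alpha> j s h (1/2) < \<beta> / 12 * mass h" if "j < n" for j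
    using that by (auto simp: not_le)
  have step: "potential (transfers \<alpha> j s h) \<le> potential h - real j * (\<beta> / 16 * mass h)" if "j \<le> n" for j
    using that
  proof (induction j)
    case (Suc j)
    let ?h = "transfers \<alpha> j s h"
    have "transfers \<alpha> (Suc j) s h = transfer (\<alpha> (Suc (s + j))) ?h"
      using transfers_add[of \<alpha> j 1 s h] by simp
    moreover have "potential (transfer (\<alpha> (Suc (s + j))) ?h) \<le> potential ?h - \<beta> / 8 * mass ?h + 3/4 * ?h (1/2)"
      by (rule potential_transfer[OF dec_dens_transfers[OF h] transfers_bounded[OF h B] alpha_Suc])
    ultimately have "potential (transfers \<alpha> (Suc j) s h) \<le> potential ?h - \<beta> / 8 * mass ?h + 3/4 * ?h (1/2)"
      by simp
    then have "potential (transfers \<alpha> (Suc j) s h) \<le> potential ?h - \<beta> / 8 * mass h + 3/4 * ?h (1/2)"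
      by (simp only: mass_transfers[OF h])
    moreover have "real (Suc j) * (\<beta> / 16 * mass h) = real j * (\<beta> / 16 * mass h) + \<beta> / 16 * mass h"
      by (simp add: distrib_right)
    moreover have "potential ?h \<le> potential h - real j * (\<beta> / 16 * mass h)" "?h (1/2) < \<beta> / 12 * mass h"
      using Suc.IH Suc.prems small[of j] by auto
    ultimately show ?case by linarith
  qed simp
  have "0 \<le> 16 / \<beta> * R" using R0 beta by simp
  then have "n > 0" using n by (cases n) auto
  have m: "0 < mass h"
  proof -
    have "0 \<le> transfers \<alpha> 0 s h (1/2)" by (rule dec_densD(4)[OF dec_dens_transfers[OF h]]) auto
    then have "0 < \<beta> / 12 * mass h" using small[OF \<open>n > 0\<close>] by linarith
    then show ?thesis using beta by (simp add: zero_less_mult_iff)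
  qed
  have "0 \<le> potential (transfers \<alpha> n s h)" unfolding potential_def
    by (rule integral_lebesgue01_nonneg) (auto intro!: mult_nonneg_nonneg dec_densD(4)[OF dec_dens_transfers[OF h]])
  also have "\<dots> \<le> R * mass h - real n * (\<beta> / 16 * mass h)" using step[of n] R by simp
  also have "\<dots> = (R - real n * \<beta> / 16) * mass h" by (simp add: algebra_simps)
  also have "\<dots> < 0" using n m beta by (intro mult_neg_pos) (auto simp: field_simps)
  finally show False by simp
qed

text \<open>Only the chain of left preimages is followed. Each step costs the factor
  \<open>left_deriv\<close>, at most 3, and moves the point closer to 0 by a factor of at least
  \<open>1 + \<delta> powr \<beta>\<close> until it is below \<delta>; from there on monotonicity
  allows evaluation at \<delta>.\<close>

lemma transfers_chain:
  assumes h: "dec_dens h" and d: "0 < \<delta>" "\<delta> \<le> 1" and x: "0 < x" "x \<le> 1"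
  shows "h (max \<delta> (x / (1 + \<delta> powr \<beta>) ^ r)) / 3 ^ r \<le> transfers \<alpha> r s h x"
  using x
proof (induction r arbitrary: x)
  case 0
  then show ?case using d by (auto intro!: dec_densD(5)[OF h])
next
  case (Suc r)
  define a where "a = \<alpha> (Suc (s + r))"
  have a: "0 \<le> a" "a \<le> \<beta>" by (auto simp: a_def alpha_Suc)
  define y where "y = left_inv a x"
  have y: "0 < y" "y \<le> 1/2" "y \<le> x" "left_branch a y = x" "x \<le> 2 * y"
    using Suc.prems a left_inv_le_half[OF a(1), of x] left_inv_ge[OF a(1), of x]
    by (auto simp: y_def left_inv_pos left_inv_le)
  define Q where "Q = 1 + \<delta> powr \<beta>"
  have Q: "1 \<le> Q" by (simp add: Q_def)
  let ?h = "transfers \<alpha> r s h"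
  have dh: "dec_dens ?h" by (rule dec_dens_transfers[OF h])
  \<comment> \<open>Below \<delta> both maxima equal \<delta> because preimages move towards 0.
    Above \<delta> the inverse branch divides by at least \<open>Q\<close>.\<close>
  have le: "max \<delta> (y / Q ^ r) \<le> max \<delta> (x / Q ^ Suc r)"
  proof (cases "x \<le> \<delta>")
    case True
    have "y / Q ^ r \<le> y / 1" using y Q by (intro divide_left_mono) auto
    then show ?thesis using True y by auto
  next
    case False
    have "\<delta> powr \<beta> \<le> branch_pow a y" using d False y by (intro powr_branch_pow_ge a) auto
    then have "y * Q \<le> x"
      using y unfolding Q_def by (metis left_branch_def add_left_mono mult_left_mono less_imp_le)
    then have "y \<le> x / Q" using Q by (simp add: le_divide_eq)
    then have "y / Q ^ r \<le> x / Q / Q ^ r" using Q by (intro divide_right_mono) auto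
    then show ?thesis by (intro max.mono) auto
  qed
  have "x / Q ^ Suc r \<le> x / 1" using Suc.prems Q one_le_power[OF Q, of "Suc r"] by (intro divide_left_mono) auto
  then have "max \<delta> (x / Q ^ Suc r) \<le> 1" using d Suc.prems by simp
  then have "h (max \<delta> (x / Q ^ Suc r)) \<le> h (max \<delta> (y / Q ^ r))"
    using le d by (intro dec_densD(5)[OF h]) (auto simp: less_max_iff_disj)
  then have "h (max \<delta> (x / Q ^ Suc r)) / 3 ^ Suc r \<le> h (max \<delta> (y / Q ^ r)) / 3 ^ Suc r"
    by (rule divide_right_mono) simp
  also have "\<dots> = h (max \<delta> (y / Q ^ r)) / 3 ^ r / 3" by simp
  also have "\<dots> \<le> ?h y / 3" using Suc.IH[of y] y by (simp add: Q_def)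
  also have "\<dots> \<le> ?h y / left_deriv a y"
    using left_deriv_ge_1[OF a(1), of y] left_deriv_le[OF a(1), of y] a beta y dec_densD(4)[OF dh, of y]
    by (intro divide_left_mono) auto
  also have "\<dots> \<le> transfer a ?h x"
    using dec_densD(4)[OF dh, of "(x + 1) / 2"] Suc.prems by (simp add: transfer_def y_def)
  also have "transfer a ?h = transfers \<alpha> (Suc r) s h"
    using transfers_add[of \<alpha> r 1 s h] by (simp add: a_def)
  finally show ?case by (simp add: Q_def)
qed

text \<open>The preserved tail bound leaves at most half of the unit mass below \<delta>, so the
  density at \<delta> is at least 1/2. A fixed number r of left preimages brings every point below
  \<delta> at the cost of \<open>3 ^ r\<close>. With fewer than r steps available, the chain is
  started from the constant 1 itself.\<close>

lemma transfers_one_lower: "\<exists>d>0. \<forall>i s x. 0 < x \<longrightarrow> x \<le> 1 \<longrightarrow> d \<le> transfers \<alpha> i s (\<lambda>_. 1) x"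
proof -
  \<comment> \<open>The value makes the mass of \<open>7/2 * x powr - \<beta>\<close> on
    \<open>{..\<delta>}\<close> equal to 7/2 * 2/21 / (1 - \<beta>), which is at most 1/2.\<close>
  define \<delta> where "\<delta> = (2/21) powr (1 / (1 - \<beta>))"
  have b: "0 < 1 - \<beta>" using beta by simp
  have d: "0 < \<delta>" "\<delta> \<le> 1" using b by (auto simp: \<delta>_def powr_le1)
  have dp: "\<delta> powr (1 - \<beta>) = 2/21" using b by (simp add: \<delta>_def powr_powr)
  have "1 < 1 + \<delta> powr \<beta>" using d by simp
  then obtain r where "1 / \<delta> < (1 + \<delta> powr \<beta>) ^ r" using real_arch_pow by blast
  then have r: "1 / (1 + \<delta> powr \<beta>) ^ r \<le> \<delta>"
    using d by (simp add: divide_less_eq divide_le_eq mult.commute add_pos_nonneg less_imp_le)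
  have one: "dec_dens (\<lambda>_. 1)" by (rule dec_dens_const) simp
  have "1 / 3 ^ r / 2 \<le> transfers \<alpha> i s (\<lambda>_. 1) x" if x: "0 < x" "x \<le> 1" for i s x
  proof (cases "i < r")
    case True
    have "1 / 3 ^ r / 2 \<le> (1::real) / 3 ^ i"
    proof -
      have "(3::real) ^ i \<le> 3 ^ r" using True by (intro power_increasing) auto
      moreover have "(0::real) < 3 ^ r" by simp
      ultimately have "(3::real) ^ i \<le> 2 * 3 ^ r" by linarith
      then show ?thesis by (simp add: field_simps)
    qed
    also have "\<dots> \<le> transfers \<alpha> i s (\<lambda>_. 1) x" using transfers_chain[OF one d x, of i s] by simp
    finally show ?thesis .
  next
    case False
    define g where "g = transfers \<alpha> (i - r) s (\<lambda>_. 1)"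
    have g: "dec_dens g" "mass g = 1"
      using one mass_transfers[OF one] lebesgue01.prob_space by (auto simp: g_def intro: dec_dens_transfers)
    have t: "g x \<le> 7/2 * x powr - \<beta>" if "0 < x" "x \<le> 1" for x
    proof -
      have p: "1 \<le> 7/2 * x powr - \<beta>" if "0 < x" "x \<le> 1" for x
      proof -
        have "x powr \<beta> \<le> 1" using that beta by (intro powr_le1) auto
        then show ?thesis using that by (simp add: powr_minus divide_simps)
      qed
      show ?thesis using tail_transfers[OF one, of 1 x "i - r" s] that p lebesgue01.prob_space
        by (simp add: g_def)
    qed
    define I where "I = (indicator {..\<delta>} :: real \<Rightarrow> real)"
    note P = powr_integral_lebesgue01[of \<beta> \<delta>, folded I_def]
    have iP: "integrable lebesgue01 (\<lambda>x. I x * x powr - \<beta>)" using P d beta by simp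
    have "1 \<le> mass (\<lambda>x. 7/2 * (I x * x powr - \<beta>) + g \<delta>)"
      unfolding g(2)[symmetric]
    proof (rule integral_lebesgue01_mono)
      fix x :: real assume x: "0 < x" "x < 1"
      have "0 \<le> g \<delta>" using d by (intro dec_densD(4)[OF g(1)]) auto
      then show "g x \<le> 7/2 * (I x * x powr - \<beta>) + g \<delta>"
        using t[of x] x d by (auto simp: I_def indicator_def intro!: dec_densD(5)[OF g(1)] add_increasing2)
    qed (use iP dec_densD(3)[OF g(1)] in auto)
    also have "\<dots> = 7/2 * mass (\<lambda>x. I x * x powr - \<beta>) + g \<delta>"
      using iP lebesgue01.prob_space by simp
    also have "mass (\<lambda>x. I x * x powr - \<beta>) = 2/21 / (1 - \<beta>)"
      using P(2) d beta dp by simp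
    also have "7/2 * (2/21 / (1 - \<beta>)) = 1/3 * (1 / (1 - \<beta>))"
      using b by (simp add: divide_simps)
    also have "1/3 * (1 / (1 - \<beta>)) + g \<delta> \<le> 1/2 + g \<delta>" using one_minus_beta_bound by linarith
    finally have gd: "1/2 \<le> g \<delta>" by simp
    have "1 / 3 ^ r / 2 \<le> g \<delta> / 3 ^ r" using gd by (simp add: field_simps)
    also have "max \<delta> (x / (1 + \<delta> powr \<beta>) ^ r) = \<delta>"
      using r x d mult_right_mono[OF x(2), of "1 / (1 + \<delta> powr \<beta>) ^ r"] by (simp add: max_def)
    then have "g \<delta> / 3 ^ r \<le> transfers \<alpha> r (s + (i - r)) g x"
      using transfers_chain[OF g(1) d x, of r "s + (i - r)"] by simp
    also have "\<dots> = transfers \<alpha> i s (\<lambda>_. 1) x"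
      using transfers_add[of \<alpha> "i - r" r s "\<lambda>_. 1"] False by (simp add: g_def)
    finally show ?thesis .
  qed
  then show ?thesis by (intro exI[of _ "1 / 3 ^ r / 2"]) auto
qed

text \<open>At some time before n the density at 1/2 is comparable to the mass, hence also on the
  whole left half. One more step spreads this over the unit interval at the cost of a factor 3, and
  the resulting constant is carried to time n by the lower bound for the transferred constant 1. The
  number c depends neither on the density nor on the starting time.\<close>

lemma minorisation:
  "\<exists>c. 0 < c \<and> c < 1 \<and> (\<forall>h B R n s x. dec_dens h \<longrightarrow> (\<forall>x. 0 < x \<longrightarrow> x \<le> 1 \<longrightarrow> h x \<le> B) \<longrightarrow>
     0 \<le> R \<longrightarrow> potential h \<le> R * mass h \<longrightarrow> 16 / \<beta> * R < real n \<longrightarrow> 0 < x \<longrightarrow> x \<le> 1 \<longrightarrow>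
     c * mass h \<le> transfers \<alpha> n s h x)"
proof -
  obtain d where d: "d > 0" "\<And>i s x. 0 < x \<Longrightarrow> x \<le> 1 \<Longrightarrow> d \<le> transfers \<alpha> i s (\<lambda>_. 1) x"
    using transfers_one_lower by blast
  define c where "c = min (1/2) (\<beta> / 36 * d)"
  have "c * mass h \<le> transfers \<alpha> n s h x"
    if h: "dec_dens h" and B: "\<forall>x. 0 < x \<longrightarrow> x \<le> 1 \<longrightarrow> h x \<le> B" and R: "0 \<le> R" "potential h \<le> R * mass h"
      and n: "16 / \<beta> * R < real n" and x: "0 < x" "x \<le> 1" for h B R n s x
  proof -
    obtain j where j: "j < n" "\<beta> / 12 * mass h \<le> transfers \<alpha> j s h (1/2)"
      using escape_from_zero[OF h _ R n, of B s] B by auto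
    define K where "K = \<beta> / 36 * mass h"
    have K: "0 \<le> K" using mass_nonneg[OF h] beta by (simp add: K_def)
    let ?h = "transfers \<alpha> j s h"
    have dh: "dec_dens ?h" by (rule dec_dens_transfers[OF h])
    have low: "K * 1 \<le> transfers \<alpha> (Suc j) s h y" if y: "0 < y" "y \<le> 1" for y
    proof -
      define a where "a = \<alpha> (Suc (s + j))"
      have a: "0 \<le> a" "a \<le> \<beta>" by (auto simp: a_def alpha_Suc)
      define z where "z = left_inv a y"
      have z: "0 < z" "z \<le> 1/2" using y a left_inv_le_half[OF a(1), of y] by (auto simp: z_def left_inv_pos)
      have "K * 1 \<le> ?h (1/2) / 3" using j(2) by (simp add: K_def)
      also have "\<dots> \<le> ?h z / 3" using z by (intro divide_right_mono dec_densD(5)[OF dh]) auto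
      also have "\<dots> \<le> ?h z / left_deriv a z"
        using left_deriv_ge_1[OF a(1), of z] left_deriv_le[OF a(1), of z] a beta z dec_densD(4)[OF dh, of z]
        by (intro divide_left_mono) auto
      also have "\<dots> \<le> transfer a ?h y"
        using dec_densD(4)[OF dh, of "(y + 1) / 2"] y by (simp add: transfer_def z_def)
      also have "transfer a ?h = transfers \<alpha> (Suc j) s h"
        using transfers_add[of \<alpha> j 1 s h] by (simp add: a_def)
      finally show ?thesis .
    qed
    define i where "i = n - Suc j"
    have n_eq: "n = Suc j + i" using j(1) by (simp add: i_def)
    have "c * mass h \<le> \<beta> / 36 * d * mass h"
      using mass_nonneg[OF h] by (intro mult_right_mono) (auto simp: c_def)
    also have "\<dots> = K * d" by (simp add: K_def)
    also have "\<dots> \<le> K * transfers \<alpha> i (s + Suc j) (\<lambda>_. 1) x"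
      using d(2)[OF x] K by (intro mult_left_mono) auto
    also have "\<dots> = transfers \<alpha> i (s + Suc j) (\<lambda>x. K * 1) x" by (rule transfers_cmult[symmetric])
    also have "\<dots> \<le> transfers \<alpha> i (s + Suc j) (transfers \<alpha> (Suc j) s h) x"
      using low by (intro transfers_mono x) auto
    also have "\<dots> = transfers \<alpha> n s h x" unfolding n_eq by (rule transfers_add[of \<alpha> "Suc j" i s h, symmetric, THEN fun_cong])
    finally show ?thesis .
  qed
  moreover have "0 < c" "c < 1" using d(1) beta by (auto simp: c_def)
  ultimately show ?thesis by blast
qed

text \<open>A fixed choice of the minorisation constant, so that the error of the coupling can be a
  definition.\<close>

definition overlap :: real where
  "overlap = (SOME c. 0 < c \<and> c < 1 \<and> (\<forall>h B R n s x. dec_dens h \<longrightarrow> (\<forall>x. 0 < x \<longrightarrow> x \<le> 1 \<longrightarrow> h x \<le> B) \<longrightarrow>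
     0 \<le> R \<longrightarrow> potential h \<le> R * mass h \<longrightarrow> 16 / \<beta> * R < real n \<longrightarrow> 0 < x \<longrightarrow> x \<le> 1 \<longrightarrow>
     c * mass h \<le> transfers \<alpha> n s h x))"

lemma overlap: "0 < overlap" "overlap < 1"
  and overlap_le: "\<lbrakk>dec_dens h; \<And>x. 0 < x \<Longrightarrow> x \<le> 1 \<Longrightarrow> h x \<le> B; 0 \<le> R; potential h \<le> R * mass h;
    16 / \<beta> * R < real n; 0 < x; x \<le> 1\<rbrakk> \<Longrightarrow> overlap * mass h \<le> transfers \<alpha> n s h x"
  using someI_ex[OF minorisation, folded overlap_def] by blast+

subsection \<open>Coupling\<close>

definition tail_mass :: "real \<Rightarrow> (real \<Rightarrow> real) \<Rightarrow> real" where
  "tail_mass e h = mass (\<lambda>x. indicator {..e} x * h x)"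

lemma tail_mass_nonneg: "dec_dens h \<Longrightarrow> 0 \<le> tail_mass e h"
  unfolding tail_mass_def by (rule mass_nonneg[OF dec_dens_indicator])

lemma tail_mass_mono:
  assumes "dec_dens h" "dec_dens u" "\<And>x. 0 < x \<Longrightarrow> x < 1 \<Longrightarrow> h x \<le> u x"
  shows "tail_mass e h \<le> tail_mass e u"
  unfolding tail_mass_def
  by (rule integral_lebesgue01_mono)
    (use assms in \<open>auto intro!: dec_densD(3)[OF dec_dens_indicator] mult_left_mono\<close>)

text \<open>Capping at \<open>h e\<close> makes the potential finite at the cost of at most the mass
  below e. On \<open>{..e}\<close> the potential of the capped density is at most
  \<open>h e * e powr (1 - \<beta>) / (1 - \<beta>)\<close>, that is
  \<open>3/2 * e powr - \<beta>\<close> times the rectangle \<open>e * h e\<close>; beyond e the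
  weight is at most \<open>e powr - \<beta>\<close>. Together this is the factor 5/2.\<close>

lemma truncation:
  assumes h: "dec_dens h" and e: "0 < e" "e \<le> 1"
  defines "t \<equiv> \<lambda>x. min (h x) (h e)"
  shows "dec_dens t" "potential t \<le> 5/2 * e powr - \<beta> * mass t" "mass h - tail_mass e h \<le> mass t"
proof -
  have he: "0 \<le> h e" by (rule dec_densD(4)[OF h e])
  show t: "dec_dens t" unfolding t_def by (rule dec_dens_min[OF h he])
  define I where "I = (indicator {..e} :: real \<Rightarrow> real)"
  note P = powr_integral_lebesgue01[of \<beta> e, folded I_def]
  have iP: "integrable lebesgue01 (\<lambda>x. I x * x powr - \<beta>)" using P e beta by simp
  have iT: "integrable lebesgue01 t" by (rule dec_densD(3)[OF t])
  have m0: "0 \<le> mass t" by (rule mass_nonneg[OF t])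
  have et: "e * h e \<le> mass t" using dec_dens_le_mass[OF t e] by (simp add: t_def)
  have "potential t \<le> mass (\<lambda>x. (I x * x powr - \<beta>) * h e + e powr - \<beta> * t x)"
    unfolding potential_def
  proof (rule integral_lebesgue01_mono)
    show "integrable lebesgue01 (\<lambda>x. x powr - \<beta> * t x)"
      by (rule integrable_powr_mult[where B = "h e"])
        (use dec_densD(1,4)[OF t] in \<open>auto simp: t_def\<close>)
    fix x :: real assume x: "0 < x" "x < 1"
    show "x powr - \<beta> * t x \<le> (I x * x powr - \<beta>) * h e + e powr - \<beta> * t x"
    proof (cases "x \<le> e")
      case True
      have "x powr - \<beta> * t x \<le> x powr - \<beta> * h e" by (intro mult_left_mono) (auto simp: t_def)
      moreover have "0 \<le> e powr - \<beta> * t x" using dec_densD(4)[OF t, of x] x by simp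
      ultimately show ?thesis using True by (simp add: I_def)
    next
      case False
      have "x powr - \<beta> \<le> e powr - \<beta>" using False e x beta by (intro powr_mono2') auto
      then have "x powr - \<beta> * t x \<le> e powr - \<beta> * t x"
        using dec_densD(4)[OF t, of x] x by (intro mult_right_mono) auto
      then show ?thesis using False by (simp add: I_def)
    qed
  qed (use iP iT in auto)
  also have "\<dots> = e powr (1 - \<beta>) / (1 - \<beta>) * h e + e powr - \<beta> * mass t"
    using iP iT P e beta by simp
  also have "e powr (1 - \<beta>) / (1 - \<beta>) * h e = e powr - \<beta> * (1 / (1 - \<beta>) * (e * h e))"
    using e by (simp add: powr_diff powr_minus field_simps)
  also have "\<dots> \<le> e powr - \<beta> * (3/2 * mass t)"
    using one_minus_beta_bound et m0 e he beta by (intro mult_left_mono mult_mono) auto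
  finally show "potential t \<le> 5/2 * e powr - \<beta> * mass t" by (simp add: mult.commute)
  have iI: "integrable lebesgue01 (\<lambda>x. I x * h x)"
    unfolding I_def by (rule dec_densD(3)[OF dec_dens_indicator[OF h]])
  have "mass h \<le> mass (\<lambda>x. I x * h x + t x)"
  proof (rule integral_lebesgue01_mono)
    fix x :: real assume x: "0 < x" "x < 1"
    show "h x \<le> I x * h x + t x"
      using dec_densD(4)[OF t, of x] dec_densD(5)[OF h, of e x] x e
      by (auto simp: I_def indicator_def t_def)
  qed (use iI iT dec_densD(3)[OF h] in auto)
  then show "mass h - tail_mass e h \<le> mass t"
    using iI iT by (simp add: tail_mass_def I_def)
qed

text \<open>In every block of length \<open>l\<close> both densities dominate a common constant, which is cancelled;
  the remainders stay decreasing, and their mass near \<open>0\<close> only shrinks.\<close>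
lemma coupling:
  assumes "dec_dens h" "dec_dens u" "mass h = mass u"
    and e: "0 < e" "e \<le> 1" and l: "40 / \<beta> * e powr - \<beta> < real l" and "k * l \<le> n"
    and G: "G \<in> borel_measurable borel" "\<And>x. x \<in> {0..1} \<Longrightarrow> \<bar>G x\<bar> \<le> B"
  shows "\<bar>mass (\<lambda>x. G (orbit \<alpha> n s x) * (h x - u x))\<bar> \<le> B * (2 * (1 - overlap) ^ k * mass h +
    2 * (\<Sum>j<k. tail_mass e (transfers \<alpha> (j * l) s h) + tail_mass e (transfers \<alpha> (j * l) s u)))"
  using assms(1-3,7)
proof (induction k arbitrary: s n h u)
  case 0
  have "G 0 \<le> B" "- G 0 \<le> B" using G(2)[of 0] by auto
  then have B: "0 \<le> B" by linarith
  note [measurable] = G(1) dec_densD(1)[OF 0(1)] dec_densD(1)[OF 0(2)]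
  have "\<bar>mass (\<lambda>x. G (orbit \<alpha> n s x) * (h x - u x))\<bar> \<le> mass (\<lambda>x. \<bar>G (orbit \<alpha> n s x) * (h x - u x)\<bar>)"
    by (rule integral_abs_bound)
  also have "\<dots> \<le> mass (\<lambda>x. B * (h x + u x))"
  proof (rule integral_lebesgue01_mono)
    have "integrable lebesgue01 (\<lambda>x. G (orbit \<alpha> n s x) * (h x - u x))"
      by (rule integrable_bounded_mult[where B = B])
        (use G orbit_in dec_densD(3)[OF 0(1)] dec_densD(3)[OF 0(2)] in auto)
    then show "integrable lebesgue01 (\<lambda>x. \<bar>G (orbit \<alpha> n s x) * (h x - u x)\<bar>)" by simp
    show "integrable lebesgue01 (\<lambda>x. B * (h x + u x))"
      using dec_densD(3)[OF 0(1)] dec_densD(3)[OF 0(2)] by auto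
    fix x :: real assume x: "0 < x" "x < 1"
    have "\<bar>h x - u x\<bar> \<le> h x + u x" using dec_densD(4)[OF 0(1), of x] dec_densD(4)[OF 0(2), of x] x by auto
    then show "\<bar>G (orbit \<alpha> n s x) * (h x - u x)\<bar> \<le> B * (h x + u x)"
      using G(2)[OF orbit_in, of x n s] x B by (auto simp: abs_mult intro!: mult_mono)
  qed
  also have "\<dots> = B * (2 * mass h)"
    using dec_densD(3)[OF 0(1)] dec_densD(3)[OF 0(2)] 0(3) by simp
  finally show ?case by simp
next
  case (Suc k)
  note h = Suc.prems(1) and u = Suc.prems(2)
  have "G 0 \<le> B" "- G 0 \<le> B" using G(2)[of 0] by auto
  then have B: "0 \<le> B" by linarith
  define n' where "n' = n - l"
  have n: "n = l + n'" "k * l \<le> n'" using Suc.prems(4) by (auto simp: n'_def)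
  define th tu where "th = (\<lambda>x. min (h x) (h e))" and "tu = (\<lambda>x. min (u x) (u e))"
  note Th = truncation[OF h e, folded th_def] and Tu = truncation[OF u e, folded tu_def]
  define m where "m = overlap * min (mass th) (mass tu)"
  define h1 u1 where "h1 = transfers \<alpha> l s h" and "u1 = transfers \<alpha> l s u"
  have low: "m \<le> transfers \<alpha> l s w x"
    if w: "dec_dens w" "w = h \<or> w = u" and x: "0 < x" "x \<le> 1" for w x
  proof -
    define t where "t = (\<lambda>x. min (w x) (w e))"
    note T = truncation[OF w(1) e, folded t_def]
    have "m \<le> overlap * mass t"
      using w(2) overlap unfolding m_def t_def th_def tu_def by (intro mult_left_mono) auto
    \<comment> \<open>The threshold 40/\<beta> for the block length is 16/\<beta> times the factor
      5/2 of the truncated potential.\<close>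
    also have "\<dots> \<le> transfers \<alpha> l s t x"
      by (rule overlap_le[OF T(1) _ _ T(2), where B = "w e"]) (use x l in \<open>auto simp: t_def\<close>)
    also have "\<dots> \<le> transfers \<alpha> l s w x" by (rule transfers_mono[OF x]) (simp add: t_def)
    finally show ?thesis .
  qed
  have m0: "0 \<le> m" using mass_nonneg[OF Th(1)] mass_nonneg[OF Tu(1)] overlap by (simp add: m_def)
  have dd: "dec_dens (\<lambda>x. w x - m)" if "dec_dens w" "\<And>x. 0 < x \<Longrightarrow> x \<le> 1 \<Longrightarrow> m \<le> w x" for w
    using that by (auto simp: dec_dens_def)
  have h1: "dec_dens h1" "mass h1 = mass h" and u1: "dec_dens u1" "mass u1 = mass u"
    using h u by (auto simp: h1_def u1_def dec_dens_transfers mass_transfers)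
  define h' u' where "h' = (\<lambda>x. h1 x - m)" and "u' = (\<lambda>x. u1 x - m)"
  have dh': "dec_dens h'" unfolding h'_def by (rule dd[OF h1(1)]) (use low[OF h] in \<open>auto simp: h1_def\<close>)
  have du': "dec_dens u'" unfolding u'_def by (rule dd[OF u1(1)]) (use low[OF u] in \<open>auto simp: u1_def\<close>)
  have mh': "mass h' = mass h - m" unfolding h'_def
    using dec_densD(3)[OF h1(1)] h1(2) lebesgue01.prob_space by simp
  have mu': "mass u' = mass u - m" unfolding u'_def
    using dec_densD(3)[OF u1(1)] u1(2) lebesgue01.prob_space by simp
  let ?t = "\<lambda>w. tail_mass e w" and ?L = "\<lambda>j s w. transfers \<alpha> (j * l) s w"
  \<comment> \<open>The truncation loses the tail of one of the two densities; both tails are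
    subtracted so that it does not matter which truncated mass is the smaller.\<close>
  have m_ge: "overlap * mass h - (?t h + ?t u) \<le> m"
  proof -
    have "overlap * (mass h - (?t h + ?t u)) \<le> m"
      unfolding m_def using Th(3) Tu(3) overlap tail_mass_nonneg[OF h, of e] tail_mass_nonneg[OF u, of e] Suc.prems(3)
      by (intro mult_left_mono) auto
    moreover have "overlap * (?t h + ?t u) \<le> 1 * (?t h + ?t u)"
      using overlap tail_mass_nonneg[OF h, of e] tail_mass_nonneg[OF u, of e] by (intro mult_right_mono) auto
    ultimately show ?thesis by (simp add: right_diff_distrib)
  qed
  have tails: "?t (?L j (s + l) w') \<le> ?t (?L (Suc j) s w)"
    if "dec_dens w" "dec_dens w'" "\<And>x. 0 < x \<Longrightarrow> x \<le> 1 \<Longrightarrow> w' x \<le> transfers \<alpha> l s w x" for j w w'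
  proof -
    have "?L (Suc j) s w = ?L j (s + l) (transfers \<alpha> l s w)"
      using transfers_add[of \<alpha> l "j * l" s w] by simp
    then show ?thesis using that
      by (auto intro!: tail_mass_mono dec_dens_transfers transfers_mono)
  qed
  have sums: "(\<Sum>j<k. ?t (?L j (s + l) h') + ?t (?L j (s + l) u')) \<le>
      (\<Sum>j<k. ?t (?L (Suc j) s h) + ?t (?L (Suc j) s u))"
    by (intro sum_mono add_mono tails h u dh' du') (use m0 in \<open>auto simp: h'_def u'_def h1_def u1_def\<close>)
  have q: "0 \<le> (1 - overlap) ^ k" "(1 - overlap) ^ k \<le> 1" using overlap by (auto intro: power_le_one)
  have "2 * (1 - overlap) ^ k * mass h' \<le> 2 * (1 - overlap) ^ k * ((1 - overlap) * mass h + (?t h + ?t u))"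
    using m_ge q unfolding mh' by (intro mult_left_mono) (auto simp: algebra_simps)
  also have "\<dots> = 2 * (1 - overlap) ^ Suc k * mass h + 2 * ((1 - overlap) ^ k * (?t h + ?t u))"
    by (simp add: algebra_simps)
  also have "(1 - overlap) ^ k * (?t h + ?t u) \<le> 1 * (?t h + ?t u)"
    using q tail_mass_nonneg[OF h, of e] tail_mass_nonneg[OF u, of e] by (intro mult_right_mono) auto
  finally have M: "2 * (1 - overlap) ^ k * mass h' \<le> 2 * (1 - overlap) ^ Suc k * mass h + 2 * (?t h + ?t u)"
    by simp
  have "mass (\<lambda>x. G (orbit \<alpha> n s x) * (h x - u x)) =
      mass (\<lambda>x. (G \<circ> orbit \<alpha> n' (s + l)) (orbit \<alpha> l s x) * (h x - u x))"
    by (simp add: n(1) orbit_add)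
  also have "\<dots> = mass (\<lambda>x. (G \<circ> orbit \<alpha> n' (s + l)) x * transfers \<alpha> l s (\<lambda>x. h x - u x) x)"
    by (rule transfers_dual[where B = B])
      (use G orbit_in dec_densD[OF h] dec_densD[OF u] in \<open>auto intro: measurable_comp[OF measurable_orbit]\<close>)
  also have "\<dots> = mass (\<lambda>x. G (orbit \<alpha> n' (s + l) x) * (h' x - u' x))"
    by (simp add: transfers_diff h'_def u'_def h1_def u1_def)
  finally have "\<bar>mass (\<lambda>x. G (orbit \<alpha> n s x) * (h x - u x))\<bar> \<le> B * (2 * (1 - overlap) ^ k * mass h' +
      2 * (\<Sum>j<k. ?t (?L j (s + l) h') + ?t (?L j (s + l) u')))"
    using Suc.IH[OF dh' du' _ n(2), of "s + l"] mh' mu' Suc.prems(3) by simp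
  also have "\<dots> \<le> B * (2 * (1 - overlap) ^ Suc k * mass h + 2 * (?t h + ?t u) +
      2 * (\<Sum>j<k. ?t (?L (Suc j) s h) + ?t (?L (Suc j) s u)))"
    using M sums B by (intro mult_left_mono add_mono) auto
  also have "\<dots> = B * (2 * (1 - overlap) ^ Suc k * mass h +
      2 * (\<Sum>j<Suc k. ?t (?L j s h) + ?t (?L j s u)))"
    by (subst sum.lessThan_Suc_shift) (simp add: algebra_simps)
  finally show ?case .
qed

text \<open>The coupling bound for h against the unit reference \<open>u\<close> scaled to the mass
  of h, written without normalisation so that it is additive and monotone in h. Additivity allows
  the errors of the pieces of a density over different inverse branches to be summed to the error of
  the whole.\<close>

definition coupling_err :: "real \<Rightarrow> nat \<Rightarrow> nat \<Rightarrow> nat \<Rightarrow> (real \<Rightarrow> real) \<Rightarrow> (real \<Rightarrow> real) \<Rightarrow> real" where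
  "coupling_err e l k s u h = 2 * (1 - overlap) ^ k * mass h +
    2 * (\<Sum>j<k. tail_mass e (transfers \<alpha> (j * l) s h) + mass h * tail_mass e (transfers \<alpha> (j * l) s u))"

lemma tail_mass_cmult: "tail_mass e (\<lambda>x. c * h x) = c * tail_mass e h"
  unfolding tail_mass_def by (simp add: mult.left_commute)

text \<open>Because the observable is centred under \<open>u\<close>, subtracting
  \<open>mass h * u x\<close> from the density leaves the integral unchanged and produces two
  densities of equal mass.\<close>

lemma coupling_unit:
  assumes h: "dec_dens h" and u: "dec_dens u" "mass u = 1"
    and e: "0 < e" "e \<le> 1" and l: "40 / \<beta> * e powr - \<beta> < real l" and k: "k * l \<le> n"
    and G: "G \<in> borel_measurable borel" "\<And>x. x \<in> {0..1} \<Longrightarrow> \<bar>G x\<bar> \<le> B"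
    and G0: "mass (\<lambda>x. G (orbit \<alpha> n s x) * u x) = 0"
  shows "\<bar>mass (\<lambda>x. G (orbit \<alpha> n s x) * h x)\<bar> \<le> B * coupling_err e l k s u h"
proof -
  let ?u = "\<lambda>x. mass h * u x"
  note [measurable] = G(1) dec_densD(1)[OF h] dec_densD(1)[OF u(1)]
  have du: "dec_dens ?u"
    using u(1) mass_nonneg[OF h] by (auto simp: dec_dens_def intro!: mult_left_mono)
  have i: "integrable lebesgue01 (\<lambda>x. G (orbit \<alpha> n s x) * w x)" if "dec_dens w" for w
    by (rule integrable_bounded_mult[where B = B]) (use G orbit_in dec_densD[OF that] in auto)
  have "mass (\<lambda>x. G (orbit \<alpha> n s x) * (h x - ?u x)) =
      mass (\<lambda>x. G (orbit \<alpha> n s x) * h x - mass h * (G (orbit \<alpha> n s x) * u x))"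
    by (simp add: algebra_simps)
  also have "\<dots> = mass (\<lambda>x. G (orbit \<alpha> n s x) * h x)"
    using i[OF h] i[OF u(1)] G0 by simp
  finally have "mass (\<lambda>x. G (orbit \<alpha> n s x) * h x) = mass (\<lambda>x. G (orbit \<alpha> n s x) * (h x - ?u x))" ..
  moreover have "mass h = mass ?u" using u by simp
  moreover have "transfers \<alpha> q s ?u = (\<lambda>x. mass h * transfers \<alpha> q s u x)" for q
    by (simp add: fun_eq_iff transfers_cmult)
  ultimately show ?thesis
    using coupling[OF h du _ e l k G, of s] by (simp add: coupling_err_def tail_mass_cmult)
qed

lemma coupling_err_mono:
  assumes h: "dec_dens h" and h': "dec_dens h'" and u: "dec_dens u"
    and le: "\<And>x. 0 < x \<Longrightarrow> x \<le> 1 \<Longrightarrow> h x \<le> h' x"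
  shows "coupling_err e l k s u h \<le> coupling_err e l k s u h'"
proof -
  have "mass h \<le> mass h'"
    using le by (intro integral_lebesgue01_mono dec_densD(3)[OF h] dec_densD(3)[OF h']) auto
  moreover have "tail_mass e (transfers \<alpha> q s h) \<le> tail_mass e (transfers \<alpha> q s h')" for q
    using le by (intro tail_mass_mono dec_dens_transfers h h' transfers_mono) auto
  ultimately show ?thesis
    unfolding coupling_err_def using overlap tail_mass_nonneg[OF dec_dens_transfers[OF u]]
    by (intro add_mono mult_left_mono sum_mono mult_right_mono) auto
qed

lemma coupling_err_add:
  assumes h: "dec_dens h" and h': "dec_dens h'"
  shows "coupling_err e l k s u (\<lambda>x. h x + h' x) = coupling_err e l k s u h + coupling_err e l k s u h'"
proof -
  have "tail_mass e (transfers \<alpha> q s (\<lambda>x. h x + h' x)) =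
      tail_mass e (transfers \<alpha> q s h) + tail_mass e (transfers \<alpha> q s h')" for q
    using dec_densD(3)[OF dec_dens_indicator[OF dec_dens_transfers[OF h]], of e q s]
      dec_densD(3)[OF dec_dens_indicator[OF dec_dens_transfers[OF h']], of e q s]
    unfolding tail_mass_def transfers_add_fun distrib_left by simp
  then show ?thesis
    using dec_densD(3)[OF h] dec_densD(3)[OF h']
    by (simp add: coupling_err_def algebra_simps sum.distrib sum_distrib_left sum_distrib_right)
qed

lemma coupling_err_nonneg: "dec_dens h \<Longrightarrow> dec_dens u \<Longrightarrow> 0 \<le> coupling_err e l k s u h"
  unfolding coupling_err_def using overlap mass_nonneg tail_mass_nonneg dec_dens_transfers
  by (intro add_nonneg_nonneg mult_nonneg_nonneg sum_nonneg) auto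

subsection \<open>Variation of observables of the past\<close>

text \<open>The modulus \<open>height\<close> absorbs one more Lipschitz summand at every backward step, because
  \<open>height \<circ> T - height - id\<close> increases on both branches. Hence a Birkhoff sum has bounded variation on
  cylinders, uniformly in its length.\<close>
definition height :: "real \<Rightarrow> real" where
  "height x = 2 / (1 - \<beta>) * x powr (1 - \<beta>)"

lemma height_deriv: "0 < x \<Longrightarrow> (height has_real_derivative 2 * x powr - \<beta>) (at x)"
  unfolding height_def[abs_def] using beta
  by (intro DERIV_cong[OF DERIV_cmult[OF has_real_derivative_powr]]) auto

text \<open>The difference of the two sides is an increment of a function whose derivative is
  \<open>2 * left_branch a z powr - \<beta> * left_deriv a z - 2 * z powr - \<beta> - 1\<close>.
  Expansion raises the first term to at least \<open>2 * z powr - \<beta> * (1 + p / 2)\<close>, and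
  the surplus \<open>z powr - \<beta> * p\<close> is at least 1. The factor 2 in
  \<open>height\<close> is chosen for this.\<close>

lemma height_left:
  assumes a: "0 \<le> a" "a \<le> \<beta>" and x: "0 < x" "x \<le> x'" "x' \<le> 1"
  shows "height (left_inv a x') - height (left_inv a x) + (left_inv a x' - left_inv a x) \<le> height x' - height x"
proof -
  let ?f = "\<lambda>z. height (left_branch a z) - height z - z"
  let ?f' = "\<lambda>z. 2 * left_branch a z powr - \<beta> * left_deriv a z - 2 * z powr - \<beta> - 1"
  have "?f (left_inv a x) \<le> ?f (left_inv a x')"
  proof (rule DERIV_nonneg_imp_nondecreasing[where f = ?f])
    show "left_inv a x \<le> left_inv a x'" by (rule left_inv_mono[OF a(1) x(2)])
    fix z assume "left_inv a x \<le> z" "z \<le> left_inv a x'"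
    then have z: "0 < z" "z \<le> 1/2" using left_inv_pos[OF a(1) x(1)] left_inv_le_half[OF a(1) x(3)] by auto
    have b0: "0 < left_branch a z" using left_branch_ge[of z a] z by auto
    have "(?f has_real_derivative ?f' z) (at z)"
      using z b0 by (auto intro!: derivative_eq_intros DERIV_chain2[OF height_deriv]
        left_branch_has_derivative a height_deriv)
    moreover have "0 \<le> ?f' z"
    proof -
      define p where "p = branch_pow a z"
      have p: "0 \<le> p" "p \<le> 1" using z a by (auto simp: p_def branch_pow_nonneg branch_pow_le_1)
      have zp: "1 \<le> z powr - \<beta> * p" unfolding p_def using z by (intro powr_branch_pow_ge a) auto
      have y: "(1 + p) powr \<beta> \<le> 1 + \<beta> * p" by (rule one_plus_powr_le[OF p(1)])
      have "(1 + p / 2) * (1 + p) powr \<beta> \<le> (1 + p / 2) * (1 + \<beta> * p)"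
        using p by (intro mult_left_mono[OF y]) auto
      also have "\<dots> \<le> 1 + p"
      proof -
        have b3: "\<beta> * p \<le> 1/3 * p" using p beta by (intro mult_right_mono) auto
        have "\<beta> * p * p \<le> 1/3 * p * 1" using mult_mono[OF b3, of p 1] p by simp
        moreover have "(1 + p / 2) * (1 + \<beta> * p) = 1 + \<beta> * p + p / 2 + \<beta> * p * p / 2"
          by (simp add: algebra_simps)
        ultimately show ?thesis using b3 by linarith
      qed
      finally have "1 + p / 2 \<le> (1 + p) powr - \<beta> * (1 + p)"
        using p by (simp add: powr_minus field_simps)
      also have "\<dots> \<le> (1 + p) powr - \<beta> * left_deriv a z"
        using p a by (intro mult_left_mono) (auto simp: left_deriv_def p_def algebra_simps)
      finally have "z powr - \<beta> * (1 + p / 2) \<le> z powr - \<beta> * ((1 + p) powr - \<beta> * left_deriv a z)"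
        by (rule mult_left_mono) simp
      also have "\<dots> = left_branch a z powr - \<beta> * left_deriv a z"
        using z p by (simp add: left_branch_def p_def[symmetric] powr_mult)
      finally show ?thesis using zp by (simp add: algebra_simps)
    qed
    ultimately show "\<exists>y. (?f has_real_derivative y) (at z) \<and> 0 \<le> y" by blast
  qed
  then show ?thesis using a by (simp add: algebra_simps)
qed

text \<open>Here the contraction by 1/2 is enough: after
  \<open>((z + 1) / 2) powr - \<beta> \<le> z powr - \<beta>\<close> the derivative is still at
  least \<open>z powr - \<beta> - 1/2\<close>, which is positive.\<close>

lemma height_right:
  assumes x: "0 < x" "x \<le> x'" "x' \<le> 1"
  shows "height ((x' + 1) / 2) - height ((x + 1) / 2) + ((x' + 1) / 2 - (x + 1) / 2) \<le> height x' - height x"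
proof -
  let ?f = "\<lambda>z. height z - height ((z + 1) / 2) - (z + 1) / 2"
  let ?f' = "\<lambda>z. 2 * z powr - \<beta> - 2 * ((z + 1) / 2) powr - \<beta> * (1 / 2) - 1 / 2"
  have "?f x \<le> ?f x'"
  proof (rule DERIV_nonneg_imp_nondecreasing[where f = ?f, OF x(2)])
    fix z assume "x \<le> z" "z \<le> x'"
    then have z: "0 < z" "z \<le> 1" using x by auto
    have "(?f has_real_derivative ?f' z) (at z)"
      using z by (auto intro!: derivative_eq_intros DERIV_chain2[OF height_deriv] height_deriv)
    moreover have "0 \<le> ?f' z"
    proof -
      have "((z + 1) / 2) powr - \<beta> \<le> z powr - \<beta>" using z beta by (intro powr_mono2') auto
      moreover have "1 \<le> z powr - \<beta>" using z beta powr_le1[of \<beta> z] by (simp add: powr_minus divide_simps)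
      ultimately show ?thesis by simp
    qed
    ultimately show "\<exists>y. (?f has_real_derivative y) (at z) \<and> 0 \<le> y" by blast
  qed
  then show ?thesis by (simp add: algebra_simps)
qed

text \<open>Abel summation over levels of \<open>height\<close> writes \<open>\<Theta> (P x) z\<close>, up to a small error, as a combination of
  indicators of intervals starting at \<open>0\<close>, with coefficients depending on \<open>z\<close> only; multiplying \<open>h\<close> by
  such an indicator keeps it decreasing.\<close>
lemma past_base:
  fixes \<Theta> :: "real \<Rightarrow> real \<Rightarrow> real"
  assumes h: "dec_dens h" and u: "dec_dens u" "mass u = 1"
    and e: "0 < e" "e \<le> 1" and l: "40 / \<beta> * e powr - \<beta> < real l" and k: "k * l \<le> n"
    and P [measurable]: "P \<in> borel_measurable borel" and L: "0 \<le> L"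
    and var: "\<And>x y. 0 < x \<Longrightarrow> x \<le> y \<Longrightarrow> y \<le> 1 \<Longrightarrow> \<bar>P y - P x\<bar> \<le> L * (height y - height x)"
    and T [measurable]: "case_prod \<Theta> \<in> borel_measurable (borel \<Otimes>\<^sub>M borel)" and \<Lambda>: "0 \<le> \<Lambda>"
    and B: "\<And>s z. z \<in> {0..1} \<Longrightarrow> \<bar>\<Theta> s z\<bar> \<le> B"
    and lip: "\<And>s t z. z \<in> {0..1} \<Longrightarrow> \<bar>\<Theta> s z - \<Theta> t z\<bar> \<le> \<Lambda> * \<bar>s - t\<bar>"
    and zero: "\<And>t. mass (\<lambda>x. \<Theta> t (orbit \<alpha> n s x) * u x) = 0"
  shows "\<bar>mass (\<lambda>x. \<Theta> (P x) (orbit \<alpha> n s x) * h x)\<bar> \<le> (B + 3 * L * \<Lambda>) * coupling_err e l k s u h"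
proof -
  define E where "E = coupling_err e l k s u h"
  have E0: "0 \<le> E" unfolding E_def by (rule coupling_err_nonneg[OF h u(1)])
  have b: "0 < 1 - \<beta>" using beta by simp
  have b2: "2 / (1 - \<beta>) \<le> 3" "0 \<le> 2 / (1 - \<beta>)" using one_minus_beta_bound b by auto
  note [measurable] = dec_densD(1)[OF h] dec_densD(1)[OF u(1)]
  have [measurable]: "(\<lambda>z. \<Theta> t z) \<in> borel_measurable borel" for t
    using measurable_compose[OF measurable_Pair1'[of t borel borel] T] by simp
  define X where "X = mass (\<lambda>x. \<Theta> (P x) (orbit \<alpha> n s x) * h x)"
  have main: "\<bar>X\<bar> \<le> (B + 3 * L * \<Lambda>) * E + 3 * L * \<Lambda> * mass h / real M" if M: "M > 0" for M :: nat
  proof -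
    \<comment> \<open>Points at equally spaced levels of \<open>height\<close>, which rises by
      \<open>2 / (1 - \<beta>) / real M\<close>, at most 3/M, between neighbours. The point of index
      0 is 0 and never serves as an endpoint.\<close>
    define \<sigma> where "\<sigma> = (\<lambda>j::nat. (real j / real M) powr (1 / (1 - \<beta>)))"
    have \<sigma>M: "\<sigma> M = 1" using M by (simp add: \<sigma>_def)
    have \<sigma>_powr: "\<sigma> j powr (1 - \<beta>) = real j / real M" for j
      using b by (simp add: \<sigma>_def powr_powr)
    have \<sigma>_pos: "0 < \<sigma> j" if "j \<ge> 1" for j using that M by (simp add: \<sigma>_def)
    have \<sigma>_mono: "\<sigma> i \<le> \<sigma> j" if "i \<le> j" for i j
      unfolding \<sigma>_def using that b by (intro powr_mono2 divide_right_mono) auto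
    have \<sigma>_le1: "\<sigma> j \<le> 1" if "j \<le> M" for j using \<sigma>_mono[OF that] \<sigma>M by simp
    have height_\<sigma>: "height (\<sigma> j) = 2 / (1 - \<beta>) * (real j / real M)" for j
      by (simp add: height_def \<sigma>_powr)
    define D where "D = (\<lambda>j z. \<Theta> (P (\<sigma> j)) z - \<Theta> (P (\<sigma> (Suc j))) z)"
    have [measurable]: "D j \<in> borel_measurable borel" for j unfolding D_def by measurable
    have D: "\<bar>D j z\<bar> \<le> \<Lambda> * (L * (3 / real M))" if "z \<in> {0..1}" "1 \<le> j" "j < M" for j z
    proof -
      have "\<bar>D j z\<bar> \<le> \<Lambda> * \<bar>P (\<sigma> (Suc j)) - P (\<sigma> j)\<bar>"
        using lip[OF that(1)] unfolding D_def by (simp add: abs_minus_commute)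
      also have "\<bar>P (\<sigma> (Suc j)) - P (\<sigma> j)\<bar> \<le> L * (height (\<sigma> (Suc j)) - height (\<sigma> j))"
        using that by (intro var \<sigma>_pos \<sigma>_mono \<sigma>_le1) auto
      also have "height (\<sigma> (Suc j)) - height (\<sigma> j) = 2 / (1 - \<beta>) / real M"
        unfolding height_\<sigma> right_diff_distrib[symmetric] diff_divide_distrib[symmetric] by simp
      also have "\<dots> \<le> 3 / real M" by (rule divide_right_mono[OF b2(1)]) simp
      finally show ?thesis using \<Lambda> L by (simp add: mult_left_mono)
    qed
    \<comment> \<open>For fixed x the terms with \<open>x \<le> \<sigma> j\<close> telescope,
      leaving \<open>\<Theta>\<close> evaluated at the first level that is not below x.\<close>
    define A where "A = (\<lambda>x z. \<Theta> (P 1) z + (\<Sum>j\<in>{1..<M}. indicator {..\<sigma> j} x * D j z))"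
    have A: "\<bar>\<Theta> (P x) z - A x z\<bar> \<le> \<Lambda> * (L * (3 / real M))" if x: "0 < x" "x \<le> 1" and z: "z \<in> {0..1}" for x z
    proof -
      define i where "i = nat \<lceil>real M * x powr (1 - \<beta>)\<rceil>"
      have xp: "0 < x powr (1 - \<beta>)" "x powr (1 - \<beta>) \<le> 1" using x b by (auto simp: powr_le1)
      have i: "1 \<le> i" "real M * x powr (1 - \<beta>) \<le> real i" "real i < real M * x powr (1 - \<beta>) + 1"
        using M xp unfolding i_def by (simp_all add: Suc_le_eq) linarith+
      have "real M * x powr (1 - \<beta>) \<le> real M * 1" by (intro mult_left_mono xp) auto
      then have iM: "i \<le> M" by (simp add: i_def nat_le_iff ceiling_le_iff)
      have iff: "x \<le> \<sigma> j \<longleftrightarrow> i \<le> j" for j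
      proof -
        have "x \<le> \<sigma> j \<longleftrightarrow> x powr (1 - \<beta>) \<le> \<sigma> j powr (1 - \<beta>)"
          using x b powr_mono2[of "1 - \<beta>" x "\<sigma> j"] powr_less_mono2[of "1 - \<beta>" "\<sigma> j" x]
          by (auto simp: \<sigma>_def not_le[symmetric])
        also have "\<dots> \<longleftrightarrow> real M * x powr (1 - \<beta>) \<le> real j" using M by (simp add: \<sigma>_powr field_simps)
        also have "\<dots> \<longleftrightarrow> i \<le> j" by (simp add: i_def nat_le_iff ceiling_le_iff)
        finally show ?thesis .
      qed
      have "(\<Sum>j\<in>{1..<M}. indicator {..\<sigma> j} x * D j z) = (\<Sum>j\<in>{1..<M}. if i \<le> j then D j z else 0)"
        by (intro sum.cong) (auto simp: indicator_def iff)
      also have "\<dots> = (\<Sum>j\<in>{i..<M}. D j z)"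
        using i(1) by (subst sum.inter_filter[symmetric]) (auto intro!: sum.cong)
      also have "\<dots> = \<Theta> (P (\<sigma> i)) z - \<Theta> (P 1) z"
        using sum_Suc_diff'[of i M "\<lambda>j. - \<Theta> (P (\<sigma> j)) z"] iM by (simp add: D_def \<sigma>M)
      finally have "\<Theta> (P x) z - A x z = \<Theta> (P x) z - \<Theta> (P (\<sigma> i)) z" by (simp add: A_def)
      then have "\<bar>\<Theta> (P x) z - A x z\<bar> \<le> \<Lambda> * \<bar>P (\<sigma> i) - P x\<bar>"
        using lip[OF z] by (simp add: abs_minus_commute)
      also have "\<bar>P (\<sigma> i) - P x\<bar> \<le> L * (height (\<sigma> i) - height x)"
        using x iff[of i] \<sigma>_le1[OF iM] by (intro var) auto
      also have "height (\<sigma> i) - height x = 2 / (1 - \<beta>) * (real i / real M - x powr (1 - \<beta>))"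
        by (simp add: height_\<sigma> height_def[of x] right_diff_distrib)
      also have "\<dots> \<le> 3 * (1 / real M)"
      proof -
        have "real i / real M \<le> (real M * x powr (1 - \<beta>) + 1) / real M"
          using i by (intro divide_right_mono) auto
        then have "real i / real M - x powr (1 - \<beta>) \<le> 1 / real M" using M by (simp add: add_divide_distrib)
        moreover have "0 \<le> real i / real M - x powr (1 - \<beta>)" using i M by (simp add: field_simps)
        ultimately show ?thesis using b2 by (intro mult_mono) auto
      qed
      finally show ?thesis using \<Lambda> L by (simp add: mult_left_mono)
    qed
    have [measurable]: "(\<lambda>x. A x (orbit \<alpha> n s x)) \<in> borel_measurable borel"
      unfolding A_def by measurable
    have iT: "integrable lebesgue01 (\<lambda>x. \<Theta> (P x) (orbit \<alpha> n s x) * h x)"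
      by (rule integrable_bounded_mult[where B = B]) (use B orbit_in dec_densD[OF h] in auto)
    have i1: "integrable lebesgue01 (\<lambda>x. \<Theta> (P 1) (orbit \<alpha> n s x) * h x)"
      by (rule integrable_bounded_mult[where B = B]) (use B orbit_in dec_densD[OF h] in auto)
    have ij: "integrable lebesgue01 (\<lambda>x. D j (orbit \<alpha> n s x) * (indicator {..\<sigma> j} x * h x))" if "j \<in> {1..<M}" for j
      by (rule integrable_bounded_mult[where B = "\<Lambda> * (L * (3 / real M))"])
        (use D orbit_in dec_densD[OF dec_dens_indicator[OF h]] that in auto)
    have Aeq: "A x (orbit \<alpha> n s x) * h x = \<Theta> (P 1) (orbit \<alpha> n s x) * h x +
        (\<Sum>j\<in>{1..<M}. D j (orbit \<alpha> n s x) * (indicator {..\<sigma> j} x * h x))" for x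
      by (simp only: A_def distrib_left distrib_right sum_distrib_left sum_distrib_right mult_ac)
    have iA: "integrable lebesgue01 (\<lambda>x. A x (orbit \<alpha> n s x) * h x)"
      unfolding Aeq using i1 ij by (intro Bochner_Integration.integrable_add Bochner_Integration.integrable_sum) auto
    have "\<bar>mass (\<lambda>x. A x (orbit \<alpha> n s x) * h x)\<bar> \<le>
        \<bar>mass (\<lambda>x. \<Theta> (P 1) (orbit \<alpha> n s x) * h x)\<bar> +
        (\<Sum>j\<in>{1..<M}. \<bar>mass (\<lambda>x. D j (orbit \<alpha> n s x) * (indicator {..\<sigma> j} x * h x))\<bar>)"
    proof -
      have "mass (\<lambda>x. A x (orbit \<alpha> n s x) * h x) = mass (\<lambda>x. \<Theta> (P 1) (orbit \<alpha> n s x) * h x) +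
          (\<Sum>j\<in>{1..<M}. mass (\<lambda>x. D j (orbit \<alpha> n s x) * (indicator {..\<sigma> j} x * h x)))"
        unfolding Aeq
        by (subst Bochner_Integration.integral_add[OF i1 Bochner_Integration.integrable_sum])
          (auto intro!: ij Bochner_Integration.integral_sum)
      then show ?thesis by (auto intro: order.trans[OF abs_triangle_ineq] add_left_mono sum_abs)
    qed
    also have "\<dots> \<le> B * E + (\<Sum>j\<in>{1..<M}. \<Lambda> * (L * (3 / real M)) * E)"
    proof (intro add_mono sum_mono)
      show "\<bar>mass (\<lambda>x. \<Theta> (P 1) (orbit \<alpha> n s x) * h x)\<bar> \<le> B * E"
        unfolding E_def by (rule coupling_unit[OF h u e l k _ _ zero]) (use B in auto)
      fix j assume j: "j \<in> {1..<M}"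
      have iu: "integrable lebesgue01 (\<lambda>x. \<Theta> t (orbit \<alpha> n s x) * u x)" for t
        by (rule integrable_bounded_mult[where B = B]) (use B orbit_in dec_densD[OF u(1)] in auto)
      \<comment> \<open>\<open>D j\<close> is a difference of two functionals with frozen first
        argument, each centred under \<open>u\<close>; this is why \<open>zero\<close> is assumed
        for every t.\<close>
      have "mass (\<lambda>x. D j (orbit \<alpha> n s x) * u x) = 0"
        using zero iu by (simp add: D_def left_diff_distrib)
      then have "\<bar>mass (\<lambda>x. D j (orbit \<alpha> n s x) * (indicator {..\<sigma> j} x * h x))\<bar>
          \<le> \<Lambda> * (L * (3 / real M)) * coupling_err e l k s u (\<lambda>x. indicator {..\<sigma> j} x * h x)"
        by (intro coupling_unit[OF dec_dens_indicator[OF h] u e l k]) (use D j in auto)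
      also have "\<dots> \<le> \<Lambda> * (L * (3 / real M)) * E"
        unfolding E_def using \<Lambda> L
        by (intro mult_left_mono coupling_err_mono dec_dens_indicator h u(1))
          (auto simp: indicator_def intro: dec_densD(4)[OF h])
      finally show "\<bar>mass (\<lambda>x. D j (orbit \<alpha> n s x) * (indicator {..\<sigma> j} x * h x))\<bar> \<le> \<Lambda> * (L * (3 / real M)) * E" .
    qed
    also have "\<dots> \<le> B * E + 3 * L * \<Lambda> * E"
    proof -
      have "real (M - 1) / real M * (3 * L * \<Lambda> * E) \<le> 1 * (3 * L * \<Lambda> * E)"
        using M L \<Lambda> E0 by (intro mult_right_mono) auto
      then show ?thesis by (simp add: algebra_simps)
    qed
    finally have a1: "\<bar>mass (\<lambda>x. A x (orbit \<alpha> n s x) * h x)\<bar> \<le> B * E + 3 * L * \<Lambda> * E" .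
    have "\<bar>X - mass (\<lambda>x. A x (orbit \<alpha> n s x) * h x)\<bar> =
        \<bar>mass (\<lambda>x. \<Theta> (P x) (orbit \<alpha> n s x) * h x - A x (orbit \<alpha> n s x) * h x)\<bar>"
      unfolding X_def using iT iA by simp
    also have "\<dots> \<le> mass (\<lambda>x. \<bar>\<Theta> (P x) (orbit \<alpha> n s x) * h x - A x (orbit \<alpha> n s x) * h x\<bar>)"
      by (rule integral_abs_bound)
    also have "\<dots> \<le> mass (\<lambda>x. \<Lambda> * (L * (3 / real M)) * h x)"
    proof (rule integral_lebesgue01_mono)
      fix x :: real assume x: "0 < x" "x < 1"
      show "\<bar>\<Theta> (P x) (orbit \<alpha> n s x) * h x - A x (orbit \<alpha> n s x) * h x\<bar> \<le> \<Lambda> * (L * (3 / real M)) * h x"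
        unfolding left_diff_distrib[symmetric] abs_mult
        using A[of x "orbit \<alpha> n s x"] x orbit_in[of x] dec_densD(4)[OF h, of x]
        by (intro mult_mono) auto
    qed (use iT iA dec_densD(3)[OF h] in auto)
    also have "\<dots> = 3 * L * \<Lambda> * mass h / real M" by simp
    finally show ?thesis using a1 by (simp add: distrib_right)
  qed
  \<comment> \<open>The M - 1 increments, each of size 3 L \<Lambda> / M, contribute at most 3 L
    \<Lambda> for every M. Only the discretisation error depends on M, and it vanishes in the
    limit.\<close>
  have "(\<lambda>M. (B + 3 * L * \<Lambda>) * E + 3 * L * \<Lambda> * mass h / real M) \<longlonglongrightarrow> (B + 3 * L * \<Lambda>) * E + 0"
    by (intro tendsto_intros lim_const_over_n)
  then have "\<bar>X\<bar> \<le> (B + 3 * L * \<Lambda>) * E + 0"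
    by (rule LIMSEQ_le_const) (use main in \<open>auto intro!: exI[of _ 1]\<close>)
  then show ?thesis by (simp add: X_def E_def)
qed

lemma height_mono: "0 \<le> x \<Longrightarrow> x \<le> y \<Longrightarrow> height x \<le> height y"
  unfolding height_def using beta by (intro mult_left_mono powr_mono2) auto

text \<open>Induction on the number of past steps, peeled off at the start. Restricting to one
  inverse branch of the first map turns the first summand into a part of \<open>P\<close>, and
  \<open>h\<close> into one of its two branch pieces. By \<open>height_left\<close> and
  \<open>height_right\<close> the new \<open>P\<close> has the same modulus L times
  \<open>height\<close>, so the constant does not grow with q; by \<open>coupling_err_add\<close>
  the errors of the two pieces add up to that of the transferred density.\<close>

lemma past_coupling:
  fixes \<Theta> :: "real \<Rightarrow> real \<Rightarrow> real" and \<phi> :: "nat \<Rightarrow> real \<Rightarrow> real"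
  assumes u: "dec_dens u" "mass u = 1"
    and e: "0 < e" "e \<le> 1" and l: "40 / \<beta> * e powr - \<beta> < real l" and k: "k * l \<le> n" and L: "0 \<le> L"
    and phi: "\<And>i. \<phi> i \<in> borel_measurable borel"
      "\<And>i x y. x \<in> {0..1} \<Longrightarrow> y \<in> {0..1} \<Longrightarrow> \<bar>\<phi> i x - \<phi> i y\<bar> \<le> L * \<bar>x - y\<bar>"
    and T [measurable]: "case_prod \<Theta> \<in> borel_measurable (borel \<Otimes>\<^sub>M borel)" and \<Lambda>: "0 \<le> \<Lambda>"
    and B: "\<And>s z. z \<in> {0..1} \<Longrightarrow> \<bar>\<Theta> s z\<bar> \<le> B"
    and lip: "\<And>s t z. z \<in> {0..1} \<Longrightarrow> \<bar>\<Theta> s z - \<Theta> t z\<bar> \<le> \<Lambda> * \<bar>s - t\<bar>"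
    and zero: "\<And>t. mass (\<lambda>x. \<Theta> t (orbit \<alpha> n p x) * u x) = 0"
  shows "dec_dens h \<Longrightarrow> P \<in> borel_measurable borel \<Longrightarrow>
    (\<And>x y. 0 < x \<Longrightarrow> x \<le> y \<Longrightarrow> y \<le> 1 \<Longrightarrow> \<bar>P y - P x\<bar> \<le> L * (height y - height x)) \<Longrightarrow> s + q = p \<Longrightarrow>
    \<bar>mass (\<lambda>x. \<Theta> (P x + (\<Sum>i<q. \<phi> (s + i) (orbit \<alpha> i s x))) (orbit \<alpha> (q + n) s x) * h x)\<bar>
      \<le> (B + 3 * L * \<Lambda>) * coupling_err e l k p u (transfers \<alpha> q s h)"
proof (induction q arbitrary: s P h)
  case 0
  then show ?case using past_base[OF 0(1) u e l k 0(2) L 0(3) T \<Lambda> B lip zero] by simp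
next
  case (Suc q)
  note h = Suc.prems(1) and P = Suc.prems(2) and var = Suc.prems(3)
  define a where "a = \<alpha> (Suc s)"
  have a: "0 \<le> a" "a \<le> \<beta>" by (auto simp: a_def alpha_Suc)
  note [measurable] = phi(1) P dec_densD(1)[OF h] measurable_left_inv[OF a(1)] measurable_left_deriv[OF a(1)]
  define Q where "Q = (\<lambda>x. \<Theta> (P x + (\<Sum>i<Suc q. \<phi> (s + i) (orbit \<alpha> i s x))) (orbit \<alpha> (Suc q + n) s x) * h x)"
  define y1 y2 where "y1 = left_inv a" and "y2 = (\<lambda>x::real. (x + 1) / 2)"
  define P1 P2 where "P1 = (\<lambda>x. P (y1 x) + \<phi> s (y1 x))" and "P2 = (\<lambda>x. P (y2 x) + \<phi> s (y2 x))"
  define h1 h2 where "h1 = (\<lambda>x. h (y1 x) / left_deriv a (y1 x))" and "h2 = (\<lambda>x. h (y2 x) / 2)"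
  have dh: "dec_dens h1" "dec_dens h2"
    using dec_dens_left[OF h a(1)] by (auto simp: h1_def h2_def y1_def y2_def)
  have th: "transfer a h = (\<lambda>x. h1 x + h2 x)"
    by (simp add: fun_eq_iff transfer_def h1_def h2_def y1_def y2_def)
  have [measurable]: "P1 \<in> borel_measurable borel" "P2 \<in> borel_measurable borel"
      "h1 \<in> borel_measurable borel" "h2 \<in> borel_measurable borel"
    by (auto simp: P1_def P2_def h1_def h2_def y1_def y2_def)
  let ?S = "\<lambda>x. \<Sum>i<q. \<phi> (Suc s + i) (orbit \<alpha> i (Suc s) x)"
  let ?q1 = "\<lambda>x. \<Theta> (P1 x + ?S x) (orbit \<alpha> (q + n) (Suc s) x) * h1 x"
  let ?q2 = "\<lambda>x. \<Theta> (P2 x + ?S x) (orbit \<alpha> (q + n) (Suc s) x) * h2 x"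
  have mQ: "Q \<in> borel_measurable borel" unfolding Q_def by measurable
  have iQ: "integrable lebesgue01 Q"
    unfolding Q_def
    by (rule integrable_bounded_mult[where B = B])
      (use B orbit_in dec_densD[OF h] in \<open>auto simp del: orbit.simps sum.lessThan_Suc add_Suc\<close>)
  have i1: "integrable lebesgue01 ?q1"
    by (rule integrable_bounded_mult[where B = B]) (use B orbit_in dec_densD[OF dh(1)] in auto)
  have i2: "integrable lebesgue01 ?q2"
    by (rule integrable_bounded_mult[where B = B]) (use B orbit_in dec_densD[OF dh(2)] in auto)
  have S: "(\<Sum>i<Suc q. \<phi> (s + i) (orbit \<alpha> i s y)) = \<phi> s y + ?S x"
    if "intermittent_map a y = x" for x y
    using that unfolding sum.lessThan_Suc_shift by (simp add: a_def)
  have "mass Q = mass (transfer a Q)" using integral_transfer(2)[OF mQ a(1) iQ] by simp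
  also have "\<dots> = mass (\<lambda>x. ?q1 x + ?q2 x)"
  proof (rule integral_lebesgue01_cong)
    show "transfer a Q \<in> borel_measurable borel" by (rule measurable_transfer[OF mQ a(1)])
    fix x :: real assume x: "0 < x" "x < 1"
    have y: "intermittent_map a (y1 x) = x" "intermittent_map a (y2 x) = x"
      using x a intermittent_map_left_inv[of a x] intermittent_map_right_inv[of x a]
      by (auto simp: y1_def y2_def)
    have Qy: "Q y = \<Theta> (P y + \<phi> s y + ?S x) (orbit \<alpha> (q + n) (Suc s) x) * h y"
      if "intermittent_map a y = x" for y
      using that unfolding Q_def S[OF that] by (simp add: a_def add.assoc)
    have "transfer a Q x = Q (y1 x) / left_deriv a (y1 x) + Q (y2 x) / 2"
      by (simp add: transfer_def y1_def y2_def)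
    then show "transfer a Q x = ?q1 x + ?q2 x"
      by (simp add: Qy[OF y(1)] Qy[OF y(2)] P1_def P2_def h1_def h2_def)
  qed simp
  also have "\<dots> = mass ?q1 + mass ?q2" using i1 i2 by simp
  finally have "\<bar>mass Q\<bar> \<le> \<bar>mass ?q1\<bar> + \<bar>mass ?q2\<bar>" by simp
  also have "\<dots> \<le> (B + 3 * L * \<Lambda>) * coupling_err e l k p u (transfers \<alpha> q (Suc s) h1) +
      (B + 3 * L * \<Lambda>) * coupling_err e l k p u (transfers \<alpha> q (Suc s) h2)"
  proof (intro add_mono)
    have ps: "\<bar>\<phi> s y' - \<phi> s y\<bar> \<le> L * (y' - y)" if "0 \<le> y" "y \<le> y'" "y' \<le> 1" for y y'
      using phi(2)[of y' y s] that by simp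
    show "\<bar>mass ?q1\<bar> \<le> (B + 3 * L * \<Lambda>) * coupling_err e l k p u (transfers \<alpha> q (Suc s) h1)"
    proof (rule Suc.IH[OF dh(1)])
      fix x y :: real assume x: "0 < x" "x \<le> y" "y \<le> 1"
      have z: "0 < y1 x" "y1 x \<le> y1 y" "y1 y \<le> 1"
        using x a left_inv_le_half[OF a(1), of y] by (auto simp: y1_def left_inv_pos left_inv_mono)
      have "\<bar>P1 y - P1 x\<bar> \<le> \<bar>P (y1 y) - P (y1 x)\<bar> + \<bar>\<phi> s (y1 y) - \<phi> s (y1 x)\<bar>"
        unfolding P1_def by linarith
      also have "\<dots> \<le> L * (height (y1 y) - height (y1 x)) + L * (y1 y - y1 x)"
        using z by (intro add_mono var ps) auto
      also have "\<dots> = L * (height (y1 y) - height (y1 x) + (y1 y - y1 x))" by (simp add: distrib_left)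
      also have "\<dots> \<le> L * (height y - height x)"
        using height_left[OF a x] L by (intro mult_left_mono) (auto simp: y1_def)
      finally show "\<bar>P1 y - P1 x\<bar> \<le> L * (height y - height x)" .
    qed (use Suc.prems(4) in auto)
    show "\<bar>mass ?q2\<bar> \<le> (B + 3 * L * \<Lambda>) * coupling_err e l k p u (transfers \<alpha> q (Suc s) h2)"
    proof (rule Suc.IH[OF dh(2)])
      fix x y :: real assume x: "0 < x" "x \<le> y" "y \<le> 1"
      have z: "0 < y2 x" "y2 x \<le> y2 y" "y2 y \<le> 1" using x by (auto simp: y2_def)
      have "\<bar>P2 y - P2 x\<bar> \<le> \<bar>P (y2 y) - P (y2 x)\<bar> + \<bar>\<phi> s (y2 y) - \<phi> s (y2 x)\<bar>"
        unfolding P2_def by linarith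
      also have "\<dots> \<le> L * (height (y2 y) - height (y2 x)) + L * (y2 y - y2 x)"
        using z by (intro add_mono var ps) auto
      also have "\<dots> = L * (height (y2 y) - height (y2 x) + (y2 y - y2 x))" by (simp add: distrib_left)
      also have "\<dots> \<le> L * (height y - height x)"
        using height_right[OF x] L by (intro mult_left_mono) (auto simp: y2_def)
      finally show "\<bar>P2 y - P2 x\<bar> \<le> L * (height y - height x)" .
    qed (use Suc.prems(4) in auto)
  qed
  also have "\<dots> = (B + 3 * L * \<Lambda>) * coupling_err e l k p u (transfers \<alpha> (Suc q) s h)"
  proof -
    have "transfers \<alpha> (Suc q) s h = transfers \<alpha> q (Suc s) (\<lambda>x. h1 x + h2 x)"
      using th by (simp add: a_def)
    also have "\<dots> = (\<lambda>x. transfers \<alpha> q (Suc s) h1 x + transfers \<alpha> q (Suc s) h2 x)"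
      by (simp add: fun_eq_iff transfers_add_fun)
    finally have "transfers \<alpha> (Suc q) s h =
      (\<lambda>x. transfers \<alpha> q (Suc s) h1 x + transfers \<alpha> q (Suc s) h2 x)" .
    then show ?thesis
      by (simp add: coupling_err_add dec_dens_transfers dh distrib_left)
  qed
  finally show ?case by (simp add: Q_def)
qed

end

subsection \<open>The rate of memory loss\<close>

text \<open>The shifts make the rate positive from r = 0 on; 3 is used since it exceeds e, so the
  logarithm is at least 1.\<close>

definition mixing_rate :: "real \<Rightarrow> nat \<Rightarrow> real" where
  "mixing_rate \<beta> r = (real r + 1) powr (1 - 1 / \<beta>) * ln (real r + 3) powr (1 / \<beta>)"

lemma ln_add3_ge_1: "1 \<le> ln (real r + 3)"
proof -
  have "ln (exp 1) \<le> ln (real r + 3)"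
    using exp_le by (subst ln_le_cancel_iff) auto
  then show ?thesis by simp
qed

lemma mixing_rate_pos: "0 < mixing_rate \<beta> r"
  using ln_add3_ge_1[of r] by (simp add: mixing_rate_def)

text \<open>The number k of blocks is proportional to the logarithm, with the factor that makes
  \<open>(1 - c) ^ k\<close> at most \<open>(real r + 3) powr (- 1 / \<beta>)\<close>. The block
  length is then r / k, and e is as small as this length allows. The tail term is of order k times
  (k / r) to the power 1/\<beta> - 1, hence \<open>k powr (1 / \<beta>)\<close> times the polynomial
  rate. The factor 21 anticipates the tail masses in \<open>memory_loss\<close>.\<close>

lemma block_choice:
  fixes \<beta> c :: real
  assumes b: "0 < \<beta>" "\<beta> < 1" and c: "0 < c" "c < 1"
  shows "\<exists>C>0. \<forall>r. \<exists>e l k. 0 < e \<and> e \<le> 1 \<and> 40 / \<beta> * e powr - \<beta> < real l \<and> k * l \<le> r \<and>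
    2 * (1 - c) ^ k + 21 * real k * e powr (1 - \<beta>) \<le> C * mixing_rate \<beta> r"
proof -
  define \<kappa> where "\<kappa> = (1 / \<beta>) / (- ln (1 - c))"
  have ln: "ln (1 - c) < 0" using c by simp
  have \<kappa>: "0 < \<kappa>" unfolding \<kappa>_def using b ln by (intro divide_pos_pos) auto
  define C1 where "C1 = 41 / \<beta>"
  have C1: "41 < C1" using b by (simp add: C1_def field_simps)
  define \<kappa>' where "\<kappa>' = (\<kappa> + 1) * (C1 + 2)"
  have \<kappa>'0: "0 < \<kappa>'" using \<kappa> C1 by (simp add: \<kappa>'_def)
  define p where "p = 1 / \<beta> - 1"
  have p: "0 < p" using b by (simp add: p_def)
  define CA where "CA = 2 + 21 * ((\<kappa> + 1) powr (1 / \<beta>) * (2 * C1) powr p * 2 powr p)"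
  define CB where "CB = 2 * \<kappa>' powr p"
  have CA: "0 < CA" using \<kappa> C1 by (auto simp: CA_def intro!: add_pos_nonneg)
  have CB: "0 < CB" using \<kappa>'0 by (simp add: CB_def)
  have "\<exists>e l k. 0 < e \<and> e \<le> 1 \<and> 40 / \<beta> * e powr - \<beta> < real l \<and> k * l \<le> r \<and>
    2 * (1 - c) ^ k + 21 * real k * e powr (1 - \<beta>) \<le> (CA + CB) * mixing_rate \<beta> r" for r
  proof -
    define w where "w = ln (real r + 3)"
    have w: "1 \<le> w" unfolding w_def by (rule ln_add3_ge_1)
    define k where "k = nat \<lceil>\<kappa> * w\<rceil>"
    have \<kappa>w: "0 < \<kappa> * w" using \<kappa> w by simp
    have k: "\<kappa> * w \<le> real k" "real k \<le> \<kappa> * w + 1" "1 \<le> k"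
      using \<kappa>w unfolding k_def by (auto simp: Suc_le_eq)
    have k2: "real k \<le> (\<kappa> + 1) * w" using k(2) w by (simp add: algebra_simps)
    have rate: "mixing_rate \<beta> r = (real r + 1) powr (- p) * w powr (1 / \<beta>)"
      by (simp add: mixing_rate_def p_def w_def)
    show ?thesis
    proof (cases "real k * (C1 + 1) \<le> real r")
      case True
      define l where "l = r div k"
      have kl: "k * l \<le> r" by (simp add: l_def)
      have rk: "C1 + 1 \<le> real r / real k" using True k by (simp add: field_simps)
      have l_gt: "real r / real k - 1 < real l"
      proof -
        have "r = k * l + r mod k" by (simp add: l_def)
        moreover have "r mod k < k" using k(3) by simp
        ultimately have "r < k * l + k" by linarith
        then have "real r < real (k * l + k)" by (simp only: of_nat_less_iff)
        then show ?thesis using k(3) by (simp add: field_simps)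
      qed
      have l: "C1 < real l" "real r / (2 * real k) \<le> real l"
        using l_gt rk C1 by (auto simp: field_simps)
      have r1: "1 \<le> real r" using True k C1 mult_mono[of 1 "real k" 1 "C1 + 1"] by simp
      \<comment> \<open>\<open>C1\<close> is 41/\<beta> instead of 40/\<beta> to make the inequality
        for the block length strict; \<open>C1 < real l\<close> gives
        \<open>e \<le> 1\<close>.\<close>
      define e where "e = (C1 / real l) powr (1 / \<beta>)"
      have l0: "0 < real l" using l C1 by simp
      have e: "0 < e" "e \<le> 1" using l C1 l0 b by (auto simp: e_def powr_le1)
      have eb: "e powr - \<beta> = real l / C1"
        using l0 C1 b by (simp add: e_def powr_powr powr_minus_divide)
      have le: "40 / \<beta> * e powr - \<beta> < real l"
        unfolding eb using l0 b by (simp add: C1_def field_simps)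
      have e1: "e powr (1 - \<beta>) = (C1 / real l) powr p"
        using b by (simp add: e_def powr_powr p_def field_simps)
      also have "\<dots> \<le> (2 * C1 * real k / real r) powr p"
      proof (intro powr_mono2)
        have "C1 / real l \<le> C1 / (real r / (2 * real k))"
          using l C1 k r1 by (intro divide_left_mono) auto
        then show "C1 / real l \<le> 2 * C1 * real k / real r" by (simp add: mult_ac)
      qed (use p C1 in auto)
      also have "\<dots> = (2 * C1) powr p * real k powr p * real r powr - p"
        using C1 k r1 by (simp add: powr_mult powr_divide powr_minus_divide)
      also have "real r powr - p \<le> ((real r + 1) / 2) powr - p"
        using p r1 by (intro powr_mono2') auto
      also have "((real r + 1) / 2) powr - p = 2 powr p * (real r + 1) powr - p"
        by (simp add: powr_divide powr_minus field_simps)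
      finally have e2: "e powr (1 - \<beta>) \<le> (2 * C1) powr p * real k powr p * (2 powr p * (real r + 1) powr - p)"
        by (simp add: mult_left_mono)
      have "real k * e powr (1 - \<beta>) \<le> real k * ((2 * C1) powr p * real k powr p * (2 powr p * (real r + 1) powr - p))"
        by (rule mult_left_mono[OF e2]) simp
      also have "\<dots> = (2 * C1) powr p * 2 powr p * (real r + 1) powr - p * (real k * real k powr p)"
        by simp
      also have "\<dots> \<le> (2 * C1) powr p * 2 powr p * (real r + 1) powr - p * ((\<kappa> + 1) powr (1 / \<beta>) * w powr (1 / \<beta>))"
      proof (rule mult_left_mono)
        have "real k * real k powr p = real k powr (1 / \<beta>)"
          using k powr_add[of "real k" 1 p] by (simp add: p_def)
        also have "\<dots> \<le> ((\<kappa> + 1) * w) powr (1 / \<beta>)" using k2 b by (intro powr_mono2) auto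
        also have "\<dots> = (\<kappa> + 1) powr (1 / \<beta>) * w powr (1 / \<beta>)" using \<kappa> w by (simp add: powr_mult)
        finally show "real k * real k powr p \<le> (\<kappa> + 1) powr (1 / \<beta>) * w powr (1 / \<beta>)" .
      qed simp
      finally have t2: "real k * e powr (1 - \<beta>) \<le>
          (\<kappa> + 1) powr (1 / \<beta>) * (2 * C1) powr p * 2 powr p * mixing_rate \<beta> r"
        by (simp only: rate mult_ac)
      have "(1 - c) ^ k = exp (real k * ln (1 - c))" using c by (simp add: exp_of_nat_mult)
      also have "\<dots> \<le> exp (\<kappa> * w * ln (1 - c))"
        using k(1) ln by (simp add: mult_right_mono_neg)
      also have "\<kappa> * w * ln (1 - c) = - 1 / \<beta> * w" using ln b by (simp add: \<kappa>_def field_simps)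
      also have "exp (- 1 / \<beta> * w) = (real r + 3) powr (- 1 / \<beta>)" by (simp add: powr_def w_def)
      also have "\<dots> \<le> (real r + 1) powr (- 1 / \<beta>)" using b by (intro powr_mono2') auto
      also have "\<dots> \<le> (real r + 1) powr (- p)" using b by (intro powr_mono) (auto simp: p_def)
      also have "\<dots> \<le> (real r + 1) powr (- p) * w powr (1 / \<beta>)"
        using w b by (simp add: ge_one_powr_ge_zero mult_le_cancel_left1)
      finally have t1: "(1 - c) ^ k \<le> mixing_rate \<beta> r" by (simp add: rate)
      have "2 * (1 - c) ^ k + 21 * real k * e powr (1 - \<beta>) \<le> CA * mixing_rate \<beta> r"
        using t1 t2 by (simp add: CA_def algebra_simps)
      also have "\<dots> \<le> (CA + CB) * mixing_rate \<beta> r"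
        using CB mixing_rate_pos[of \<beta> r] by (intro mult_right_mono) auto
      finally show ?thesis using e le kl by blast
    next
      case False
      \<comment> \<open>There are too few steps for k blocks, so r + 1 is at most a multiple of w
        and the rate is bounded below. The trivial choice of no block, with error 2, is then enough,
        and \<open>CB\<close> normalises it.\<close>
      have "real r + 1 \<le> real k * (C1 + 2)" using False k by (simp add: algebra_simps)
      also have "\<dots> \<le> (\<kappa> + 1) * w * (C1 + 2)" using k2 C1 by (intro mult_right_mono) auto
      also have "\<dots> = \<kappa>' * w" by (simp add: \<kappa>'_def)
      finally have "(\<kappa>' * w) powr - p \<le> (real r + 1) powr - p"
        using p by (intro powr_mono2') auto
      then have "\<kappa>' powr - p * (w powr - p * w powr (1 / \<beta>)) \<le> mixing_rate \<beta> r"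
        unfolding rate using \<kappa>'0 w by (simp add: powr_mult mult_right_mono mult.assoc[symmetric])
      also have "w powr - p * w powr (1 / \<beta>) = w" using w by (simp add: powr_add[symmetric] p_def)
      finally have "\<kappa>' powr - p * 1 \<le> mixing_rate \<beta> r"
        using w mult_left_mono[of 1 w "\<kappa>' powr - p"] by simp
      then have "CB * (\<kappa>' powr - p * 1) \<le> CB * mixing_rate \<beta> r" using CB by (intro mult_left_mono) auto
      moreover have "CB * (\<kappa>' powr - p * 1) = 2" using \<kappa>'0 by (simp add: CB_def powr_minus field_simps)
      moreover have "CB * mixing_rate \<beta> r \<le> (CA + CB) * mixing_rate \<beta> r"
        using CA mixing_rate_pos[of \<beta> r] by (intro mult_right_mono) auto
      moreover obtain l :: nat where "40 / \<beta> * 1 powr - \<beta> < real l" using reals_Archimedean2 by blast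
      ultimately show ?thesis by (intro exI[of _ 1] exI[of _ l] exI[of _ 0]) auto
    qed
  qed
  then show ?thesis using CA CB by (intro exI[of _ "CA + CB"]) auto
qed

text \<open>For \<beta> below 1/3 the exponent 1 - 1/\<beta> is below -2, and the excess absorbs the
  logarithm.\<close>

lemma summable_mixing_rate:
  assumes "0 < \<beta>" "\<beta> < 1/3" shows "summable (mixing_rate \<beta>)"
proof (rule summable_comparison_test_bigo)
  have "3 < 1 / \<beta>" using assms by (simp add: field_simps)
  define q where "q = 1 / \<beta> - 3"
  have q: "q > 0" "1 - 1 / \<beta> = - 2 - q" "1 / \<beta> = q + 3" using \<open>3 < 1 / \<beta>\<close> by (auto simp: q_def)
  show "mixing_rate \<beta> \<in> O(\<lambda>n. real n powr - 2)"
    unfolding mixing_rate_def[abs_def] q(2,3) using q(1) by real_asymp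
  show "summable (\<lambda>n. norm (real n powr - 2))" by (simp add: summable_real_powr_iff)
qed

context admissible
begin

text \<open>The reference density is the law \<open>u\<close> of the orbit at time p, so centring
  under the initial density is the same as centring under \<open>u\<close> after n more steps.
  \<open>past_coupling\<close> is started at time 0 with \<open>P = 0\<close>, and then the density
  transferred to time p is \<open>u\<close> itself. The constant comes before all other quantifiers:
  it is uniform in the observables, in p and in n.\<close>

lemma memory_loss:
  assumes g: "dec_dens g" "mass g = 1" and t: "\<And>x. 0 < x \<Longrightarrow> x \<le> 1 \<Longrightarrow> g x \<le> 7/2 * x powr - \<beta>"
  shows "\<exists>C>0. \<forall>(\<phi> :: nat \<Rightarrow> real \<Rightarrow> real) L \<Theta> \<Lambda> B p n. 0 \<le> L \<longrightarrow> 0 \<le> \<Lambda> \<longrightarrow>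
    (\<forall>i. \<phi> i \<in> borel_measurable borel) \<longrightarrow>
    (\<forall>i x y. x \<in> {0..1} \<longrightarrow> y \<in> {0..1} \<longrightarrow> \<bar>\<phi> i x - \<phi> i y\<bar> \<le> L * \<bar>x - y\<bar>) \<longrightarrow>
    case_prod \<Theta> \<in> borel_measurable (borel \<Otimes>\<^sub>M borel) \<longrightarrow>
    (\<forall>s z. z \<in> {0..1} \<longrightarrow> \<bar>\<Theta> s z\<bar> \<le> B) \<longrightarrow>
    (\<forall>s t z. z \<in> {0..1} \<longrightarrow> \<bar>\<Theta> s z - \<Theta> t z\<bar> \<le> \<Lambda> * \<bar>s - t\<bar>) \<longrightarrow>
    (\<forall>t. mass (\<lambda>x. \<Theta> t (orbit \<alpha> (p + n) 0 x) * g x) = 0) \<longrightarrow>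
    \<bar>mass (\<lambda>x. \<Theta> (\<Sum>i<p. \<phi> i (orbit \<alpha> i 0 x)) (orbit \<alpha> (p + n) 0 x) * g x)\<bar>
      \<le> (B + 3 * L * \<Lambda>) * (C * mixing_rate \<beta> n)"
proof -
  obtain C where C: "C > 0" "\<And>r. \<exists>e l k. 0 < e \<and> e \<le> 1 \<and> 40 / \<beta> * e powr - \<beta> < real l \<and> k * l \<le> r \<and>
    2 * (1 - overlap) ^ k + 21 * real k * e powr (1 - \<beta>) \<le> C * mixing_rate \<beta> r"
    using block_choice[of \<beta> overlap] beta overlap by auto
  have "\<bar>mass (\<lambda>x. \<Theta> (\<Sum>i<p. \<phi> i (orbit \<alpha> i 0 x)) (orbit \<alpha> (p + n) 0 x) * g x)\<bar>
      \<le> (B + 3 * L * \<Lambda>) * (C * mixing_rate \<beta> n)"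
    if L: "0 \<le> L" "0 \<le> \<Lambda>" and phi: "\<forall>i. \<phi> i \<in> borel_measurable borel"
      "\<forall>i x y. x \<in> {0..1} \<longrightarrow> y \<in> {0..1} \<longrightarrow> \<bar>\<phi> i x - \<phi> i y\<bar> \<le> L * \<bar>x - y\<bar>"
      and T: "case_prod \<Theta> \<in> borel_measurable (borel \<Otimes>\<^sub>M borel)"
      and B: "\<forall>s z. z \<in> {0..1} \<longrightarrow> \<bar>\<Theta> s z\<bar> \<le> B"
      and lip: "\<forall>s t z. z \<in> {0..1} \<longrightarrow> \<bar>\<Theta> s z - \<Theta> t z\<bar> \<le> \<Lambda> * \<bar>s - t\<bar>"
      and zero: "\<forall>t. mass (\<lambda>x. \<Theta> t (orbit \<alpha> (p + n) 0 x) * g x) = 0"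
    for \<phi> :: "nat \<Rightarrow> real \<Rightarrow> real" and L \<Theta> \<Lambda> B p n
  proof -
    obtain e l k where e: "0 < e" "e \<le> 1" and l: "40 / \<beta> * e powr - \<beta> < real l" and k: "k * l \<le> n"
      and err: "2 * (1 - overlap) ^ k + 21 * real k * e powr (1 - \<beta>) \<le> C * mixing_rate \<beta> n"
      using C(2)[of n] by blast
    define u where "u = transfers \<alpha> p 0 g"
    have u: "dec_dens u" "mass u = 1" using g by (auto simp: u_def dec_dens_transfers mass_transfers)
    have tu: "u x \<le> 7/2 * 1 * x powr - \<beta>" if "0 < x" "x \<le> 1" for x
      unfolding u_def by (rule tail_transfers) (use g t that in auto)
    \<comment> \<open>21/4 is 7/2 times the bound 3/2 for 1 / (1 - \<beta>). Two densities and the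
      factor 2 in \<open>coupling_err\<close> turn it into the 21 of
      \<open>block_choice\<close>.\<close>
    have tail: "tail_mass e (transfers \<alpha> q p u) \<le> 21/4 * e powr (1 - \<beta>)" for q
    proof -
      define I where "I = (indicator {..e} :: real \<Rightarrow> real)"
      note Pw = powr_integral_lebesgue01[of \<beta> e, folded I_def]
      have "tail_mass e (transfers \<alpha> q p u) \<le> mass (\<lambda>x. 7/2 * (I x * x powr - \<beta>))"
        unfolding tail_mass_def I_def[symmetric]
      proof (rule integral_lebesgue01_mono)
        show "integrable lebesgue01 (\<lambda>x. I x * transfers \<alpha> q p u x)"
          unfolding I_def by (rule dec_densD(3)[OF dec_dens_indicator[OF dec_dens_transfers[OF u(1)]]])
        show "integrable lebesgue01 (\<lambda>x. 7/2 * (I x * x powr - \<beta>))" using Pw e beta by auto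
        fix x :: real assume "0 < x" "x < 1"
        then show "I x * transfers \<alpha> q p u x \<le> 7/2 * (I x * x powr - \<beta>)"
          using tail_transfers[OF u(1) _ tu, of x q p] u(2) by (auto simp: I_def indicator_def)
      qed
      also have "\<dots> = 7/2 * e powr (1 - \<beta>) * (1 / (1 - \<beta>))" using Pw e beta by simp
      also have "\<dots> \<le> 7/2 * e powr (1 - \<beta>) * (3/2)" using one_minus_beta_bound by (intro mult_left_mono) auto
      finally show ?thesis by simp
    qed
    have G: "(\<lambda>x. \<Theta> t (orbit \<alpha> n p x)) \<in> borel_measurable borel" for t
    proof -
      have "(\<lambda>z. \<Theta> t z) \<in> borel_measurable borel"
        using measurable_compose[OF measurable_Pair1'[of t borel borel] T] by simp
      then show ?thesis by measurable
    qed
    have z: "mass (\<lambda>x. \<Theta> t (orbit \<alpha> n p x) * u x) = 0" for t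
    proof -
      have "mass (\<lambda>x. \<Theta> t (orbit \<alpha> n p (orbit \<alpha> p 0 x)) * g x) = mass (\<lambda>x. \<Theta> t (orbit \<alpha> n p x) * u x)"
        unfolding u_def
        by (rule transfers_dual[where G = "\<lambda>x. \<Theta> t (orbit \<alpha> n p x)" and B = B])
          (use dec_densD[OF g(1)] G B orbit_in in auto)
      then show ?thesis using zero by (simp add: orbit_add)
    qed
    have "\<bar>mass (\<lambda>x. \<Theta> (\<Sum>i<p. \<phi> i (orbit \<alpha> i 0 x)) (orbit \<alpha> (p + n) 0 x) * g x)\<bar>
        \<le> (B + 3 * L * \<Lambda>) * coupling_err e l k p u u"
      using past_coupling[OF u e l k L(1) _ _ T L(2) _ _ z g(1), of \<phi> B "\<lambda>_. 0" 0 p] phi B lip L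
      by (simp add: u_def[symmetric] height_mono)
    also have "\<dots> \<le> (B + 3 * L * \<Lambda>) * (C * mixing_rate \<beta> n)"
    proof (rule mult_left_mono)
      have "(\<Sum>j<k. tail_mass e (transfers \<alpha> (j * l) p u) + mass u * tail_mass e (transfers \<alpha> (j * l) p u))
          \<le> (\<Sum>j<k. 21/4 * e powr (1 - \<beta>) + 1 * (21/4 * e powr (1 - \<beta>)))"
        unfolding u(2) by (intro sum_mono add_mono mult_left_mono tail) auto
      then show "coupling_err e l k p u u \<le> C * mixing_rate \<beta> n"
        using err by (simp add: coupling_err_def u(2))
      have "\<bar>\<Theta> 0 0\<bar> \<le> B" using B by simp
      then have "0 \<le> B" by linarith
      then show "0 \<le> B + 3 * L * \<Lambda>" using L by simp
    qed
    finally show ?thesis .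
  qed
  then show ?thesis using C(1) by blast
qed

end

section \<open>Stein's equation\<close>

abbreviation gauss :: "real \<Rightarrow> real" where
  "gauss x \<equiv> exp (- (x\<^sup>2 / 2))"

lemma gauss_deriv: "(gauss has_real_derivative - x * gauss x) (at x)"
  by (auto intro!: derivative_eq_intros)

lemma gauss_density: "gauss x = sqrt (2 * pi) * std_normal_density x"
  by (simp add: std_normal_density_def)

text \<open>Both bounds compare \<open>H\<close> with a multiple of a function that also vanishes at infinity.\<close>
lemma gauss_tail_bound:
  assumes H: "\<And>x. 0 < x \<Longrightarrow> (H has_real_derivative k x) (at x)" and lim: "(H \<longlongrightarrow> 0) at_top"
    and w: "\<And>x. x \<ge> m \<Longrightarrow> (w has_real_derivative w' x) (at x)" "(w \<longlongrightarrow> 0) at_top"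
    and k: "\<And>x. x \<ge> m \<Longrightarrow> \<bar>k x\<bar> \<le> - w' x" and x: "0 < m" "m \<le> x"
  shows "\<bar>H x\<bar> \<le> w x"
proof -
  have *: "s * H x - w x \<le> 0" if s: "s = 1 \<or> s = - 1" for s :: real
  proof (rule tendsto_lowerbound)
    show "((\<lambda>y. s * H y - w y) \<longlongrightarrow> 0) at_top"
      using tendsto_diff[OF tendsto_mult[OF tendsto_const lim, of s] w(2)] by simp
    show "\<forall>\<^sub>F y in at_top. s * H x - w x \<le> s * H y - w y"
    proof (rule eventually_mono[OF eventually_ge_at_top[of x]])
      fix y assume y: "x \<le> y"
      show "s * H x - w x \<le> s * H y - w y"
      proof (rule DERIV_nonneg_imp_nondecreasing[where f = "\<lambda>y. s * H y - w y", OF y])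
        fix z assume z: "x \<le> z" "z \<le> y"
        have "((\<lambda>y. s * H y - w y) has_real_derivative s * k z - w' z) (at z)"
          using z x by (intro DERIV_diff DERIV_cmult H w) auto
        moreover have "0 \<le> s * k z - w' z" using k[of z] z x s by auto
        ultimately show "\<exists>d. ((\<lambda>y. s * H y - w y) has_real_derivative d) (at z) \<and> 0 \<le> d" by blast
      qed
    qed
  qed simp
  show ?thesis using *[of 1] *[of "- 1"] by simp
qed

lemma gauss_lim: "((\<lambda>x. x ^ n * gauss x) \<longlongrightarrow> 0) at_top"
proof -
  have "((\<lambda>x::real. x ^ n / exp x) \<longlongrightarrow> 0) at_top" by (rule tendsto_power_div_exp_0)
  moreover have "((\<lambda>x::real. exp (x - x\<^sup>2 / 2)) \<longlongrightarrow> 0) at_top" by real_asymp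
  ultimately have "((\<lambda>x::real. x ^ n / exp x * exp (x - x\<^sup>2 / 2)) \<longlongrightarrow> 0 * 0) at_top" by (rule tendsto_mult)
  moreover have "(\<lambda>x::real. x ^ n / exp x * exp (x - x\<^sup>2 / 2)) = (\<lambda>x. x ^ n * gauss x)"
  proof
    fix x :: real
    have "exp (x - x\<^sup>2 / 2) = exp x * gauss x" using exp_add[of x "- (x\<^sup>2 / 2)"] by simp
    then show "x ^ n / exp x * exp (x - x\<^sup>2 / 2) = x ^ n * gauss x" by simp
  qed
  ultimately show ?thesis by simp
qed

text \<open>The comparison function \<open>2 * gauss x\<close> decreases at rate
  \<open>2 * x * gauss x\<close>, which dominates \<open>(x + 1) * gauss x\<close> from 1
  on.\<close>

lemma gauss_tail_linear:
  assumes H: "\<And>x. 0 < x \<Longrightarrow> (H has_real_derivative k x) (at x)" and lim: "(H \<longlongrightarrow> 0) at_top"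
    and k: "\<And>x. 0 < x \<Longrightarrow> \<bar>k x\<bar> \<le> (x + 1) * gauss x" and x: "1 \<le> x"
  shows "\<bar>H x\<bar> \<le> 2 * gauss x"
proof (rule gauss_tail_bound[where k = k and m = 1 and w = "\<lambda>x. 2 * gauss x"
      and w' = "\<lambda>x. - (2 * x) * gauss x", OF H lim])
  show "((\<lambda>x. 2 * gauss x) has_real_derivative - (2 * x) * gauss x) (at x)" for x :: real
    by (auto intro!: derivative_eq_intros)
  show "((\<lambda>x. 2 * gauss x) \<longlongrightarrow> 0) at_top"
    using tendsto_mult[OF tendsto_const gauss_lim[of 0], of 2] by simp
  fix x :: real assume "1 \<le> x"
  then have "(x + 1) * gauss x \<le> 2 * x * gauss x" by (intro mult_right_mono) auto
  moreover have "\<bar>k x\<bar> \<le> (x + 1) * gauss x" using k[of x] \<open>1 \<le> x\<close> by simp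
  ultimately show "\<bar>k x\<bar> \<le> - (- (2 * x) * gauss x)" by linarith
qed (use x in auto)

text \<open>The Mills ratio estimate: \<open>R / x * gauss x\<close> decreases at rate
  \<open>R * (1 + 1 / x\<^sup>2) * gauss x\<close>, more than the derivative of H can
  compensate.\<close>

lemma gauss_tail_const:
  assumes H: "\<And>x. 0 < x \<Longrightarrow> (H has_real_derivative r x * gauss x) (at x)" and lim: "(H \<longlongrightarrow> 0) at_top"
    and r: "\<And>x. 0 < x \<Longrightarrow> \<bar>r x\<bar> \<le> R" and x: "0 < x"
  shows "x * \<bar>H x\<bar> \<le> R * gauss x"
proof -
  have "0 \<le> \<bar>r x\<bar>" by simp
  then have R: "0 \<le> R" using r[OF x] by linarith
  have "\<bar>H x\<bar> \<le> R / x * gauss x"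
  proof (rule gauss_tail_bound[OF H lim, where m = x and w = "\<lambda>x. R / x * gauss x" and w' = "\<lambda>x. - R * (1 + 1 / x\<^sup>2) * gauss x"])
    show "((\<lambda>x. R / x * gauss x) has_real_derivative - R * (1 + 1 / y\<^sup>2) * gauss y) (at y)" if "x \<le> y" for y
      using that x by (auto intro!: derivative_eq_intros simp: field_simps power2_eq_square)
    have "((\<lambda>x::real. R / x) \<longlongrightarrow> 0) at_top" by real_asymp
    then show "((\<lambda>x. R / x * gauss x) \<longlongrightarrow> 0) at_top"
      using tendsto_mult[OF _ gauss_lim[of 0]] by fastforce
    fix y :: real assume y: "x \<le> y"
    have "\<bar>r y\<bar> * gauss y \<le> R * gauss y" using r[of y] x y by (intro mult_right_mono) auto
    also have "\<dots> \<le> R * (1 + 1 / y\<^sup>2) * gauss y" using R by (intro mult_right_mono) (auto simp: mult_le_cancel_left1)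
    finally show "\<bar>r y * gauss y\<bar> \<le> - (- R * (1 + 1 / y\<^sup>2) * gauss y)" by (simp add: abs_mult)
  qed (use x in auto)
  then show ?thesis using x by (simp add: field_simps)
qed

lemma continuous_antiderivative:
  fixes k :: "real \<Rightarrow> real"
  assumes "\<And>x. isCont k x"
  obtains F where "\<And>x. (F has_real_derivative k x) (at x)"
  using einterval_antiderivative[of "-\<infinity>" \<infinity> k] assms
  by (auto simp: has_real_derivative_iff_has_vector_derivative)

text \<open>H is the integral up to y, which differs from any antiderivative by a constant. The
  limit at the right end is the total integral, hence 0; the limit at the left end is the same fact
  for the reflected function.\<close>

lemma centred_primitive:
  fixes k :: "real \<Rightarrow> real"
  assumes cont: "\<And>x. isCont k x" and int: "integrable lborel k" and zero: "(\<integral>x. k x \<partial>lborel) = 0"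
  obtains H where "\<And>x. (H has_real_derivative k x) (at x)" "(H \<longlongrightarrow> 0) at_top" "(H \<longlongrightarrow> 0) at_bot"
proof -
  obtain F where F: "\<And>x. (F has_real_derivative k x) (at x)"
    using continuous_antiderivative[OF cont] by blast
  have [measurable]: "k \<in> borel_measurable borel"
    using cont by (intro borel_measurable_continuous_onI) (simp add: continuous_at_imp_continuous_on)
  define H where "H = (\<lambda>y. \<integral>x. indicator {..y} x * k x \<partial>lborel)"
  have i: "integrable lborel (\<lambda>x. indicator A x * k x)" if "A \<in> sets borel" for A
    using integrable_mult_indicator[OF _ int, of A] that by simp
  have HF: "H y - H x = F y - F x" if "x \<le> y" for x y
  proof -
    have "F y - F x = (\<integral>z. k z * indicator {x..y} z \<partial>lborel)"
      using integral_FTC_Icc_real[OF that, of F k] F cont by simp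
    also have "\<dots> = (\<integral>z. indicator {..y} z * k z - indicator {..x} z * k z \<partial>lborel)"
    proof (rule integral_cong_AE)
      show "AE z in lborel. k z * indicator {x..y} z = indicator {..y} z * k z - indicator {..x} z * k z"
        using AE_lborel_singleton[of x] by eventually_elim (use that in \<open>auto simp: indicator_def\<close>)
    qed auto
    also have "\<dots> = H y - H x" unfolding H_def by (intro Bochner_Integration.integral_diff i) auto
    finally show ?thesis ..
  qed
  have "H = (\<lambda>y. F y + (H 0 - F 0))"
  proof
    fix y show "H y = F y + (H 0 - F 0)" using HF[of 0 y] HF[of y 0] by (cases "0 \<le> y") auto
  qed
  then have "(H has_real_derivative k x) (at x)" for x
    using DERIV_add[OF F[of x] DERIV_const[of "H 0 - F 0"]] by simp
  moreover have "(H \<longlongrightarrow> 0) at_top"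
    using tendsto_integral_at_top[of lborel k] int zero by (simp add: H_def)
  moreover have "(H \<longlongrightarrow> 0) at_bot"
  proof -
    have k': "integrable lborel (\<lambda>x. k (- x))" "(\<integral>x. k (- x) \<partial>lborel) = 0"
      using lborel_integrable_real_affine[OF int, of "- 1" 0] lborel_integral_real_affine[of "- 1" k 0] zero by auto
    have eq: "(\<integral>x. indicator {..y} x * k (- x) \<partial>lborel) = - H (- y)" for y
    proof -
      have "(\<integral>x. indicator {..y} x * k (- x) \<partial>lborel) = (\<integral>x. indicator {- y..} x * k x \<partial>lborel)"
        using lborel_integral_real_affine[of "- 1" "\<lambda>x. indicator {- y..} x * k x" 0]
        by (simp add: indicator_def neg_le_iff_le cong: if_cong)
      also have "\<dots> = (\<integral>x. k x - indicator {..- y} x * k x \<partial>lborel)"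
      proof (rule integral_cong_AE)
        show "AE x in lborel. indicator {- y..} x * k x = k x - indicator {..- y} x * k x"
          using AE_lborel_singleton[of "- y"] by eventually_elim (auto simp: indicator_def)
      qed auto
      also have "\<dots> = - H (- y)" using int i[of "{..- y}"] zero by (simp add: H_def)
      finally show ?thesis .
    qed
    have "((\<lambda>y. - H (- y)) \<longlongrightarrow> 0) at_top"
      using tendsto_integral_at_top[of lborel "\<lambda>x. k (- x)"] k' by (simp add: eq)
    then have "((\<lambda>y. H (- y)) \<longlongrightarrow> 0) at_top" using tendsto_minus_cancel[of "\<lambda>y. H (- y)" 0 at_top] by simp
    then show ?thesis by (simp add: filterlim_at_bot_mirror)
  qed
  ultimately show thesis using that by blast
qed

text \<open>The solution is A = H / \<open>gauss\<close>, where H is the primitive of (h - c)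
  \<open>gauss\<close>. Gaussian tails bound A by 2 outside the unit interval. Differentiating the
  equation gives A'' = x A' + r with r = A + h', so A' \<open>gauss\<close> has derivative r
  \<open>gauss\<close>; as |r| is at most 13, the Mills bound yields |x A'| \<le> 13. Hence |A''|
  \<le> 26, while near 0 the equation itself gives |A'| \<le> 12 + 2. Smoothness of h is used to
  differentiate A' and is removed later.\<close>

lemma stein_equation:
  fixes h h' :: "real \<Rightarrow> real"
  assumes lip: "\<And>x y. \<bar>h x - h y\<bar> \<le> \<bar>x - y\<bar>" and deriv: "\<And>x. (h has_real_derivative h' x) (at x)"
  defines "c \<equiv> (\<integral>x. std_normal_density x * h x \<partial>lborel)"
  obtains A A' where "\<And>x. (A has_real_derivative A' x) (at x)" "\<And>x. A' x = x * A x + (h x - c)"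
    "\<And>x. \<bar>A x\<bar> \<le> 12" "\<And>x. \<bar>A' x\<bar> \<le> 14" "\<And>x y. \<bar>A' x - A' y\<bar> \<le> 26 * \<bar>x - y\<bar>"
proof -
  let ?\<phi> = std_normal_density
  have contf: "isCont h x" for x using deriv DERIV_isCont by blast
  have [measurable]: "h \<in> borel_measurable borel"
    using contf by (intro borel_measurable_continuous_onI) (simp add: continuous_at_imp_continuous_on)
  have i0: "integrable lborel ?\<phi>" using integrable_std_normal_moment[of 0] by simp
  have m0: "(\<integral>x. ?\<phi> x \<partial>lborel) = 1" using integral_std_normal_moment_even[of 0] by simp
  have i1: "integrable lborel (\<lambda>x. ?\<phi> x * \<bar>x\<bar>)" using integrable_std_normal_moment_abs[of 1] by simp
  have m1: "(\<integral>x. ?\<phi> x * \<bar>x\<bar> \<partial>lborel) \<le> 1"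
    using integral_std_normal_moment_abs_odd[of 0] pi_gt3 by (simp add: real_sqrt_le_1_iff)
  have ih: "integrable lborel (\<lambda>x. ?\<phi> x * h x)"
  proof (rule Bochner_Integration.integrable_bound)
    show "integrable lborel (\<lambda>x. ?\<phi> x * (\<bar>h 0\<bar> + \<bar>x\<bar>))"
      using i0 i1 by (simp add: distrib_left)
    have "\<bar>h x\<bar> \<le> \<bar>h 0\<bar> + \<bar>x\<bar>" for x using lip[of x 0] by linarith
    then show "AE x in lborel. norm (?\<phi> x * h x) \<le> norm (?\<phi> x * (\<bar>h 0\<bar> + \<bar>x\<bar>))"
      by (intro AE_I2) (simp add: abs_mult mult_left_mono)
  qed simp
  have hc: "\<bar>h x - c\<bar> \<le> \<bar>x\<bar> + 1" for x
  proof -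
    have "h x - c = (\<integral>z. ?\<phi> z * (h x - h z) \<partial>lborel)"
      using i0 ih m0 by (simp add: c_def right_diff_distrib)
    also have "\<bar>\<dots>\<bar> \<le> (\<integral>z. \<bar>?\<phi> z * (h x - h z)\<bar> \<partial>lborel)" by (rule integral_abs_bound)
    also have "\<dots> \<le> (\<integral>z. ?\<phi> z * \<bar>x\<bar> + ?\<phi> z * \<bar>z\<bar> \<partial>lborel)"
    proof (rule integral_mono)
      have "integrable lborel (\<lambda>z. ?\<phi> z * (h x - h z))" using i0 ih by (simp add: right_diff_distrib)
      then show "integrable lborel (\<lambda>z. \<bar>?\<phi> z * (h x - h z)\<bar>)" by simp
      fix z
      have "\<bar>h x - h z\<bar> \<le> \<bar>x\<bar> + \<bar>z\<bar>" using lip[of x z] by linarith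
      then show "\<bar>?\<phi> z * (h x - h z)\<bar> \<le> ?\<phi> z * \<bar>x\<bar> + ?\<phi> z * \<bar>z\<bar>"
        by (simp add: abs_mult distrib_left[symmetric] mult_left_mono)
    qed (use i0 i1 in auto)
    also have "\<dots> \<le> \<bar>x\<bar> + 1" using i0 i1 m0 m1 by simp
    finally show ?thesis .
  qed
  define k where "k = (\<lambda>x. (h x - c) * gauss x)"
  have k_eq: "k x = sqrt (2 * pi) * (?\<phi> x * h x - c * ?\<phi> x)" for x
    by (simp add: k_def gauss_density algebra_simps)
  have "isCont k x" for x unfolding k_def by (intro continuous_intros contf) auto
  moreover have "integrable lborel k" "(\<integral>x. k x \<partial>lborel) = 0"
    unfolding k_eq using i0 ih m0 by (auto simp: c_def)
  ultimately obtain H where H: "\<And>x. (H has_real_derivative k x) (at x)" "(H \<longlongrightarrow> 0) at_top" "(H \<longlongrightarrow> 0) at_bot"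
    using centred_primitive by metis
  define A where "A = (\<lambda>x. H x / gauss x)"
  define A' where "A' = (\<lambda>x. x * A x + (h x - c))"
  have HA: "H x = A x * gauss x" for x by (simp add: A_def)
  have dA: "(A has_real_derivative A' x) (at x)" for x
  proof -
    have "(A has_real_derivative (k x * gauss x - H x * (- x * gauss x)) / (gauss x * gauss x)) (at x)"
      unfolding A_def by (rule DERIV_divide[OF H(1) gauss_deriv]) simp
    moreover have "(k x * gauss x - H x * (- x * gauss x)) / (gauss x * gauss x) = A' x"
      by (simp add: A'_def HA k_def field_simps)
    ultimately show ?thesis by simp
  qed
  have Hm: "((\<lambda>x. H (- x)) has_real_derivative - k (- x)) (at x)" for x
    using DERIV_chain2[OF H(1)[of "- x"] DERIV_minus[OF DERIV_ident]] by simp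
  have limm: "((\<lambda>x. F (- x)) \<longlongrightarrow> (0::real)) at_top" if "(F \<longlongrightarrow> 0) at_bot" for F :: "real \<Rightarrow> real"
    using that by (simp add: filterlim_at_bot_mirror)
  have kb: "\<bar>k x\<bar> \<le> (\<bar>x\<bar> + 1) * gauss x" for x
    using hc[of x] by (simp add: k_def abs_mult mult_right_mono)
  have A_out: "\<bar>A x\<bar> \<le> 2" if "1 \<le> \<bar>x\<bar>" for x
  proof -
    have "\<bar>H x\<bar> \<le> 2 * gauss x"
    proof (cases "1 \<le> x")
      case True
      show ?thesis
        by (rule gauss_tail_linear[OF H(1,2) _ True]) (use kb in \<open>metis abs_of_pos\<close>)
    next
      case False
      have "\<bar>H (- (- x))\<bar> \<le> 2 * gauss (- x)"
      proof (rule gauss_tail_linear[OF Hm limm[OF H(3)]])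
        show "\<bar>- k (- y)\<bar> \<le> (y + 1) * gauss y" if "0 < y" for y using kb[of "- y"] that by simp
      qed (use that False in auto)
      then show ?thesis by simp
    qed
    then show ?thesis by (simp add: A_def divide_le_eq)
  qed
  have A_le: "\<bar>A x\<bar> \<le> 12" for x
  proof (cases "1 \<le> \<bar>x\<bar>")
    case True then show ?thesis using A_out[of x] by simp
  next
    case False
    have H1: "\<bar>H 1\<bar> \<le> 2 * gauss 1" using A_out[of 1] by (simp add: HA abs_mult)
    \<comment> \<open>From 1 the point x is at distance at most 2, and |k| is at most 2 on the way.
      So |H x| \<le> 2 + 4, and \<open>gauss x\<close> \<ge> 1/2 turns 6 into 12.\<close>
    have "\<exists>z. x < z \<and> z < 1 \<and> H 1 - H x = (1 - x) * k z"
      using MVT2[of x 1 H k] H(1) False by auto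
    then obtain z where z: "x < z" "z < 1" "H 1 - H x = (1 - x) * k z" by blast
    have "\<bar>k z\<bar> \<le> 2 * 1"
      using z False by (intro order.trans[OF kb] mult_mono) auto
    then have "\<bar>(1 - x) * k z\<bar> \<le> 2 * 2" unfolding abs_mult using False by (intro mult_mono) auto
    moreover have "gauss 1 \<le> 1" by simp
    ultimately have "\<bar>H x\<bar> \<le> 6" using H1 z(3) by linarith
    moreover have "1/2 \<le> gauss x"
    proof -
      have "1 - x\<^sup>2 / 2 \<le> gauss x" using exp_ge_add_one_self[of "- (x\<^sup>2 / 2)"] by simp
      moreover have "x\<^sup>2 \<le> 1" using False by (simp add: abs_square_le_1)
      ultimately show ?thesis by linarith
    qed
    ultimately have "\<bar>H x\<bar> \<le> 12 * gauss x" by linarith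
    then show ?thesis by (simp add: A_def divide_le_eq)
  qed
  have h'_le: "\<bar>h' x\<bar> \<le> 1" for x
  proof -
    have lim: "((\<lambda>y. (h (x + y) - h x) / y) \<longlongrightarrow> h' x) (at 0)" using deriv by (simp add: DERIV_def)
    have "\<bar>(h (x + y) - h x) / y\<bar> \<le> 1" for y
      using lip[of "x + y" x] by (cases "y = 0") (auto simp: divide_le_eq)
    then show ?thesis
      using tendsto_upperbound[OF tendsto_rabs[OF lim], of 1] by auto
  qed
  define r where "r = (\<lambda>x. A x + h' x)"
  have r: "\<bar>r x\<bar> \<le> 13" for x using A_le[of x] h'_le[of x] by (simp add: r_def)
  have dA': "(A' has_real_derivative x * A' x + r x) (at x)" for x
    unfolding A'_def r_def by (auto intro!: derivative_eq_intros dA deriv simp: A'_def)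
  \<comment> \<open>\<open>gauss\<close> is an integrating factor: it removes the term x A' from the
    equation for A'.\<close>
  define G where "G = (\<lambda>x. A' x * gauss x)"
  have dG: "(G has_real_derivative r x * gauss x) (at x)" for x
    unfolding G_def by (auto intro!: derivative_eq_intros dA' simp: algebra_simps)
  have G_le: "\<bar>G x\<bar> \<le> (13 * \<bar>x\<bar> + 1) * gauss x" for x
  proof -
    have "\<bar>x * A x\<bar> \<le> \<bar>x\<bar> * 12" unfolding abs_mult by (intro mult_left_mono A_le) simp
    then have "\<bar>A' x\<bar> \<le> 13 * \<bar>x\<bar> + 1" using hc[of x] unfolding A'_def by linarith
    then show ?thesis by (simp add: G_def abs_mult mult_right_mono)
  qed
  have w: "((\<lambda>x. (13 * \<bar>x\<bar> + 1) * gauss x) \<longlongrightarrow> 0) at_top"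
  proof -
    have "((\<lambda>x. 13 * (x ^ 1 * gauss x) + x ^ 0 * gauss x) \<longlongrightarrow> 13 * 0 + 0) at_top"
      by (intro tendsto_intros gauss_lim)
    moreover have "\<forall>\<^sub>F x in at_top. 13 * (x ^ 1 * gauss x) + x ^ 0 * gauss x = (13 * \<bar>x\<bar> + 1) * gauss x"
      using eventually_ge_at_top[of 0] by eventually_elim (simp add: algebra_simps)
    ultimately show ?thesis using Lim_transform_eventually by fastforce
  qed
  have Glim: "(G \<longlongrightarrow> 0) at_top" "((\<lambda>x. G (- x)) \<longlongrightarrow> 0) at_top"
    using G_le[of "- _"] G_le by (auto intro!: Lim_null_comparison[OF _ w] always_eventually)
  have Gm: "((\<lambda>x. G (- x)) has_real_derivative - r (- x) * gauss x) (at x)" for x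
    using DERIV_chain2[OF dG[of "- x"] DERIV_minus[OF DERIV_ident]] by simp
  have xA': "\<bar>x * A' x\<bar> \<le> 13" for x
  proof -
    consider "x = 0" | "0 < x" | "0 < - x" by linarith
    then show ?thesis
    proof cases
      case 2
      have "x * \<bar>G x\<bar> \<le> 13 * gauss x" by (rule gauss_tail_const[OF dG Glim(1) _ 2]) (use r in auto)
      then show ?thesis using 2 by (simp add: G_def abs_mult mult.assoc[symmetric])
    next
      case 3
      have "- x * \<bar>G (- (- x))\<bar> \<le> 13 * gauss (- x)"
        by (rule gauss_tail_const[OF Gm Glim(2) _ 3]) (use r in auto)
      then have "- x * \<bar>A' x\<bar> * gauss x \<le> 13 * gauss x" by (simp add: G_def abs_mult)
      then have "- x * \<bar>A' x\<bar> \<le> 13" by (rule mult_right_le_imp_le) simp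
      then show ?thesis using 3 by (simp add: abs_mult)
    qed simp
  qed
  have A'_le: "\<bar>A' x\<bar> \<le> 14" for x
  proof (cases "1 \<le> \<bar>x\<bar>")
    case True
    have "1 * \<bar>A' x\<bar> \<le> \<bar>x\<bar> * \<bar>A' x\<bar>" using True by (intro mult_right_mono) auto
    then show ?thesis using xA'[of x] by (simp add: abs_mult)
  next
    case False
    have "\<bar>x * A x\<bar> \<le> 1 * 12" unfolding abs_mult using False A_le by (intro mult_mono) auto
    then show ?thesis using hc[of x] False unfolding A'_def by linarith
  qed
  have A'_lip: "\<bar>A' x - A' y\<bar> \<le> 26 * \<bar>x - y\<bar>" for x y
  proof -
    have *: "\<bar>A' b - A' a\<bar> \<le> 26 * \<bar>b - a\<bar>" if ab: "a < b" for a b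
    proof -
      obtain z where "A' b - A' a = (b - a) * (z * A' z + r z)"
        using MVT2[OF ab, of A' "\<lambda>x. x * A' x + r x"] dA' by blast
      moreover have "\<bar>z * A' z + r z\<bar> \<le> 26" using xA'[of z] r[of z] by linarith
      ultimately show ?thesis using ab mult_left_mono[of "\<bar>z * A' z + r z\<bar>" 26 "\<bar>b - a\<bar>"]
        by (simp only: abs_mult mult.commute[of 26])
    qed
    show ?thesis using *[of x y] *[of y x] by (cases x y rule: linorder_cases) (auto simp: abs_minus_commute)
  qed
  show thesis by (rule that[OF dA _ A_le A'_le A'_lip]) (simp add: A'_def)
qed

text \<open>Averaging h over an interval of length d gives a differentiable function with the same
  Lipschitz constant; by the mean value theorem the average is a value of h at distance less than
  d.\<close>

lemma lipschitz_smoothing: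
  fixes h :: "real \<Rightarrow> real"
  assumes lip: "\<And>x y. \<bar>h x - h y\<bar> \<le> \<bar>x - y\<bar>" and d: "0 < d"
  obtains u u' where "\<And>x. (u has_real_derivative u' x) (at x)" "\<And>x y. \<bar>u x - u y\<bar> \<le> \<bar>x - y\<bar>"
    "\<And>x. \<bar>u x - h x\<bar> \<le> d"
proof -
  have "isCont h x" for x
    unfolding continuous_at_eps_delta dist_real_def
    using lip by (meson le_less_trans)
  then obtain F where F: "\<And>x. (F has_real_derivative h x) (at x)"
    using continuous_antiderivative by blast
  define u where "u = (\<lambda>x. (F (x + d) - F x) / d)"
  define u' where "u' = (\<lambda>x. (h (x + d) - h x) / d)"
  have du: "(u has_real_derivative u' x) (at x)" for x
    unfolding u_def u'_def
    by (intro DERIV_cdivide DERIV_diff F DERIV_shift[THEN iffD1])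
  have "\<bar>u' x\<bar> \<le> 1" for x using lip[of "x + d" x] d by (simp add: u'_def divide_le_eq)
  then have *: "\<bar>u b - u a\<bar> \<le> \<bar>b - a\<bar>" if ab: "a < b" for a b
  proof -
    obtain z where "u b - u a = (b - a) * u' z" using MVT2[OF ab, of u u'] du by blast
    then show ?thesis using \<open>\<And>x. \<bar>u' x\<bar> \<le> 1\<close> ab by (simp add: abs_mult mult_le_cancel_left1 mult_le_cancel_left2)
  qed
  have "\<bar>u x - u y\<bar> \<le> \<bar>x - y\<bar>" for x y
    using *[of x y] *[of y x] by (cases x y rule: linorder_cases) (auto simp: abs_minus_commute)
  moreover have "\<bar>u x - h x\<bar> \<le> d" for x
  proof -
    obtain z where z: "x < z" "z < x + d" "F (x + d) - F x = (x + d - x) * h z"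
      using MVT2[of x "x + d" F h] F d by auto
    then have "u x = h z" using d by (simp add: u_def)
    then show ?thesis using lip[of z x] z by simp
  qed
  ultimately show thesis using that du by blast
qed

section \<open>Normal approximation for processes with memory loss\<close>

text \<open>Boundedness holds everywhere on the space and is closed under the arithmetic used below,
  so integrability conditions are discharged by the rules collected in \<open>bdd\<close>.\<close>

definition bdd_rv :: "'a measure \<Rightarrow> ('a \<Rightarrow> real) \<Rightarrow> bool" where
  "bdd_rv M Y \<longleftrightarrow> Y \<in> borel_measurable M \<and> (\<exists>B. \<forall>w\<in>space M. \<bar>Y w\<bar> \<le> B)"

named_theorems bdd

lemma bdd_rv_const [bdd]: "bdd_rv M (\<lambda>_. c)"
  by (auto simp: bdd_rv_def)

lemma bdd_rv_add [bdd]: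
  assumes "bdd_rv M Y" "bdd_rv M V" shows "bdd_rv M (\<lambda>w. Y w + V w)"
proof -
  obtain A B where "\<forall>w\<in>space M. \<bar>Y w\<bar> \<le> A" "\<forall>w\<in>space M. \<bar>V w\<bar> \<le> B"
    using assms by (auto simp: bdd_rv_def)
  then have "\<forall>w\<in>space M. \<bar>Y w + V w\<bar> \<le> A + B" by (meson abs_triangle_ineq add_mono order.trans)
  then show ?thesis using assms by (auto simp: bdd_rv_def)
qed

lemma bdd_rv_mult [bdd]:
  assumes "bdd_rv M Y" "bdd_rv M V" shows "bdd_rv M (\<lambda>w. Y w * V w)"
proof -
  obtain A B where "\<forall>w\<in>space M. \<bar>Y w\<bar> \<le> A" "\<forall>w\<in>space M. \<bar>V w\<bar> \<le> B"
    using assms by (auto simp: bdd_rv_def)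
  then have "\<forall>w\<in>space M. \<bar>Y w * V w\<bar> \<le> A * B"
    by (auto simp: abs_mult intro!: mult_mono)
  then show ?thesis using assms by (auto simp: bdd_rv_def)
qed

lemma bdd_rv_diff [bdd]: "bdd_rv M Y \<Longrightarrow> bdd_rv M V \<Longrightarrow> bdd_rv M (\<lambda>w. Y w - V w)"
  using bdd_rv_add[of M Y "\<lambda>w. - 1 * V w"] bdd_rv_mult[OF bdd_rv_const[of M "- 1"], of V] by simp

lemma bdd_rv_divide [bdd]: "bdd_rv M Y \<Longrightarrow> bdd_rv M (\<lambda>w. Y w / c)"
  using bdd_rv_mult[OF bdd_rv_const[of M "1 / c"], of Y] by simp

lemma bdd_rv_power2 [bdd]: "bdd_rv M Y \<Longrightarrow> bdd_rv M (\<lambda>w. (Y w)\<^sup>2)"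
  by (simp add: power2_eq_square bdd_rv_mult)

lemma bdd_rv_abs [bdd]: "bdd_rv M Y \<Longrightarrow> bdd_rv M (\<lambda>w. \<bar>Y w\<bar>)"
  by (auto simp: bdd_rv_def)

lemma bdd_rv_sum [bdd]: "(\<And>i. i \<in> I \<Longrightarrow> bdd_rv M (Y i)) \<Longrightarrow> bdd_rv M (\<lambda>w. \<Sum>i\<in>I. Y i w)"
  by (induction I rule: infinite_finite_induct) (auto intro: bdd)

lemma bdd_rv_compose:
  assumes "bdd_rv M Y" "u \<in> borel_measurable borel" "\<And>x. \<bar>u x\<bar> \<le> B"
  shows "bdd_rv M (\<lambda>w. u (Y w))"
  using assms measurable_compose[of Y M borel u borel] by (auto simp: bdd_rv_def)

lemma lipschitz_borel:
  fixes u :: "real \<Rightarrow> real"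
  assumes "\<And>x y. \<bar>u x - u y\<bar> \<le> C * \<bar>x - y\<bar>"
  shows "u \<in> borel_measurable borel"
proof (rule borel_measurable_continuous_onI)
  have "(max C 0)-lipschitz_on UNIV u"
    using assms by (intro lipschitz_onI)
      (auto simp: dist_real_def intro: order.trans[OF _ mult_right_mono[of C "max C 0"]])
  then show "continuous_on UNIV u" by (rule lipschitz_on_continuous_on)
qed

abbreviation dist_nat :: "nat \<Rightarrow> nat \<Rightarrow> nat" where
  "dist_nat i j \<equiv> (if i \<le> j then j - i else i - j)"

text \<open>Each distance from n is attained at most once on either side.\<close>

lemma sum_dist_nat_le:
  fixes r :: "nat \<Rightarrow> real"
  assumes r: "\<And>d. 0 \<le> r d" and I: "I \<subseteq> {..<N}" and n: "n < N"
  shows "(\<Sum>j\<in>I. r (dist_nat n j)) \<le> 2 * (\<Sum>d<N. r d)"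
proof -
  have "(\<Sum>j\<in>I. r (dist_nat n j)) \<le> (\<Sum>j<N. r (dist_nat n j))"
    using I r by (intro sum_mono2) auto
  also have "{..<N} = {..<n} \<union> {n..<N}" using n by auto
  also have "(\<Sum>j\<in>{..<n} \<union> {n..<N}. r (dist_nat n j)) =
      (\<Sum>j<n. r (dist_nat n j)) + (\<Sum>j\<in>{n..<N}. r (dist_nat n j))"
    by (intro sum.union_disjoint) auto
  also have "(\<Sum>j<n. r (dist_nat n j)) = (\<Sum>d\<in>{1..n}. r d)"
    by (rule sum.reindex_bij_witness[of _ "\<lambda>d. n - d" "\<lambda>j. n - j"]) auto
  also have "\<dots> \<le> (\<Sum>d<N. r d)" using n r by (intro sum_mono2) auto
  also have "(\<Sum>j\<in>{n..<N}. r (dist_nat n j)) = (\<Sum>d<N - n. r d)"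
    by (rule sum.reindex_bij_witness[of _ "\<lambda>d. n + d" "\<lambda>j. j - n"]) auto
  also have "\<dots> \<le> (\<Sum>d<N. r d)" using r by (intro sum_mono2) auto
  finally show ?thesis by simp
qed

section \<open>The abstract process\<close>

text \<open>The process is deterministic given one state: \<open>flow i m\<close> carries the state
  at time m to time m + i, so any functional of the future is a function of the present. The
  condition \<open>mixing\<close> has the form of \<open>memory_loss\<close>: Lipschitz in the sum
  over the past and merely measurable in the present state, on which the future depends very
  irregularly. The observables depend on the index because the centring does.\<close>

locale mixing_process = prob_space M for M :: "'a measure" +
  fixes X :: "nat \<Rightarrow> 'a \<Rightarrow> real" and flow :: "nat \<Rightarrow> nat \<Rightarrow> real \<Rightarrow> real" and R :: "nat \<Rightarrow> real"
    and \<psi> :: "nat \<Rightarrow> real \<Rightarrow> real" and a L :: real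
  assumes X_measurable [measurable]: "\<And>i. X i \<in> borel_measurable M"
    and X_in: "\<And>i w. w \<in> space M \<Longrightarrow> X i w \<in> {0..1}"
    and flow_measurable [measurable]: "\<And>i m. flow i m \<in> borel_measurable borel"
    and flow_in: "\<And>i m z. z \<in> {0..1} \<Longrightarrow> flow i m z \<in> {0..1}"
    and flow: "\<And>i m w. w \<in> space M \<Longrightarrow> X (m + i) w = flow i m (X m w)"
    and R_summable: "summable R" and R_nonneg: "\<And>n. 0 \<le> R n"
    and mixing: "\<And>\<phi> l \<Theta> \<Lambda> B p n. 0 \<le> l \<Longrightarrow> 0 \<le> \<Lambda> \<Longrightarrow> (\<And>i. \<phi> i \<in> borel_measurable borel) \<Longrightarrow>
      (\<And>i x y. x \<in> {0..1} \<Longrightarrow> y \<in> {0..1} \<Longrightarrow> \<bar>\<phi> i x - \<phi> i y\<bar> \<le> l * \<bar>x - y\<bar>) \<Longrightarrow>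
      case_prod \<Theta> \<in> borel_measurable (borel \<Otimes>\<^sub>M borel) \<Longrightarrow>
      (\<And>s z. z \<in> {0..1} \<Longrightarrow> \<bar>\<Theta> s z\<bar> \<le> B) \<Longrightarrow>
      (\<And>s t z. z \<in> {0..1} \<Longrightarrow> \<bar>\<Theta> s z - \<Theta> t z\<bar> \<le> \<Lambda> * \<bar>s - t\<bar>) \<Longrightarrow>
      (\<And>t. expectation (\<lambda>w. \<Theta> t (X (p + n) w)) = 0) \<Longrightarrow>
      \<bar>expectation (\<lambda>w. \<Theta> (\<Sum>i<p. \<phi> i (X i w)) (X (p + n) w))\<bar> \<le> (B + 3 * l * \<Lambda>) * R n"
    and psi_measurable [measurable]: "\<And>i. \<psi> i \<in> borel_measurable borel"
    and psi_le: "\<And>i x. x \<in> {0..1} \<Longrightarrow> \<bar>\<psi> i x\<bar> \<le> a"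
    and psi_lip: "\<And>i x y. x \<in> {0..1} \<Longrightarrow> y \<in> {0..1} \<Longrightarrow> \<bar>\<psi> i x - \<psi> i y\<bar> \<le> L * \<bar>x - y\<bar>"
    and a_pos: "0 < a" and L_nonneg: "0 \<le> L"
    and psi_mean: "\<And>i. expectation (\<lambda>w. \<psi> i (X i w)) = 0"
begin

definition F :: "nat \<Rightarrow> 'a \<Rightarrow> real" where
  "F i w = \<psi> i (X i w)"

lemma F_le: "w \<in> space M \<Longrightarrow> \<bar>F i w\<bar> \<le> a"
  unfolding F_def by (rule psi_le[OF X_in])

lemma bdd_F [bdd]: "bdd_rv M (F i)"
  using F_le unfolding bdd_rv_def F_def[abs_def] by auto

lemma integrable_bdd: "bdd_rv M Y \<Longrightarrow> integrable M Y"
  unfolding bdd_rv_def by (auto intro!: integrable_const_bound AE_I2)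

lemma F_mean: "expectation (F i) = 0"
  using psi_mean by (simp add: F_def[abs_def])

lemma expectation_le:
  "bdd_rv M Y \<Longrightarrow> bdd_rv M V \<Longrightarrow> (\<And>w. w \<in> space M \<Longrightarrow> Y w \<le> V w) \<Longrightarrow> expectation Y \<le> expectation V"
  by (intro integral_mono integrable_bdd)

lemma expectation_abs_le:
  assumes "bdd_rv M Y" "\<And>w. w \<in> space M \<Longrightarrow> \<bar>Y w\<bar> \<le> B" shows "\<bar>expectation Y\<bar> \<le> B"
proof -
  have "\<bar>expectation Y\<bar> \<le> expectation (\<lambda>w. \<bar>Y w\<bar>)" by (rule integral_abs_bound)
  also have "\<dots> \<le> expectation (\<lambda>_. B)" using assms by (intro expectation_le bdd)
  finally show ?thesis by (simp add: prob_space)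
qed

lemma bdd_future:
  assumes "G \<in> borel_measurable borel" "\<And>z. z \<in> {0..1} \<Longrightarrow> \<bar>G z\<bar> \<le> B"
  shows "bdd_rv M (\<lambda>w. G (X n w))"
  using assms X_in unfolding bdd_rv_def by auto

section \<open>Covariances between past and future\<close>

text \<open>The condition \<open>mixing\<close> is applied to \<Theta> s z = \<kappa> s (G z - m),
  where m is the mean of G, so it is centred for every s. Functionals of the past enter only as a
  function \<kappa> of a single sum; the factor 2 B bounds G - m.\<close>

lemma decorrelation:
  assumes phi: "\<And>i. \<phi> i \<in> borel_measurable borel" "0 \<le> l"
      "\<And>i x y. x \<in> {0..1} \<Longrightarrow> y \<in> {0..1} \<Longrightarrow> \<bar>\<phi> i x - \<phi> i y\<bar> \<le> l * \<bar>x - y\<bar>"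
    and k: "\<And>s. \<bar>\<kappa> s\<bar> \<le> Kb" "\<And>s t. \<bar>\<kappa> s - \<kappa> t\<bar> \<le> Kl * \<bar>s - t\<bar>" "0 \<le> Kl"
    and G [measurable]: "G \<in> borel_measurable borel" and GB: "\<And>z. z \<in> {0..1} \<Longrightarrow> \<bar>G z\<bar> \<le> B"
    and Y: "\<And>w. w \<in> space M \<Longrightarrow> Y w = \<kappa> (\<Sum>i<p. \<phi> i (X i w))"
  shows "\<bar>expectation (\<lambda>w. Y w * G (X (p + n) w)) - expectation Y * expectation (\<lambda>w. G (X (p + n) w))\<bar>
      \<le> 2 * B * (Kb + 3 * l * Kl) * R n"
proof -
  define m where "m = expectation (\<lambda>w. G (X (p + n) w))"
  have [measurable]: "\<kappa> \<in> borel_measurable borel" using k(2) by (rule lipschitz_borel)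
  note [measurable] = phi(1)
  have "0 \<le> \<bar>G 0\<bar>" by simp
  then have B: "0 \<le> B" using GB[of 0] by simp
  have bG: "bdd_rv M (\<lambda>w. G (X (p + n) w))" using bdd_future[OF G GB] .
  have m: "\<bar>m\<bar> \<le> B" unfolding m_def by (rule expectation_abs_le[OF bG]) (use GB X_in in auto)
  have bY: "bdd_rv M Y"
  proof -
    have "bdd_rv M (\<lambda>w. \<kappa> (\<Sum>i<p. \<phi> i (X i w)))" using k(1) unfolding bdd_rv_def by auto
    then show ?thesis using Y measurable_cong[of M Y "\<lambda>w. \<kappa> (\<Sum>i<p. \<phi> i (X i w))" borel]
      unfolding bdd_rv_def by auto
  qed
  have Kb: "0 \<le> Kb" using k(1)[of 0] by linarith
  have "\<bar>expectation (\<lambda>w. \<kappa> (\<Sum>i<p. \<phi> i (X i w)) * (G (X (p + n) w) - m))\<bar> \<le> (Kb * (2 * B) + 3 * l * (Kl * (2 * B))) * R n"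
  proof (rule mixing[of l "Kl * (2 * B)" \<phi> "\<lambda>s z. \<kappa> s * (G z - m)" "Kb * (2 * B)"])
    fix s t z :: real assume z: "z \<in> {0..1}"
    have g: "\<bar>G z - m\<bar> \<le> 2 * B" using GB[OF z] m by linarith
    show "\<bar>\<kappa> s * (G z - m)\<bar> \<le> Kb * (2 * B)"
      unfolding abs_mult using k(1) Kb g by (intro mult_mono) auto
    have "\<bar>\<kappa> s - \<kappa> t\<bar> * \<bar>G z - m\<bar> \<le> (Kl * \<bar>s - t\<bar>) * (2 * B)"
      using k g by (intro mult_mono) auto
    then show "\<bar>\<kappa> s * (G z - m) - \<kappa> t * (G z - m)\<bar> \<le> Kl * (2 * B) * \<bar>s - t\<bar>"
      by (simp add: left_diff_distrib[symmetric] abs_mult mult_ac)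
  next
    fix t
    show "expectation (\<lambda>w. \<kappa> t * (G (X (p + n) w) - m)) = 0"
      using integrable_bdd[OF bG] by (simp add: m_def prob_space)
  qed (use phi B k in auto)
  also have "expectation (\<lambda>w. \<kappa> (\<Sum>i<p. \<phi> i (X i w)) * (G (X (p + n) w) - m)) =
      expectation (\<lambda>w. Y w * G (X (p + n) w) - m * Y w)"
    by (rule Bochner_Integration.integral_cong[OF refl]) (simp add: Y algebra_simps)
  also have "\<dots> = expectation (\<lambda>w. Y w * G (X (p + n) w)) - m * expectation Y"
    using integrable_bdd[OF bdd_rv_mult[OF bY bG]] integrable_bdd[OF bY] by simp
  finally show ?thesis by (simp add: m_def mult_ac algebra_simps)
qed

text \<open>Truncation makes the identity, and below the square, globally bounded and Lipschitz
  without changing them on the range of the sums they are applied to.\<close>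

definition clip :: "real \<Rightarrow> real \<Rightarrow> real" where
  "clip c s = max (- c) (min c s)"

lemma clip: "0 \<le> c \<Longrightarrow> \<bar>clip c s\<bar> \<le> c" "\<bar>clip c s - clip c t\<bar> \<le> \<bar>s - t\<bar>" "\<bar>s\<bar> \<le> c \<Longrightarrow> clip c s = s"
  by (auto simp: clip_def max_def min_def)

text \<open>\<open>c1\<close> is the constant of \<open>decorrelation\<close> for the clipped
  identity (bound a, slope 1, one summand). \<open>c2\<close> comes from the clipped square of two
  summands (bound 4 a^2, slope 4 a, Lipschitz constant 2 L) and the factor 3/2 of
  polarisation.\<close>

definition c1 :: real where "c1 = 2 * (a + 3 * L)"
definition c2 :: real where "c2 = 12 * (a\<^sup>2 + 6 * L * a)"

lemma c_nonneg: "0 \<le> c1" "0 \<le> c2"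
  using a_pos L_nonneg by (auto simp: c1_def c2_def)

lemma mean_past_future:
  assumes "G \<in> borel_measurable borel" "\<And>z. z \<in> {0..1} \<Longrightarrow> \<bar>G z\<bar> \<le> B"
  shows "\<bar>expectation (\<lambda>w. F i w * G (X (Suc i + n) w))\<bar> \<le> B * c1 * R n"
proof -
  have "\<bar>expectation (\<lambda>w. F i w * G (X (Suc i + n) w)) - expectation (F i) * expectation (\<lambda>w. G (X (Suc i + n) w))\<bar>
      \<le> 2 * B * (a + 3 * L * 1) * R n"
  proof (rule decorrelation[where \<phi> = "\<lambda>j. if j = i then \<psi> i else (\<lambda>_. 0)" and \<kappa> = "clip a"])
    show "F i w = clip a (\<Sum>j<Suc i. (if j = i then \<psi> i else (\<lambda>_. 0)) (X j w))" if "w \<in> space M" for w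
    proof -
      have "(\<Sum>j<Suc i. (if j = i then \<psi> i else (\<lambda>_. 0)) (X j w)) = F i w"
        by (simp add: F_def if_distrib[where f = "\<lambda>u. u _"] sum.delta cong: if_cong)
      then show ?thesis using F_le[OF that] by (simp add: clip(3))
    qed
    show "\<bar>(if j = i then \<psi> i else (\<lambda>_. 0)) x - (if j = i then \<psi> i else (\<lambda>_. 0)) y\<bar> \<le> L * \<bar>x - y\<bar>"
      if "x \<in> {0..1}" "y \<in> {0..1}" for j x y
      using psi_lip[OF that] L_nonneg by simp
    show "\<bar>clip a s\<bar> \<le> a" "\<bar>clip a s - clip a t\<bar> \<le> 1 * \<bar>s - t\<bar>" for s t
      using a_pos clip(1)[of a s] clip(2)[of a s t] by auto
  qed (use L_nonneg assms in auto)
  then show ?thesis by (simp add: F_mean c1_def mult_ac)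
qed

text \<open>A product of two summands is not a function of one sum, but by polarisation it is half
  of the square of F_i + F_j minus the two single squares, and each square is a clipped square of a
  sum.\<close>

lemma cov_pair_future:
  assumes ij: "i < p" "j < p" and G: "G \<in> borel_measurable borel" "\<And>z. z \<in> {0..1} \<Longrightarrow> \<bar>G z\<bar> \<le> B"
  shows "\<bar>expectation (\<lambda>w. F i w * F j w * G (X (p + n) w)) -
      expectation (\<lambda>w. F i w * F j w) * expectation (\<lambda>w. G (X (p + n) w))\<bar> \<le> B * c2 * R n"
proof -
  let ?g = "\<lambda>w. G (X (p + n) w)"
  define sq where "sq = (\<lambda>s. (clip (2 * a) s)\<^sup>2)"
  define D where "D = (\<lambda>Y. expectation (\<lambda>w. Y w * ?g w) - expectation Y * expectation ?g)"
  have sq: "\<bar>sq s\<bar> \<le> (2 * a)\<^sup>2" "\<bar>sq s - sq t\<bar> \<le> 4 * a * \<bar>s - t\<bar>" for s t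
  proof -
    have c: "\<bar>clip (2 * a) s\<bar> \<le> 2 * a" for s using a_pos by (intro clip) auto
    show "\<bar>sq s\<bar> \<le> (2 * a)\<^sup>2"
      unfolding sq_def using power_mono[OF c[of s] abs_ge_zero, of 2] by simp
    have "sq s - sq t = (clip (2 * a) s + clip (2 * a) t) * (clip (2 * a) s - clip (2 * a) t)"
      by (simp add: sq_def power2_eq_square algebra_simps)
    also have "\<bar>\<dots>\<bar> \<le> (4 * a) * \<bar>s - t\<bar>"
      unfolding abs_mult using c[of s] c[of t] clip(2) a_pos by (intro mult_mono) auto
    finally show "\<bar>sq s - sq t\<bar> \<le> 4 * a * \<bar>s - t\<bar>" .
  qed
  have key: "\<bar>D (\<lambda>w. (u * F i w + v * F j w)\<^sup>2)\<bar> \<le> 2 * B * ((2 * a)\<^sup>2 + 3 * (2 * L) * (4 * a)) * R n"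
    if uv: "(u, v) \<in> {(1, 1), (1, 0), (0, 1)}" for u v
  proof -
    \<comment> \<open>The two conditionals are added instead of nested, so that \<open>i = j\<close>
      is covered; this is why the Lipschitz constant is 2 L.\<close>
    let ?\<phi> = "\<lambda>l x. (if l = i then u * \<psi> i x else 0) + (if l = j then v * \<psi> j x else 0)"
    have uv': "0 \<le> u" "u \<le> 1" "0 \<le> v" "v \<le> 1" using uv by auto
    show ?thesis unfolding D_def
    proof (rule decorrelation[where \<phi> = ?\<phi> and \<kappa> = sq])
      fix l x y :: real and q :: nat assume xy: "x \<in> {0..1}" "y \<in> {0..1}"
      have 1: "\<bar>u * \<psi> i x - u * \<psi> i y\<bar> \<le> L * \<bar>x - y\<bar>" "\<bar>v * \<psi> j x - v * \<psi> j y\<bar> \<le> L * \<bar>x - y\<bar>"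
        using psi_lip[OF xy] uv' mult_mono[of u 1 "\<bar>\<psi> i x - \<psi> i y\<bar>" "L * \<bar>x - y\<bar>"]
          mult_mono[of v 1 "\<bar>\<psi> j x - \<psi> j y\<bar>" "L * \<bar>x - y\<bar>"]
        by (auto simp: right_diff_distrib[symmetric] abs_mult)
      have 2: "0 \<le> L * \<bar>x - y\<bar>" using L_nonneg by simp
      show "\<bar>?\<phi> q x - ?\<phi> q y\<bar> \<le> 2 * L * \<bar>x - y\<bar>" using 1 2 by auto
    next
      fix w assume w: "w \<in> space M"
      have "(\<Sum>l<p. ?\<phi> l (X l w)) = u * F i w + v * F j w"
        using ij by (simp add: sum.distrib F_def)
      moreover have "\<bar>u * F i w + v * F j w\<bar> \<le> 2 * a"
      proof -
        have "\<bar>u * F i w\<bar> \<le> 1 * a" "\<bar>v * F j w\<bar> \<le> 1 * a"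
          using uv' F_le[OF w, of i] F_le[OF w, of j] mult_mono[of u 1 "\<bar>F i w\<bar>" a]
            mult_mono[of v 1 "\<bar>F j w\<bar>" a] by (auto simp: abs_mult)
        then show ?thesis by linarith
      qed
      ultimately show "(u * F i w + v * F j w)\<^sup>2 = sq (\<Sum>l<p. ?\<phi> l (X l w))"
        unfolding sq_def by (simp add: clip(3))
    qed (use sq a_pos L_nonneg G in auto)
  qed
  have bg: "bdd_rv M ?g" by (rule bdd_future[OF G])
  note int = integrable_bdd[OF bdd_rv_mult[OF bdd_rv_power2[OF bdd_rv_add[OF bdd_rv_mult[OF bdd_rv_const bdd_F] bdd_rv_mult[OF bdd_rv_const bdd_F]]] bg]]
    integrable_bdd[OF bdd_rv_power2[OF bdd_rv_add[OF bdd_rv_mult[OF bdd_rv_const bdd_F] bdd_rv_mult[OF bdd_rv_const bdd_F]]]]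
  let ?q = "\<lambda>u v w. (u * F i w + v * F j w)\<^sup>2"
  have eq: "F i w * F j w = 1/2 * (?q 1 1 w - ?q 1 0 w - ?q 0 1 w)" for w
    by (simp add: power2_eq_square algebra_simps)
  have Deq: "D (\<lambda>w. F i w * F j w) = 1/2 * (D (?q 1 1) - D (?q 1 0) - D (?q 0 1))"
  proof -
    have "expectation (\<lambda>w. F i w * F j w * ?g w) =
        expectation (\<lambda>w. 1/2 * (?q 1 1 w * ?g w - ?q 1 0 w * ?g w - ?q 0 1 w * ?g w))"
      unfolding eq by (simp add: algebra_simps)
    also have "\<dots> = 1/2 * (expectation (\<lambda>w. ?q 1 1 w * ?g w) - expectation (\<lambda>w. ?q 1 0 w * ?g w)
        - expectation (\<lambda>w. ?q 0 1 w * ?g w))"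
      using int(1)[of 1 i 1 j] int(1)[of 1 i 0 j] int(1)[of 0 i 1 j]
      by (simp only: integral_mult_right_zero Bochner_Integration.integral_diff Bochner_Integration.integrable_diff)
    finally have 1: "expectation (\<lambda>w. F i w * F j w * ?g w) = \<dots>" .
    have 2: "expectation (\<lambda>w. F i w * F j w) = 1/2 * (expectation (?q 1 1) - expectation (?q 1 0) - expectation (?q 0 1))"
      unfolding eq using int(2)[of 1 i 1 j] int(2)[of 1 i 0 j] int(2)[of 0 i 1 j]
      by (simp only: integral_mult_right_zero Bochner_Integration.integral_diff Bochner_Integration.integrable_diff)
    show ?thesis unfolding D_def 1 2 by (simp add: algebra_simps)
  qed
  have "\<bar>D (\<lambda>w. F i w * F j w)\<bar> \<le> 1/2 * (3 * (2 * B * ((2 * a)\<^sup>2 + 3 * (2 * L) * (4 * a)) * R n))"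
  proof -
    have tri: "\<bar>1/2 * (x - y - z)\<bar> \<le> 1/2 * (3 * e)" if "\<bar>x\<bar> \<le> e" "\<bar>y\<bar> \<le> e" "\<bar>z\<bar> \<le> e" for x y z e :: real
    proof -
      have "\<bar>x - y - z\<bar> \<le> 3 * e" using that by linarith
      then show ?thesis by (simp only: abs_mult) simp
    qed
    show ?thesis unfolding Deq by (intro tri key) auto
  qed
  also have "\<dots> = B * c2 * R n" by (simp add: c2_def power2_eq_square algebra_simps)
  finally show ?thesis by (simp add: D_def)
qed

text \<open>At distance d > 0 the gap is d - 1, since a past that contains index i consists of
  \<open>Suc i\<close> terms.\<close>

definition rho :: "nat \<Rightarrow> real" where
  "rho d = (if d = 0 then a\<^sup>2 else a * c1 * R (d - 1))"

lemma rho_nonneg: "0 \<le> rho d"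
  using c_nonneg a_pos R_nonneg by (simp add: rho_def)

lemma covariance_le: "\<bar>expectation (\<lambda>w. F i w * F j w)\<bar> \<le> rho (dist_nat i j)"
proof -
  have lt: "\<bar>expectation (\<lambda>w. F i w * F j w)\<bar> \<le> a * c1 * R (j - i - 1)" if "i < j" for i j
    using mean_past_future[of "\<psi> j" a i "j - i - 1"] psi_le that by (simp add: F_def)
  consider "i = j" | "i < j" | "j < i" by linarith
  then show ?thesis
  proof cases
    case 1
    have "\<bar>expectation (\<lambda>w. F i w * F j w)\<bar> \<le> a * a"
    proof (rule expectation_abs_le)
      show "\<bar>F i w * F j w\<bar> \<le> a * a" if "w \<in> space M" for w
        unfolding abs_mult using F_le[OF that] a_pos by (intro mult_mono) auto
    qed (intro bdd)
    then show ?thesis using 1 by (simp add: rho_def power2_eq_square)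
  next
    case 2 then show ?thesis using lt[OF 2] by (simp add: rho_def)
  next
    case 3 then show ?thesis using lt[OF 3] by (simp add: rho_def mult.commute)
  qed
qed

definition SR :: real where "SR = (\<Sum>n. R n)"
text \<open>A bound for the variance per index: twice the sum of \<open>rho\<close>, one copy for
  each side.\<close>

definition SV :: real where "SV = 2 * (a\<^sup>2 + a * c1 * SR)"

lemma SR: "0 \<le> SR" "(\<Sum>d<N. R d) \<le> SR"
  unfolding SR_def using R_summable R_nonneg by (auto intro!: suminf_nonneg sum_le_suminf)

lemma SV_pos: "0 < SV"
  unfolding SV_def using a_pos c_nonneg SR(1) by (intro mult_pos_pos add_pos_nonneg) auto

lemma sum_rho_le: "2 * (\<Sum>d<N. rho d) \<le> SV"
proof (cases N)
  case (Suc m)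
  have "(\<Sum>d<N. rho d) = a\<^sup>2 + a * c1 * (\<Sum>d<m. R d)"
    unfolding Suc sum.lessThan_Suc_shift by (simp add: rho_def sum_distrib_left)
  also have "\<dots> \<le> a\<^sup>2 + a * c1 * SR" using SR(2) a_pos c_nonneg by (intro add_left_mono mult_left_mono) auto
  finally show ?thesis by (simp add: SV_def)
qed (use SV_pos in simp)

text \<open>Every row of the covariance matrix has an absolute sum of at most \<open>SV\<close>. The
  index set is arbitrary because this is applied to windows as well as to the full sum.\<close>

lemma second_moment:
  assumes "I \<subseteq> {..<N}"
  shows "expectation (\<lambda>w. (\<Sum>i\<in>I. F i w)\<^sup>2) \<le> SV * real (card I)"
proof -
  have fin: "finite I" using assms finite_subset by blast
  have "expectation (\<lambda>w. (\<Sum>i\<in>I. F i w)\<^sup>2) = (\<Sum>i\<in>I. \<Sum>j\<in>I. expectation (\<lambda>w. F i w * F j w))"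
    unfolding power2_eq_square sum_product
    by (subst Bochner_Integration.integral_sum, intro integrable_bdd bdd)
      (intro sum.cong refl Bochner_Integration.integral_sum integrable_bdd bdd)
  also have "\<dots> \<le> (\<Sum>i\<in>I. \<Sum>j\<in>I. rho (dist_nat i j))"
    using covariance_le by (intro sum_mono) (meson abs_le_D1)
  also have "\<dots> \<le> (\<Sum>i\<in>I. SV)"
    using assms by (intro sum_mono order.trans[OF sum_dist_nat_le sum_rho_le] rho_nonneg) auto
  finally show ?thesis by (simp add: mult.commute)
qed

section \<open>Leaving out a window around one summand\<close>

text \<open>The summand has to be decoupled from both sides. With the past sum frozen at s, the
  remaining mean \<open>\<Psi>b s\<close> correlates F_n only with indices beyond the gap and is
  small because F_n is centred. The difference \<Psi> - \<open>\<Psi>b\<close> is then centred for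
  every s and Lipschitz in s, so \<open>mixing\<close> decouples the past across the gap on the
  other side. The lower bound \<open>\<sigma>0\<close> keeps the Lipschitz constant uniform.\<close>

lemma mean_separated:
  assumes A: "\<And>x. \<bar>A x\<bar> \<le> A0" "\<And>x y. \<bar>A x - A y\<bar> \<le> A1 * \<bar>x - y\<bar>" "0 \<le> A1"
    and s: "0 < \<sigma>0" "\<sigma>0 \<le> \<sigma>"
  shows "\<bar>expectation (\<lambda>w. F n w * A (((\<Sum>i<n - K. F i w) + (\<Sum>i\<in>{n + K + 1..<N}. F i w)) / \<sigma>))\<bar>
      \<le> (A0 * c1 + 2 * a * A0 + 6 * L * a * A1 / \<sigma>0) * R K"
proof -
  have A0: "0 \<le> A0" using A(1)[of 0] by linarith
  have [measurable]: "A \<in> borel_measurable borel" using A(2) by (rule lipschitz_borel)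
  define U where "U = (\<lambda>z. \<Sum>i\<in>{n + K + 1..<N}. \<psi> i (flow (i - (n + K + 1)) (n + K + 1) z))"
  \<comment> \<open>Via \<open>flow\<close>, everything after the gap is a function of the state at
    time n.\<close>
  define V where "V = (\<lambda>z. U (flow (Suc K) n z))"
  have [measurable]: "U \<in> borel_measurable borel" unfolding U_def by measurable
  have [measurable]: "V \<in> borel_measurable borel" unfolding V_def by measurable
  have U: "U (X (Suc n + K) w) = (\<Sum>i\<in>{n + K + 1..<N}. F i w)" if "w \<in> space M" for w
    unfolding U_def F_def
  proof (intro sum.cong refl)
    fix i assume "i \<in> {n + K + 1..<N}"
    then show "\<psi> i (flow (i - (n + K + 1)) (n + K + 1) (X (Suc n + K) w)) = \<psi> i (X i w)"
      using flow[OF that, of "n + K + 1" "i - (n + K + 1)"] by simp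
  qed
  have V: "V (X n w) = U (X (Suc n + K) w)" if "w \<in> space M" for w
    using flow[OF that, of n "Suc K"] by (simp add: V_def)
  define \<Psi> where "\<Psi> = (\<lambda>s z. \<psi> n z * A ((s + V z) / \<sigma>))"
  define \<Psi>b where "\<Psi>b = (\<lambda>s. expectation (\<lambda>w. \<Psi> s (X n w)))"
  have \<Psi>_le: "\<bar>\<Psi> s z\<bar> \<le> a * A0" if "z \<in> {0..1}" for s z
    unfolding \<Psi>_def abs_mult using psi_le[OF that] A a_pos by (intro mult_mono) auto
  have \<Psi>_lip: "\<bar>\<Psi> s z - \<Psi> t z\<bar> \<le> a * A1 / \<sigma>0 * \<bar>s - t\<bar>" if "z \<in> {0..1}" for s t z
  proof -
    have "\<bar>A ((s + V z) / \<sigma>) - A ((t + V z) / \<sigma>)\<bar> \<le> A1 * \<bar>(s + V z) / \<sigma> - (t + V z) / \<sigma>\<bar>" by (rule A)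
    also have "\<bar>(s + V z) / \<sigma> - (t + V z) / \<sigma>\<bar> = \<bar>s - t\<bar> / \<sigma>"
      using s by (simp add: diff_divide_distrib[symmetric])
    also have "A1 * (\<bar>s - t\<bar> / \<sigma>) \<le> A1 * (\<bar>s - t\<bar> / \<sigma>0)"
      using A s by (intro mult_left_mono divide_left_mono) auto
    finally have "\<bar>\<psi> n z\<bar> * \<bar>A ((s + V z) / \<sigma>) - A ((t + V z) / \<sigma>)\<bar> \<le> a * (A1 * (\<bar>s - t\<bar> / \<sigma>0))"
      using psi_le[OF that] a_pos by (intro mult_mono) auto
    then show ?thesis by (simp add: \<Psi>_def right_diff_distrib[symmetric] abs_mult)
  qed
  have [measurable]: "case_prod \<Psi> \<in> borel_measurable (borel \<Otimes>\<^sub>M borel)" unfolding \<Psi>_def by measurable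
  have \<Psi>_meas: "\<Psi> s \<in> borel_measurable borel" for s unfolding \<Psi>_def by measurable
  have bdd_\<Psi>: "bdd_rv M (\<lambda>w. \<Psi> s (X n w))" for s by (rule bdd_future[OF \<Psi>_meas \<Psi>_le])
  have \<Psi>b_le: "\<bar>\<Psi>b s\<bar> \<le> A0 * c1 * R K" for s
  proof -
    have "\<Psi>b s = expectation (\<lambda>w. F n w * A ((s + U (X (Suc n + K) w)) / \<sigma>))"
      unfolding \<Psi>b_def by (rule Bochner_Integration.integral_cong[OF refl]) (simp add: \<Psi>_def V F_def)
    then show ?thesis using mean_past_future[of "\<lambda>z. A ((s + U z) / \<sigma>)" A0 n K] A by simp
  qed
  have \<Psi>b_lip: "\<bar>\<Psi>b s - \<Psi>b t\<bar> \<le> a * A1 / \<sigma>0 * \<bar>s - t\<bar>" for s t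
  proof -
    have "\<Psi>b s - \<Psi>b t = expectation (\<lambda>w. \<Psi> s (X n w) - \<Psi> t (X n w))"
      unfolding \<Psi>b_def by (simp add: integrable_bdd bdd_\<Psi>)
    also have "\<bar>\<dots>\<bar> \<le> a * A1 / \<sigma>0 * \<bar>s - t\<bar>"
      by (rule expectation_abs_le) (use \<Psi>_lip X_in bdd_\<Psi> in \<open>auto intro: bdd\<close>)
    finally show ?thesis .
  qed
  have [measurable]: "\<Psi>b \<in> borel_measurable borel" using \<Psi>b_lip by (rule lipschitz_borel)
  have \<Psi>b_le2: "\<bar>\<Psi>b s\<bar> \<le> a * A0" for s unfolding \<Psi>b_def
    by (rule expectation_abs_le) (use \<Psi>_le X_in bdd_\<Psi> in auto)
  let ?P = "\<lambda>w. \<Sum>i<n - K. F i w"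
  have eq: "expectation (\<lambda>w. F n w * A ((?P w + (\<Sum>i\<in>{n + K + 1..<N}. F i w)) / \<sigma>)) =
      expectation (\<lambda>w. \<Psi> (?P w) (X n w))"
    by (rule Bochner_Integration.integral_cong[OF refl]) (simp only: \<Psi>_def F_def[of n] V U)
  have nn: "0 \<le> (2 * a * A0 + 6 * L * a * A1 / \<sigma>0) * R K"
    using a_pos A0 L_nonneg A s R_nonneg by auto
  show ?thesis
  proof (cases "n \<le> K")
    case True
    \<comment> \<open>By truncated subtraction no index precedes the window: the past sum is empty
      and only the future needs decoupling.\<close>
    then have "expectation (\<lambda>w. \<Psi> (?P w) (X n w)) = \<Psi>b 0" by (simp add: \<Psi>b_def)
    then show ?thesis unfolding eq using \<Psi>b_le[of 0] nn by (simp add: algebra_simps)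
  next
    case False
    then have pn: "n - K + K = n" by simp
    have "\<bar>expectation (\<lambda>w. \<Psi> (\<Sum>i<n - K. \<psi> i (X i w)) (X (n - K + K) w) - \<Psi>b (\<Sum>i<n - K. \<psi> i (X i w)))\<bar>
        \<le> (2 * (a * A0) + 3 * L * (2 * (a * A1 / \<sigma>0))) * R K"
    proof (rule mixing[where \<Theta> = "\<lambda>s z. \<Psi> s z - \<Psi>b s"])
      show "(\<lambda>(s, z). \<Psi> s z - \<Psi>b s) \<in> borel_measurable (borel \<Otimes>\<^sub>M borel)" by measurable
      fix s t z :: real assume z: "z \<in> {0..1}"
      show "\<bar>\<Psi> s z - \<Psi>b s\<bar> \<le> 2 * (a * A0)" using \<Psi>_le[OF z, of s] \<Psi>b_le2[of s] by linarith
      show "\<bar>\<Psi> s z - \<Psi>b s - (\<Psi> t z - \<Psi>b t)\<bar> \<le> 2 * (a * A1 / \<sigma>0) * \<bar>s - t\<bar>"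
        using \<Psi>_lip[OF z, of s t] \<Psi>b_lip[of s t] by linarith
    next
      fix t
      show "expectation (\<lambda>w. \<Psi> t (X (n - K + K) w) - \<Psi>b t) = 0"
        unfolding pn using integrable_bdd[OF bdd_\<Psi>[of t]] by (simp add: \<Psi>b_def prob_space)
    qed (use L_nonneg a_pos A s psi_lip in auto)
    then have "\<bar>expectation (\<lambda>w. \<Psi> (?P w) (X n w) - \<Psi>b (?P w))\<bar>
        \<le> (2 * (a * A0) + 3 * L * (2 * (a * A1 / \<sigma>0))) * R K"
      by (simp only: pn F_def)
    moreover have "expectation (\<lambda>w. \<Psi> (?P w) (X n w) - \<Psi>b (?P w)) =
        expectation (\<lambda>w. \<Psi> (?P w) (X n w)) - expectation (\<lambda>w. \<Psi>b (?P w))"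
    proof (intro Bochner_Integration.integral_diff integrable_bdd)
      show "bdd_rv M (\<lambda>w. \<Psi> (?P w) (X n w))"
        unfolding bdd_rv_def F_def using \<Psi>_le[OF X_in] by (intro conjI exI[of _ "a * A0"] ballI) auto
      show "bdd_rv M (\<lambda>w. \<Psi>b (?P w))" using \<Psi>b_le2 unfolding bdd_rv_def F_def by auto
    qed
    moreover have "\<bar>expectation (\<lambda>w. \<Psi>b (?P w))\<bar> \<le> A0 * c1 * R K"
      using \<Psi>b_le \<Psi>b_le2 by (intro expectation_abs_le) (auto simp: bdd_rv_def F_def)
    moreover have "(A0 * c1 + 2 * a * A0 + 6 * L * a * A1 / \<sigma>0) * R K =
        A0 * c1 * R K + (2 * (a * A0) + 3 * L * (2 * (a * A1 / \<sigma>0))) * R K"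
      by (simp add: algebra_simps)
    ultimately show ?thesis unfolding eq by linarith
  qed
qed

section \<open>Windows and their products\<close>

definition near :: "nat \<Rightarrow> nat \<Rightarrow> nat \<Rightarrow> nat set" where
  "near N K n = {i. i < N \<and> dist_nat n i \<le> K}"

lemma near: "near N K n \<subseteq> {..<N}" "finite (near N K n)" "card (near N K n) \<le> 2 * K + 1"
proof -
  show sub: "near N K n \<subseteq> {..<N}" by (auto simp: near_def)
  then show "finite (near N K n)" by (rule finite_subset) simp
  have "near N K n \<subseteq> {n - K..n + K}" by (auto simp: near_def split: if_splits)
  then have "card (near N K n) \<le> card {n - K..n + K}" by (intro card_mono) auto
  then show "card (near N K n) \<le> 2 * K + 1" by simp
qed

definition window :: "nat \<Rightarrow> nat \<Rightarrow> nat \<Rightarrow> 'a \<Rightarrow> real" where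
  "window N K n w = (\<Sum>i\<in>near N K n. F i w)"

lemma bdd_window [bdd]: "bdd_rv M (window N K n)"
  unfolding window_def[abs_def] by (intro bdd)

lemma window_second_moment: "expectation (\<lambda>w. (window N K n w)\<^sup>2) \<le> SV * (2 * real K + 1)"
proof -
  have "expectation (\<lambda>w. (window N K n w)\<^sup>2) \<le> SV * real (card (near N K n))"
    unfolding window_def by (rule second_moment[OF near(1)])
  also have "\<dots> \<le> SV * real (2 * K + 1)"
    using near(3)[of N K n] SV_pos by (intro mult_left_mono) (simp_all only: of_nat_le_iff less_imp_le)
  finally show ?thesis by (simp add: add.commute)
qed

definition SRtail :: "nat \<Rightarrow> real" where
  "SRtail K = (\<Sum>d. R (d + K))"

lemma SRtail: "0 \<le> SRtail K" "(\<Sum>d<N. R (d + K)) \<le> SRtail K"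
  unfolding SRtail_def using summable_ignore_initial_segment[OF R_summable, of K] R_nonneg
  by (auto intro!: suminf_nonneg sum_le_suminf)

text \<open>The variance is the sum of all covariances, and the products with windows keep those at
  distance at most K; the rest is a tail of \<open>rho\<close> in each row.\<close>

lemma variance_window_gap:
  "\<bar>expectation (\<lambda>w. (\<Sum>i<N. F i w)\<^sup>2) - expectation (\<lambda>w. \<Sum>n<N. F n w * window N K n w)\<bar>
     \<le> 2 * a * c1 * real N * SRtail K"
proof -
  let ?e = "\<lambda>i j. expectation (\<lambda>w. F i w * F j w)"
  define r where "r = (\<lambda>d. if d \<le> K then 0 else rho d)"
  have v: "expectation (\<lambda>w. (\<Sum>i<N. F i w)\<^sup>2) = (\<Sum>n<N. \<Sum>i<N. ?e n i)"
    unfolding power2_eq_square sum_product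
    by (subst Bochner_Integration.integral_sum, intro integrable_bdd bdd)
      (intro sum.cong refl Bochner_Integration.integral_sum integrable_bdd bdd)
  have q: "expectation (\<lambda>w. \<Sum>n<N. F n w * window N K n w) = (\<Sum>n<N. \<Sum>i\<in>near N K n. ?e n i)"
    unfolding window_def sum_distrib_left
    by (subst Bochner_Integration.integral_sum, intro integrable_bdd bdd)
      (intro sum.cong refl Bochner_Integration.integral_sum integrable_bdd bdd)
  have "(\<Sum>i<N. ?e n i) - (\<Sum>i\<in>near N K n. ?e n i) = (\<Sum>i\<in>{..<N} - near N K n. ?e n i)" for n
    by (rule sum_diff[symmetric]) (use near(1) in auto)
  then have "\<bar>expectation (\<lambda>w. (\<Sum>i<N. F i w)\<^sup>2) - expectation (\<lambda>w. \<Sum>n<N. F n w * window N K n w)\<bar> =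
      \<bar>\<Sum>n<N. \<Sum>i\<in>{..<N} - near N K n. ?e n i\<bar>"
    unfolding v q by (simp add: sum_subtractf[symmetric])
  also have "\<dots> \<le> (\<Sum>n<N. \<Sum>i\<in>{..<N} - near N K n. \<bar>?e n i\<bar>)"
    by (intro order.trans[OF sum_abs] sum_mono sum_abs)
  also have "\<dots> \<le> (\<Sum>n<N. 2 * (a * c1 * SRtail K))"
  proof (rule sum_mono)
    fix n assume n: "n \<in> {..<N}"
    have "(\<Sum>i\<in>{..<N} - near N K n. \<bar>?e n i\<bar>) \<le> (\<Sum>i\<in>{..<N} - near N K n. r (dist_nat n i))"
    proof (rule sum_mono)
      fix i assume "i \<in> {..<N} - near N K n"
      then have "\<not> dist_nat n i \<le> K" by (auto simp: near_def)
      then show "\<bar>?e n i\<bar> \<le> r (dist_nat n i)" using covariance_le[of n i] unfolding r_def by presburger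
    qed
    also have "\<dots> \<le> 2 * (\<Sum>d<N. r d)"
      by (rule sum_dist_nat_le) (use n in \<open>auto simp: r_def rho_nonneg\<close>)
    also have "(\<Sum>d<N. r d) = (\<Sum>d\<in>{K + 1..<N}. a * c1 * R (d - 1))"
      by (rule sum.mono_neutral_cong_right) (auto simp: r_def rho_def)
    also have "\<dots> = (\<Sum>d<N - (K + 1). a * c1 * R (d + K))"
      by (rule sum.reindex_bij_witness[of _ "\<lambda>d. d + K + 1" "\<lambda>d. d - (K + 1)"]) auto
    also have "\<dots> \<le> a * c1 * SRtail K"
      unfolding sum_distrib_left[symmetric] using SRtail(2) a_pos c_nonneg by (intro mult_left_mono) auto
    finally show "(\<Sum>i\<in>{..<N} - near N K n. \<bar>?e n i\<bar>) \<le> 2 * (a * c1 * SRtail K)" by simp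
  qed
  finally show ?thesis by (simp add: mult_ac)
qed

definition c3 :: real where "c3 = 2 * a\<^sup>2 * (SV + c2 * SR)"

text \<open>Put k = 2 K + 1. Centred products at distance at most 2 K are bounded through their
  variances, of order k by \<open>window_second_moment\<close>, a factor k better than the pointwise
  bound. More distant ones are expanded over the first window, where \<open>cov_pair_future\<close>
  applies to each of at most k terms with a future function bounded by a k a. Either way the sum
  over distances is of order k^2, which gives \<open>c3\<close> with the factor 2 for the two
  sides.\<close>

lemma variance_window_products:
  fixes N K :: nat
  defines "Q \<equiv> \<lambda>w. \<Sum>n<N. F n w * window N K n w"
  shows "expectation (\<lambda>w. (Q w - expectation Q)\<^sup>2) \<le> c3 * real N * (2 * real K + 1)\<^sup>2"
proof -
  define q where "q = (\<lambda>n w. F n w * window N K n w)"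
  have bq [bdd]: "bdd_rv M (q n)" for n unfolding q_def by (intro bdd)
  define C where "C = (\<lambda>n w. q n w - expectation (q n))"
  have bC [bdd]: "bdd_rv M (C n)" for n unfolding C_def by (intro bdd)
  define k where "k = 2 * real K + 1"
  have k1: "1 \<le> k" by (simp add: k_def)
  have C_sq: "expectation (\<lambda>w. (C n w)\<^sup>2) \<le> a\<^sup>2 * SV * k" for n
  proof -
    have "expectation (\<lambda>w. (C n w)\<^sup>2) = expectation (\<lambda>w. (q n w)\<^sup>2) - (expectation (q n))\<^sup>2"
      unfolding C_def using integrable_bdd[OF bq] integrable_bdd[OF bdd_rv_power2[OF bq]]
      by (intro variance_eq) auto
    also have "\<dots> \<le> expectation (\<lambda>w. (q n w)\<^sup>2)" by simp
    also have "\<dots> \<le> expectation (\<lambda>w. a\<^sup>2 * (window N K n w)\<^sup>2)"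
    proof (rule expectation_le)
      fix w assume "w \<in> space M"
      from F_le[OF this] have "(F n w)\<^sup>2 \<le> a\<^sup>2" using a_pos by (simp add: abs_le_square_iff[symmetric])
      then show "(q n w)\<^sup>2 \<le> a\<^sup>2 * (window N K n w)\<^sup>2" by (simp add: q_def power_mult_distrib mult_right_mono)
    qed (intro bdd)+
    also have "\<dots> \<le> a\<^sup>2 * (SV * k)"
      using window_second_moment[of N K n] by (simp add: k_def mult_left_mono)
    finally show ?thesis by simp
  qed
  have near_bound: "\<bar>expectation (\<lambda>w. C n w * C m w)\<bar> \<le> a\<^sup>2 * SV * k" for n m
  proof -
    have "\<bar>expectation (\<lambda>w. C n w * C m w)\<bar> \<le> expectation (\<lambda>w. \<bar>C n w * C m w\<bar>)" by (rule integral_abs_bound)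
    also have "\<dots> \<le> expectation (\<lambda>w. 1/2 * ((C n w)\<^sup>2 + (C m w)\<^sup>2))"
    proof (rule expectation_le)
      fix w
      have "0 \<le> (\<bar>C n w\<bar> - \<bar>C m w\<bar>)\<^sup>2" by simp
      then show "\<bar>C n w * C m w\<bar> \<le> 1/2 * ((C n w)\<^sup>2 + (C m w)\<^sup>2)" by (simp add: power2_diff abs_mult)
    qed (intro bdd)+
    also have "\<dots> = 1/2 * (expectation (\<lambda>w. (C n w)\<^sup>2) + expectation (\<lambda>w. (C m w)\<^sup>2))"
      using integrable_bdd[OF bdd_rv_power2[OF bC]] by simp
    finally show ?thesis using C_sq[of n] C_sq[of m] by simp
  qed
  have far_bound: "\<bar>expectation (\<lambda>w. C n w * C m w)\<bar> \<le> c2 * a\<^sup>2 * k\<^sup>2 * R (m - n - 2 * K - 1)"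
    if nm: "n + 2 * K < m" for n m
  proof -
    let ?t = "m - K"
    define G where "G = (\<lambda>z. \<psi> m (flow K ?t z) * (\<Sum>i\<in>near N K m. \<psi> i (flow (i - ?t) ?t z)))"
    have [measurable]: "G \<in> borel_measurable borel" unfolding G_def by measurable
    have card: "real (card (near N K j)) \<le> k" for j
      using near(3)[of N K j] of_nat_le_iff[where 'a = real] unfolding k_def by fastforce
    have G_le: "\<bar>G z\<bar> \<le> a * (k * a)" if z: "z \<in> {0..1}" for z
    proof -
      have "\<bar>\<Sum>i\<in>near N K m. \<psi> i (flow (i - ?t) ?t z)\<bar> \<le> (\<Sum>i\<in>near N K m. a)"
        by (intro order.trans[OF sum_abs] sum_mono psi_le flow_in z)
      also have "\<dots> \<le> k * a" using card a_pos by simp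
      finally show ?thesis unfolding G_def abs_mult
        using psi_le[OF flow_in[OF z]] a_pos by (intro mult_mono) auto
    qed
    have qm: "q m w = G (X ?t w)" if w: "w \<in> space M" for w
    proof -
      have "X m w = flow K ?t (X ?t w)" using flow[OF w, of ?t K] nm by simp
      moreover have "X i w = flow (i - ?t) ?t (X ?t w)" if "i \<in> near N K m" for i
        using flow[OF w, of ?t "i - ?t"] that nm by (auto simp: near_def split: if_splits)
      ultimately show ?thesis by (simp add: q_def window_def G_def F_def)
    qed
    have qn: "q n w = F n w * window N K n w" for w by (simp add: q_def)
    \<comment> \<open>The product at n reads indices up to n + K, and the product at m reads indices
      from m - K on; g is the gap in between.\<close>
    define p g where "p = n + K + 1" and "g = m - n - 2 * K - 1"
    have pg: "p + g = ?t" using nm by (simp add: p_def g_def)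
    let ?g = "\<lambda>w. G (X (p + g) w)"
    have bg: "bdd_rv M ?g" by (rule bdd_future[OF _ G_le]) auto
    have "expectation (\<lambda>w. C n w * C m w) = expectation (\<lambda>w. q n w * q m w) - expectation (q n) * expectation (q m)"
      unfolding C_def
      using integrable_bdd[OF bdd_rv_mult[OF bq bq]] integrable_bdd[OF bq]
      by (simp add: algebra_simps prob_space)
    also have "expectation (q m) = expectation ?g"
      by (rule Bochner_Integration.integral_cong[OF refl]) (simp add: qm pg)
    also have "expectation (\<lambda>w. q n w * q m w) = expectation (\<lambda>w. \<Sum>i\<in>near N K n. F n w * F i w * ?g w)"
      by (rule Bochner_Integration.integral_cong[OF refl])
        (simp add: qm pg qn window_def sum_distrib_left sum_distrib_right)
    also have "\<dots> = (\<Sum>i\<in>near N K n. expectation (\<lambda>w. F n w * F i w * ?g w))"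
      by (intro Bochner_Integration.integral_sum integrable_bdd bdd bg)
    also have "expectation (q n) = (\<Sum>i\<in>near N K n. expectation (\<lambda>w. F n w * F i w))"
      unfolding q_def window_def sum_distrib_left by (intro Bochner_Integration.integral_sum integrable_bdd bdd)
    finally have cov: "expectation (\<lambda>w. C n w * C m w) = (\<Sum>i\<in>near N K n.
        expectation (\<lambda>w. F n w * F i w * ?g w) - expectation (\<lambda>w. F n w * F i w) * expectation ?g)"
      by (simp only: sum_subtractf sum_distrib_right)
    have "\<bar>expectation (\<lambda>w. C n w * C m w)\<bar> \<le> (\<Sum>i\<in>near N K n. a * (k * a) * c2 * R g)"
      unfolding cov
    proof (rule order.trans[OF sum_abs], rule sum_mono)
      fix i assume "i \<in> near N K n"
      then have "i < p" by (auto simp: near_def p_def split: if_splits)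
      moreover have "n < p" by (simp add: p_def)
      ultimately show "\<bar>expectation (\<lambda>w. F n w * F i w * ?g w) -
          expectation (\<lambda>w. F n w * F i w) * expectation ?g\<bar> \<le> a * (k * a) * c2 * R g"
        using G_le by (intro cov_pair_future) auto
    qed
    also have "\<dots> = real (card (near N K n)) * (a * (k * a) * c2 * R g)" by simp
    also have "\<dots> \<le> k * (a * (k * a) * c2 * R g)"
      using card[of n] a_pos c_nonneg R_nonneg k1 by (intro mult_right_mono) auto
    finally show ?thesis by (simp add: g_def power2_eq_square mult_ac)
  qed
  define \<gamma> where "\<gamma> = (\<lambda>d. if d \<le> 2 * K then a\<^sup>2 * SV * k else c2 * a\<^sup>2 * k\<^sup>2 * R (d - 2 * K - 1))"
  have \<gamma>0: "0 \<le> \<gamma> d" for d using SV_pos k1 c_nonneg R_nonneg by (simp add: \<gamma>_def)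
  have le\<gamma>: "\<bar>expectation (\<lambda>w. C n w * C m w)\<bar> \<le> \<gamma> (dist_nat n m)" for n m
  proof -
    have sym: "expectation (\<lambda>w. C m w * C n w) = expectation (\<lambda>w. C n w * C m w)"
      by (simp only: mult.commute)
    have "dist_nat n m \<le> 2 * K \<or> n + 2 * K < m \<or> m + 2 * K < n" by (cases "n \<le> m") auto
    then consider "dist_nat n m \<le> 2 * K" | "n + 2 * K < m" | "m + 2 * K < n" by blast
    then show ?thesis
    proof cases
      case 1 then show ?thesis using near_bound[of n m] unfolding \<gamma>_def by simp
    next
      case 2 then show ?thesis using far_bound[OF 2] unfolding \<gamma>_def by (simp add: le_diff_conv)
    next
      case 3 then show ?thesis using far_bound[OF 3] unfolding \<gamma>_def sym by (simp add: le_diff_conv)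
    qed
  qed
  have sum\<gamma>: "(\<Sum>d<N. \<gamma> d) \<le> a\<^sup>2 * (SV + c2 * SR) * k\<^sup>2"
  proof -
    have "(\<Sum>d<N. \<gamma> d) \<le> (\<Sum>d\<in>{..<2 * K + 1} \<union> {2 * K + 1..<N}. \<gamma> d)"
      using \<gamma>0 by (intro sum_mono2) auto
    also have "\<dots> = (\<Sum>d<2 * K + 1. \<gamma> d) + (\<Sum>d\<in>{2 * K + 1..<N}. \<gamma> d)"
      by (intro sum.union_disjoint) auto
    also have "(\<Sum>d<2 * K + 1. \<gamma> d) = k * (a\<^sup>2 * SV * k)" by (simp add: \<gamma>_def k_def)
    also have "(\<Sum>d\<in>{2 * K + 1..<N}. \<gamma> d) = (\<Sum>d<N - (2 * K + 1). c2 * a\<^sup>2 * k\<^sup>2 * R d)"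
      by (rule sum.reindex_bij_witness[of _ "\<lambda>d. d + (2 * K + 1)" "\<lambda>d. d - (2 * K + 1)"]) (auto simp: \<gamma>_def)
    also have "\<dots> \<le> c2 * a\<^sup>2 * k\<^sup>2 * SR"
      unfolding sum_distrib_left[symmetric] using SR(2) c_nonneg by (intro mult_left_mono) auto
    finally show ?thesis by (simp add: power2_eq_square algebra_simps)
  qed
  have "Q w - expectation Q = (\<Sum>n<N. C n w)" for w
  proof -
    have "expectation Q = (\<Sum>n<N. expectation (q n))"
      unfolding Q_def q_def by (intro Bochner_Integration.integral_sum integrable_bdd bdd)
    then show ?thesis by (simp add: Q_def C_def q_def sum_subtractf)
  qed
  then have "expectation (\<lambda>w. (Q w - expectation Q)\<^sup>2) = expectation (\<lambda>w. \<Sum>n<N. \<Sum>m<N. C n w * C m w)"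
    by (simp only: power2_eq_square sum_product)
  also have "\<dots> = (\<Sum>n<N. \<Sum>m<N. expectation (\<lambda>w. C n w * C m w))"
    by (subst Bochner_Integration.integral_sum, intro integrable_bdd bdd)
      (intro sum.cong refl Bochner_Integration.integral_sum integrable_bdd bdd)
  also have "\<dots> \<le> (\<Sum>n<N. \<Sum>m<N. \<gamma> (dist_nat n m))"
    using le\<gamma> by (intro sum_mono) (meson abs_le_D1)
  also have "\<dots> \<le> (\<Sum>n<N. 2 * (\<Sum>d<N. \<gamma> d))"
    by (intro sum_mono sum_dist_nat_le \<gamma>0) auto
  also have "\<dots> \<le> (\<Sum>n<N. 2 * (a\<^sup>2 * (SV + c2 * SR) * k\<^sup>2))"
    using sum\<gamma> by (intro sum_mono) auto
  finally show ?thesis by (simp add: c3_def k_def mult_ac)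
qed

lemma abs_moment_le: "bdd_rv M Y \<Longrightarrow> expectation (\<lambda>w. \<bar>Y w\<bar>) \<le> sqrt (expectation (\<lambda>w. (Y w)\<^sup>2))"
proof -
  assume Y: "bdd_rv M Y"
  have "expectation (\<lambda>w. (\<bar>Y w\<bar> - expectation (\<lambda>w. \<bar>Y w\<bar>))\<^sup>2) =
      expectation (\<lambda>w. \<bar>Y w\<bar>\<^sup>2) - (expectation (\<lambda>w. \<bar>Y w\<bar>))\<^sup>2"
    by (rule variance_eq) (intro integrable_bdd bdd Y)+
  moreover have "0 \<le> expectation (\<lambda>w. (\<bar>Y w\<bar> - expectation (\<lambda>w. \<bar>Y w\<bar>))\<^sup>2)" by simp
  ultimately have "(expectation (\<lambda>w. \<bar>Y w\<bar>))\<^sup>2 \<le> expectation (\<lambda>w. (Y w)\<^sup>2)" by simp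
  then show ?thesis by (rule real_le_rsqrt)
qed

definition partial_sum :: "nat \<Rightarrow> 'a \<Rightarrow> real" where
  "partial_sum N w = (\<Sum>i<N. F i w)"

lemma bdd_partial_sum [bdd]: "bdd_rv M (partial_sum N)"
  unfolding partial_sum_def[abs_def] by (intro bdd)

lemma partial_sum_split:
  assumes "n < N"
  shows "partial_sum N w = ((\<Sum>i<n - K. F i w) + (\<Sum>i\<in>{n + K + 1..<N}. F i w)) + window N K n w"
proof -
  have "{..<N} = ({..<n - K} \<union> {n + K + 1..<N}) \<union> near N K n"
    using assms by (auto simp: near_def split: if_splits)
  moreover have "({..<n - K} \<union> {n + K + 1..<N}) \<inter> near N K n = {}" by (auto simp: near_def split: if_splits)
  moreover have "{..<n - K} \<inter> {n + K + 1..<N} = {}" by auto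
  ultimately show ?thesis
    unfolding partial_sum_def window_def by (simp add: sum.union_disjoint near(2) del: Un_insert_left)
qed

section \<open>The Stein bound\<close>

text \<open>In this order: the mismatch between \<sigma>^2 and the sum of window products, the
  correlation left across the gap, and the Taylor remainder. The numbers 12, 14 and 26 are the
  bounds of \<open>stein_equation\<close>.\<close>

definition stein_error :: "nat \<Rightarrow> nat \<Rightarrow> real \<Rightarrow> real \<Rightarrow> real" where
  "stein_error N K \<sigma>0 \<sigma> =
    14 * (2 * a * c1 * real N * SRtail K + sqrt (c3 * real N) * (2 * real K + 1)) / \<sigma>\<^sup>2 +
    real N * ((12 * c1 + 2 * a * 12 + 6 * L * a * 14 / \<sigma>0) * R K) / \<sigma> +
    real N * (26 * a * (SV * (2 * real K + 1))) / \<sigma> ^ 3"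

text \<open>The error of the normal approximation is the mean of A'(W) - W A(W). Writing W as a sum
  over n, each A(W) is compared with its value at V_n, the normalised sum without the window. This
  leaves F_n A(V_n), handled by \<open>mean_separated\<close>; a linear term which should cancel
  A'(W), because the window products have mean close to \<sigma>^2; and a quadratic remainder
  controlled by the second moment of the window.\<close>

lemma stein_bound_smooth:
  fixes u :: "real \<Rightarrow> real"
  assumes lip: "\<And>x y. \<bar>u x - u y\<bar> \<le> \<bar>x - y\<bar>" and deriv: "\<And>x. (u has_real_derivative u' x) (at x)"
    and \<sigma>: "\<sigma>\<^sup>2 = expectation (\<lambda>w. (partial_sum N w)\<^sup>2)" "0 < \<sigma>0" "\<sigma>0 \<le> \<sigma>"
  shows "\<bar>expectation (\<lambda>w. u (partial_sum N w / \<sigma>)) - (\<integral>x. std_normal_density x * u x \<partial>lborel)\<bar>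
    \<le> stein_error N K \<sigma>0 \<sigma>"
proof -
  define c where "c = (\<integral>x. std_normal_density x * u x \<partial>lborel)"
  obtain A A' where dA: "\<And>x. (A has_real_derivative A' x) (at x)" and eq: "\<And>x. A' x = x * A x + (u x - c)"
    and A: "\<And>x. \<bar>A x\<bar> \<le> 12" and A': "\<And>x. \<bar>A' x\<bar> \<le> 14" "\<And>x y. \<bar>A' x - A' y\<bar> \<le> 26 * \<bar>x - y\<bar>"
    using stein_equation[OF lip deriv, folded c_def] by metis
  have mvt: "\<exists>z. \<bar>z - x\<bar> \<le> \<bar>x - y\<bar> \<and> A x - A y = (x - y) * A' z" for x y
  proof (cases x y rule: linorder_cases)
    case less
    obtain z where "x < z" "z < y" "A y - A x = (y - x) * A' z" using MVT2[OF less, of A A'] dA by blast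
    then show ?thesis by (intro exI[of _ z]) (auto simp: algebra_simps)
  next
    case greater
    obtain z where "y < z" "z < x" "A x - A y = (x - y) * A' z" using MVT2[OF greater, of A A'] dA by blast
    then show ?thesis by (intro exI[of _ z]) auto
  qed auto
  have taylor: "\<bar>A x - A y - A' x * (x - y)\<bar> \<le> 26 * (x - y)\<^sup>2" for x y
  proof -
    obtain z where z: "\<bar>z - x\<bar> \<le> \<bar>x - y\<bar>" "A x - A y = (x - y) * A' z" using mvt by blast
    have "A x - A y - A' x * (x - y) = (x - y) * (A' z - A' x)" by (simp add: z algebra_simps)
    also have "\<bar>\<dots>\<bar> \<le> \<bar>x - y\<bar> * (26 * \<bar>x - y\<bar>)"
      unfolding abs_mult using A'(2)[of z x] z by (intro mult_left_mono) auto
    also have "\<dots> = 26 * (x - y)\<^sup>2" by (simp add: power2_eq_square flip: abs_mult)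
    finally show ?thesis .
  qed
  have A_lip: "\<bar>A x - A y\<bar> \<le> 14 * \<bar>x - y\<bar>" for x y
  proof -
    obtain z where "A x - A y = (x - y) * A' z" using mvt by blast
    then show ?thesis using mult_left_mono[OF A'(1)[of z], of "\<bar>x - y\<bar>"] by (simp add: abs_mult mult.commute)
  qed
  have [measurable]: "A \<in> borel_measurable borel" "A' \<in> borel_measurable borel" "u \<in> borel_measurable borel"
    using lipschitz_borel[of A 14] lipschitz_borel[of A' 26] lipschitz_borel[of u 1] A_lip A'(2) lip by auto
  have \<sigma>0: "0 < \<sigma>" using \<sigma> by simp
  define W where "W = (\<lambda>w. partial_sum N w / \<sigma>)"
  define V where "V = (\<lambda>n w. ((\<Sum>i<n - K. F i w) + (\<Sum>i\<in>{n + K + 1..<N}. F i w)) / \<sigma>)"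
  define B where "B = window N K"
  define Q where "Q = (\<lambda>w. \<Sum>n<N. F n w * B n w)"
  have bW [bdd]: "bdd_rv M W" unfolding W_def by (intro bdd)
  have bV [bdd]: "bdd_rv M (V n)" for n unfolding V_def by (intro bdd)
  have bB [bdd]: "bdd_rv M (B n)" for n unfolding B_def by (intro bdd)
  have bQ [bdd]: "bdd_rv M Q" unfolding Q_def by (intro bdd)
  have bA [bdd]: "bdd_rv M (\<lambda>w. A (Y w))" if "bdd_rv M Y" for Y
    by (rule bdd_rv_compose[OF that _ A]) simp
  have bA' [bdd]: "bdd_rv M (\<lambda>w. A' (Y w))" if "bdd_rv M Y" for Y
    by (rule bdd_rv_compose[OF that _ A'(1)]) simp
  \<comment> \<open>The derivative is taken at W and not at V_n: it is then a common factor for all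
    n, and the linear terms add up to A'(W) Q.\<close>
  define rem where "rem = (\<lambda>n w. A (W w) - A (V n w) - A' (W w) * (W w - V n w))"
  have brem [bdd]: "bdd_rv M (rem n)" for n unfolding rem_def by (intro bdd)
  have WV: "W w - V n w = B n w / \<sigma>" if "n < N" for n w
    unfolding W_def V_def B_def partial_sum_split[OF that, of w K] by (simp add: diff_divide_distrib[symmetric])
  have rem_le: "\<bar>rem n w\<bar> \<le> 26 * (B n w)\<^sup>2 / \<sigma>\<^sup>2" if "n < N" for n w
    using taylor[of "W w" "V n w"] unfolding rem_def WV[OF that] by (simp add: power_divide)
  have decomp: "A' (W w) - W w * A (W w) = A' (W w) * (1 - Q w / \<sigma>\<^sup>2) -
      (\<Sum>n<N. F n w * A (V n w)) / \<sigma> - (\<Sum>n<N. F n w * rem n w) / \<sigma>" for w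
  proof -
    have "F n w * A (W w) = F n w * A (V n w) + A' (W w) * (F n w * B n w) / \<sigma> + F n w * rem n w"
      if "n < N" for n
      unfolding rem_def WV[OF that] by (simp add: algebra_simps)
    then have "(\<Sum>n<N. F n w * A (W w)) =
        (\<Sum>n<N. F n w * A (V n w) + A' (W w) * (F n w * B n w) / \<sigma> + F n w * rem n w)"
      by (intro sum.cong) auto
    also have "\<dots> = (\<Sum>n<N. F n w * A (V n w)) + A' (W w) * Q w / \<sigma> + (\<Sum>n<N. F n w * rem n w)"
      by (simp add: sum.distrib Q_def sum_distrib_left sum_divide_distrib)
    also have "(\<Sum>n<N. F n w * A (W w)) = \<sigma> * (W w * A (W w))"
      using \<sigma>0 by (simp add: W_def partial_sum_def sum_distrib_right)
    finally have "W w * A (W w) = ((\<Sum>n<N. F n w * A (V n w)) + A' (W w) * Q w / \<sigma> + (\<Sum>n<N. F n w * rem n w)) / \<sigma>"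
      using \<sigma>0 by (simp add: field_simps)
    then show ?thesis by (simp add: add_divide_distrib power2_eq_square right_diff_distrib)
  qed
  \<comment> \<open>The distance of Q from \<sigma>^2 is split into a deterministic part, the
    covariances outside the windows, and the fluctuation of Q, estimated in mean by its standard
    deviation.\<close>
  have e1: "\<bar>expectation (\<lambda>w. A' (W w) * (1 - Q w / \<sigma>\<^sup>2))\<bar>
      \<le> 14 * (2 * a * c1 * real N * SRtail K + sqrt (c3 * real N) * (2 * real K + 1)) / \<sigma>\<^sup>2"
  proof -
    have "\<bar>expectation (\<lambda>w. A' (W w) * (1 - Q w / \<sigma>\<^sup>2))\<bar> \<le> expectation (\<lambda>w. \<bar>A' (W w) * (1 - Q w / \<sigma>\<^sup>2)\<bar>)"
      by (rule integral_abs_bound)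
    also have "\<dots> \<le> expectation (\<lambda>w. 14 / \<sigma>\<^sup>2 * (\<bar>\<sigma>\<^sup>2 - expectation Q\<bar> + \<bar>Q w - expectation Q\<bar>))"
    proof (rule expectation_le)
      fix w
      have "1 - Q w / \<sigma>\<^sup>2 = (\<sigma>\<^sup>2 - Q w) / \<sigma>\<^sup>2" using \<sigma>0 by (simp add: diff_divide_distrib)
      also have "\<bar>\<dots>\<bar> = \<bar>\<sigma>\<^sup>2 - Q w\<bar> / \<sigma>\<^sup>2" by simp
      also have "\<dots> \<le> (\<bar>\<sigma>\<^sup>2 - expectation Q\<bar> + \<bar>Q w - expectation Q\<bar>) / \<sigma>\<^sup>2"
        by (intro divide_right_mono) auto
      finally have "\<bar>A' (W w)\<bar> * \<bar>1 - Q w / \<sigma>\<^sup>2\<bar> \<le> 14 * ((\<bar>\<sigma>\<^sup>2 - expectation Q\<bar> + \<bar>Q w - expectation Q\<bar>) / \<sigma>\<^sup>2)"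
        using A'(1) by (intro mult_mono) auto
      then show "\<bar>A' (W w) * (1 - Q w / \<sigma>\<^sup>2)\<bar> \<le> 14 / \<sigma>\<^sup>2 * (\<bar>\<sigma>\<^sup>2 - expectation Q\<bar> + \<bar>Q w - expectation Q\<bar>)"
        by (simp add: abs_mult)
    qed (intro bdd)+
    also have "\<dots> = 14 / \<sigma>\<^sup>2 * (\<bar>\<sigma>\<^sup>2 - expectation Q\<bar> + expectation (\<lambda>w. \<bar>Q w - expectation Q\<bar>))"
      using integrable_bdd[OF bdd_rv_abs[OF bdd_rv_diff[OF bQ bdd_rv_const]]] by (simp add: prob_space)
    also have "\<dots> \<le> 14 / \<sigma>\<^sup>2 * (2 * a * c1 * real N * SRtail K + sqrt (c3 * real N) * (2 * real K + 1))"
    proof (intro mult_left_mono add_mono)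
      show "\<bar>\<sigma>\<^sup>2 - expectation Q\<bar> \<le> 2 * a * c1 * real N * SRtail K"
        unfolding \<sigma>(1) Q_def B_def partial_sum_def by (rule variance_window_gap)
      have "expectation (\<lambda>w. \<bar>Q w - expectation Q\<bar>) \<le> sqrt (expectation (\<lambda>w. (Q w - expectation Q)\<^sup>2))"
        by (rule abs_moment_le) (intro bdd)
      also have "\<dots> \<le> sqrt (c3 * real N * (2 * real K + 1)\<^sup>2)"
        unfolding Q_def B_def by (intro real_sqrt_le_mono variance_window_products)
      also have "\<dots> = sqrt (c3 * real N) * (2 * real K + 1)" by (simp add: real_sqrt_mult)
      finally show "expectation (\<lambda>w. \<bar>Q w - expectation Q\<bar>) \<le> sqrt (c3 * real N) * (2 * real K + 1)" .
    qed simp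
    finally show ?thesis by simp
  qed
  have e2: "\<bar>expectation (\<lambda>w. (\<Sum>n<N. F n w * A (V n w)) / \<sigma>)\<bar>
      \<le> real N * ((12 * c1 + 2 * a * 12 + 6 * L * a * 14 / \<sigma>0) * R K) / \<sigma>"
  proof -
    have "expectation (\<lambda>w. (\<Sum>n<N. F n w * A (V n w)) / \<sigma>) = (\<Sum>n<N. expectation (\<lambda>w. F n w * A (V n w))) / \<sigma>"
      unfolding integral_divide_zero
      by (subst Bochner_Integration.integral_sum, intro integrable_bdd bdd) simp
    also have "\<bar>\<dots>\<bar> = \<bar>\<Sum>n<N. expectation (\<lambda>w. F n w * A (V n w))\<bar> / \<sigma>" using \<sigma>0 by simp
    also have "\<dots> \<le> (\<Sum>n<N. (12 * c1 + 2 * a * 12 + 6 * L * a * 14 / \<sigma>0) * R K) / \<sigma>"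
      using \<sigma>0 unfolding V_def
      by (intro divide_right_mono order.trans[OF sum_abs] sum_mono mean_separated A A_lip \<sigma>) auto
    finally show ?thesis by simp
  qed
  have e3: "\<bar>expectation (\<lambda>w. (\<Sum>n<N. F n w * rem n w) / \<sigma>)\<bar> \<le> real N * (26 * a * (SV * (2 * real K + 1))) / \<sigma> ^ 3"
  proof -
    have one: "\<bar>expectation (\<lambda>w. F n w * rem n w)\<bar> \<le> 26 * a / \<sigma>\<^sup>2 * (SV * (2 * real K + 1))" if "n < N" for n
    proof -
      have "\<bar>expectation (\<lambda>w. F n w * rem n w)\<bar> \<le> expectation (\<lambda>w. \<bar>F n w * rem n w\<bar>)" by (rule integral_abs_bound)
      also have "\<dots> \<le> expectation (\<lambda>w. 26 * a / \<sigma>\<^sup>2 * (B n w)\<^sup>2)"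
      proof (rule expectation_le)
        fix w assume "w \<in> space M"
        then have "\<bar>F n w\<bar> * \<bar>rem n w\<bar> \<le> a * (26 * (B n w)\<^sup>2 / \<sigma>\<^sup>2)"
          using F_le[of w n] rem_le[OF that, of w] a_pos by (intro mult_mono) auto
        then show "\<bar>F n w * rem n w\<bar> \<le> 26 * a / \<sigma>\<^sup>2 * (B n w)\<^sup>2" by (simp add: abs_mult mult_ac)
      qed (intro bdd)+
      also have "\<dots> = 26 * a / \<sigma>\<^sup>2 * expectation (\<lambda>w. (B n w)\<^sup>2)" by simp
      also have "\<dots> \<le> 26 * a / \<sigma>\<^sup>2 * (SV * (2 * real K + 1))"
        unfolding B_def using a_pos by (intro mult_left_mono window_second_moment) auto
      finally show ?thesis .
    qed
    have "expectation (\<lambda>w. (\<Sum>n<N. F n w * rem n w) / \<sigma>) = (\<Sum>n<N. expectation (\<lambda>w. F n w * rem n w)) / \<sigma>"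
      unfolding integral_divide_zero
      by (subst Bochner_Integration.integral_sum, intro integrable_bdd bdd) simp
    also have "\<bar>\<dots>\<bar> = \<bar>\<Sum>n<N. expectation (\<lambda>w. F n w * rem n w)\<bar> / \<sigma>" using \<sigma>0 by simp
    also have "\<dots> \<le> (\<Sum>n<N. 26 * a / \<sigma>\<^sup>2 * (SV * (2 * real K + 1))) / \<sigma>"
      using \<sigma>0 one by (intro divide_right_mono order.trans[OF sum_abs] sum_mono) auto
    also have "\<dots> = real N * (26 * a * (SV * (2 * real K + 1))) / \<sigma> ^ 3"
      by (simp add: power2_eq_square power3_eq_cube)
    finally show ?thesis .
  qed
  have "expectation (\<lambda>w. u (W w)) - c = expectation (\<lambda>w. A' (W w) - W w * A (W w))"
  proof -
    have "expectation (\<lambda>w. A' (W w) - W w * A (W w)) = expectation (\<lambda>w. u (W w) - c)"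
      by (simp add: eq)
    moreover have "bdd_rv M (\<lambda>w. u (W w))"
    proof -
      have "u (W w) = A' (W w) - W w * A (W w) + c" for w by (simp add: eq)
      then show ?thesis by (simp only:) (intro bdd)
    qed
    ultimately show ?thesis using integrable_bdd by (simp add: prob_space)
  qed
  also have "\<dots> = expectation (\<lambda>w. A' (W w) * (1 - Q w / \<sigma>\<^sup>2)) -
      expectation (\<lambda>w. (\<Sum>n<N. F n w * A (V n w)) / \<sigma>) - expectation (\<lambda>w. (\<Sum>n<N. F n w * rem n w) / \<sigma>)"
    unfolding decomp
    by (subst Bochner_Integration.integral_diff, (intro integrable_bdd bdd)+)
      (subst Bochner_Integration.integral_diff, (intro integrable_bdd bdd)+, simp)
  finally have "\<bar>expectation (\<lambda>w. u (W w)) - c\<bar> \<le> stein_error N K \<sigma>0 \<sigma>"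
    using e1 e2 e3 unfolding stein_error_def by linarith
  then show ?thesis by (simp add: W_def c_def)
qed

text \<open>The smooth bound depends on the test function only through its Lipschitz constant, so
  smoothing at scale e / 2 costs e / 2 in each of the two integrals, and e is arbitrary.\<close>

lemma stein_bound:
  fixes h :: "real \<Rightarrow> real"
  assumes lip: "\<And>x y. \<bar>h x - h y\<bar> \<le> \<bar>x - y\<bar>"
    and \<sigma>: "\<sigma>\<^sup>2 = expectation (\<lambda>w. (partial_sum N w)\<^sup>2)" "0 < \<sigma>0" "\<sigma>0 \<le> \<sigma>"
  shows "\<bar>expectation (\<lambda>w. h (partial_sum N w / \<sigma>)) - (\<integral>x. std_normal_density x * h x \<partial>lborel)\<bar>
    \<le> stein_error N K \<sigma>0 \<sigma>"
proof (rule field_le_epsilon)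
  fix e :: real assume "0 < e"
  then have e: "0 < e / 2" by simp
  obtain u u' where u: "\<And>x. (u has_real_derivative u' x) (at x)" "\<And>x y. \<bar>u x - u y\<bar> \<le> \<bar>x - y\<bar>"
    "\<And>x. \<bar>u x - h x\<bar> \<le> e / 2"
    using lipschitz_smoothing[OF lip e] by metis
  let ?W = "\<lambda>w. partial_sum N w / \<sigma>" and ?\<phi> = std_normal_density
  have bl: "bdd_rv M (\<lambda>w. v (?W w))" if v: "\<And>x y. \<bar>v x - v y\<bar> \<le> \<bar>x - y\<bar>" for v :: "real \<Rightarrow> real"
  proof -
    have [measurable]: "v \<in> borel_measurable borel" using lipschitz_borel[of v 1] v by simp
    have W: "bdd_rv M ?W" by (intro bdd)
    then obtain b where b: "\<forall>w\<in>space M. \<bar>?W w\<bar> \<le> b" and [measurable]: "?W \<in> borel_measurable M"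
      unfolding bdd_rv_def by blast
    have "\<forall>w\<in>space M. \<bar>v (?W w)\<bar> \<le> \<bar>v 0\<bar> + b"
    proof
      fix w assume "w \<in> space M"
      then show "\<bar>v (?W w)\<bar> \<le> \<bar>v 0\<bar> + b" using v[of "?W w" 0] b[rule_format, of w] by linarith
    qed
    then show ?thesis unfolding bdd_rv_def by (intro conjI exI[of _ "\<bar>v 0\<bar> + b"]) auto
  qed
  have il: "integrable lborel (\<lambda>x. ?\<phi> x * v x)" if v: "\<And>x y. \<bar>v x - v y\<bar> \<le> \<bar>x - y\<bar>" for v :: "real \<Rightarrow> real"
  proof (rule Bochner_Integration.integrable_bound)
    have [measurable]: "v \<in> borel_measurable borel" using lipschitz_borel[of v 1] v by simp
    show "(\<lambda>x. ?\<phi> x * v x) \<in> borel_measurable lborel" by measurable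
    show "integrable lborel (\<lambda>x. ?\<phi> x * (\<bar>v 0\<bar> + \<bar>x\<bar>))"
      using integrable_std_normal_moment[of 0] integrable_std_normal_moment_abs[of 1] by (simp add: distrib_left)
    have "\<bar>v x\<bar> \<le> \<bar>v 0\<bar> + \<bar>x\<bar>" for x using v[of x 0] by linarith
    then show "AE x in lborel. norm (?\<phi> x * v x) \<le> norm (?\<phi> x * (\<bar>v 0\<bar> + \<bar>x\<bar>))"
      by (intro AE_I2) (simp add: abs_mult mult_left_mono)
  qed
  have "expectation (\<lambda>w. u (?W w)) - expectation (\<lambda>w. h (?W w)) = expectation (\<lambda>w. u (?W w) - h (?W w))"
    using integrable_bdd[OF bl[OF u(2)]] integrable_bdd[OF bl[OF lip]] by simp
  also have "\<bar>\<dots>\<bar> \<le> e / 2" by (rule expectation_abs_le) (use u(3) bl[OF u(2)] bl[OF lip] in \<open>auto intro: bdd\<close>)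
  finally have 1: "\<bar>expectation (\<lambda>w. u (?W w)) - expectation (\<lambda>w. h (?W w))\<bar> \<le> e / 2" .
  have "(\<integral>x. ?\<phi> x * u x \<partial>lborel) - (\<integral>x. ?\<phi> x * h x \<partial>lborel) = (\<integral>x. ?\<phi> x * (u x - h x) \<partial>lborel)"
    using il[OF u(2)] il[OF lip] by (simp add: right_diff_distrib)
  also have "\<bar>\<dots>\<bar> \<le> (\<integral>x. \<bar>?\<phi> x * (u x - h x)\<bar> \<partial>lborel)" by (rule integral_abs_bound)
  also have "\<dots> \<le> (\<integral>x. ?\<phi> x * (e / 2) \<partial>lborel)"
  proof (rule integral_mono)
    have "integrable lborel (\<lambda>x. ?\<phi> x * (u x - h x))"
      using il[OF u(2)] il[OF lip] by (simp add: right_diff_distrib)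
    then show "integrable lborel (\<lambda>x. \<bar>?\<phi> x * (u x - h x)\<bar>)" by simp
    show "\<bar>?\<phi> x * (u x - h x)\<bar> \<le> ?\<phi> x * (e / 2)" for x
      using u(3)[of x] by (simp add: abs_mult mult_left_mono del: times_divide_eq_right)
  qed (use integrable_std_normal_moment[of 0] in simp)
  also have "\<dots> = e / 2" using integral_std_normal_moment_even[of 0] by simp
  finally have 2: "\<bar>(\<integral>x. ?\<phi> x * u x \<partial>lborel) - (\<integral>x. ?\<phi> x * h x \<partial>lborel)\<bar> \<le> e / 2" .
  show "\<bar>expectation (\<lambda>w. h (?W w)) - (\<integral>x. ?\<phi> x * h x \<partial>lborel)\<bar> \<le> stein_error N K \<sigma>0 \<sigma> + e"
    using stein_bound_smooth[OF u(2,1) \<sigma>, of K] 1 2 by linarith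
qed

end

subsection \<open>The final rate\<close>

text \<open>The weight leaves the exponent -1/(2\<beta>), below -3/2, so the logarithm does no
  harm.\<close>

lemma summable_weighted_mixing_rate:
  assumes "0 < \<beta>" "\<beta> < 1/3"
  shows "summable (\<lambda>d. (real d + 1) powr (1 / (2 * \<beta>) - 1) * mixing_rate \<beta> d)"
proof (rule summable_comparison_test_bigo)
  have "3 < 1 / \<beta>" using assms by (simp add: field_simps)
  define q where "q = 1 / (2 * \<beta>) - 3/2"
  have q: "q > 0" "1 / \<beta> = 2 * q + 3" "1 / (2 * \<beta>) = q + 3/2"
    using \<open>3 < 1 / \<beta>\<close> assms by (auto simp: q_def field_simps)
  have "(real d + 1) powr (1 / (2 * \<beta>) - 1) * mixing_rate \<beta> d =
      (real d + 1) powr (- 3/2 - q) * ln (real d + 3) powr (2 * q + 3)" for d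
    unfolding mixing_rate_def mult.assoc[symmetric] powr_add[symmetric] q(2,3) by (simp add: field_simps)
  moreover have "(\<lambda>d. (real d + 1) powr (- 3/2 - q) * ln (real d + 3) powr (2 * q + 3)) \<in> O(\<lambda>n. real n powr - (3/2))"
    using q(1) by real_asymp
  ultimately show "(\<lambda>d. (real d + 1) powr (1 / (2 * \<beta>) - 1) * mixing_rate \<beta> d) \<in> O(\<lambda>n. real n powr - (3/2))"
    by simp
  show "summable (\<lambda>n. norm (real n powr - (3/2)))" by (simp add: summable_real_powr_iff)
qed

context mixing_process
begin

text \<open>Beyond K the weight of \<open>summable_weighted_mixing_rate\<close> is at least its
  value at K, so dividing by it bounds the tail without a logarithm. The loss in the exponent is
  affordable: for K = \<open>N powr \<beta>\<close> the tail is of order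
  \<open>N powr (\<beta> - 1/2)\<close>, so N times it matches sqrt N times K.\<close>

lemma SRtail_le:
  assumes b: "0 < \<beta>" "\<beta> < 1/3" and Cr: "0 < Cr" and R: "R = (\<lambda>n. Cr * mixing_rate \<beta> n)"
  shows "\<exists>C\<ge>0. \<forall>K. SRtail K \<le> C * (real K + 1) powr (1 - 1 / (2 * \<beta>))"
proof -
  define s where "s = 1 / (2 * \<beta>) - 1"
  have s: "0 < s" using b by (simp add: s_def field_simps)
  define v where "v = (\<lambda>d. (real d + 1) powr s * mixing_rate \<beta> d)"
  have sv: "summable v" unfolding v_def s_def by (rule summable_weighted_mixing_rate[OF b])
  have v0: "0 \<le> v d" for d using mixing_rate_pos[of \<beta> d] by (simp add: v_def)
  have "SRtail K \<le> Cr * suminf v * (real K + 1) powr (1 - 1 / (2 * \<beta>))" for K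
  proof -
    let ?k = "(real K + 1) powr - s"
    have le: "R (d + K) \<le> Cr * ?k * v (d + K)" for d
    proof -
      have "1 \<le> ?k * (real (d + K) + 1) powr s"
        using powr_mono2[of s "real K + 1" "real (d + K) + 1"] s by (simp add: powr_minus divide_simps)
      then have "1 * mixing_rate \<beta> (d + K) \<le> ?k * (real (d + K) + 1) powr s * mixing_rate \<beta> (d + K)"
        using mixing_rate_pos[of \<beta> "d + K"] by (intro mult_right_mono) auto
      then show ?thesis using Cr by (simp add: R v_def mult_ac)
    qed
    have sk: "summable (\<lambda>d. v (d + K))" using sv by (rule summable_ignore_initial_segment)
    have "SRtail K \<le> (\<Sum>d. Cr * ?k * v (d + K))"
      unfolding SRtail_def
      by (intro suminf_le le summable_ignore_initial_segment R_summable summable_mult sk)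
    also have "\<dots> = Cr * ?k * (\<Sum>d. v (d + K))" by (rule suminf_mult[OF sk])
    also have "(\<Sum>d. v (d + K)) \<le> suminf v"
      using suminf_split_initial_segment[OF sv, of K] v0 by (simp add: sum_nonneg)
    finally have "SRtail K \<le> Cr * ?k * suminf v" using Cr by (simp add: mult_left_mono)
    then show ?thesis by (simp add: s_def mult_ac)
  qed
  moreover have "0 \<le> Cr * suminf v" using Cr suminf_nonneg[OF sv] v0 by simp
  ultimately show ?thesis by blast
qed

text \<open>All three terms are reduced to E = \<open>x powr (1 + \<beta>) / \<sigma> ^ 3\<close>,
  the size of the Taylor remainder: missing powers of \<sigma> are supplied by the upper bound
  \<sigma>^2 \<le> \<open>SV\<close> N. Only then does the lower bound for the variance enter,
  through its power 3/2. Terms without a logarithm are divided by \<open>l2\<close>, which is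
  positive because N \<ge> 2.\<close>

lemma stein_error_rate:
  assumes b: "0 < \<beta>" "\<beta> < 1/3" and Cr: "0 < Cr" and R: "R = (\<lambda>n. Cr * mixing_rate \<beta> n)" and C0: "0 < C0"
  shows "\<exists>C>0. \<forall>N\<ge>2. \<forall>\<sigma>>0. \<sigma>\<^sup>2 \<le> SV * real N \<longrightarrow> C0 * real N powr \<epsilon> \<le> \<sigma>\<^sup>2 \<longrightarrow>
    stein_error N (nat \<lceil>real N powr \<beta>\<rceil>) (sqrt C0) \<sigma>
      \<le> C * real N powr (1 - 3/2 * \<epsilon> + \<beta>) * ln (real N) powr (1 / \<beta>)"
proof -
  obtain CT where CT: "0 \<le> CT" "\<And>K. SRtail K \<le> CT * (real K + 1) powr (1 - 1 / (2 * \<beta>))"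
    using SRtail_le[OF b Cr R] by blast
  define c4 where "c4 = 12 * c1 + 2 * a * 12 + 6 * L * a * 14 / sqrt C0"
  define l2 where "l2 = ln (2::real) powr (1 / \<beta>)"
  have l2: "0 < l2" by (simp add: l2_def)
  define D1 where "D1 = 14 * (2 * a * c1 * CT + 5 * sqrt c3) * sqrt SV + 130 * a * SV"
  define D2 where "D2 = c4 * Cr * 3 powr (1 / \<beta>) * SV"
  have pos: "0 \<le> c1" "0 \<le> c2" "0 < a" "0 \<le> L" "0 < SV" using c_nonneg a_pos L_nonneg SV_pos by auto
  have c3: "0 \<le> c3" using SR(1) pos by (simp add: c3_def)
  have c4: "0 \<le> c4" using pos C0 by (simp add: c4_def)
  have D1: "0 < D1" unfolding D1_def using pos c3 CT by (intro add_nonneg_pos) auto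
  have D2: "0 \<le> D2" unfolding D2_def using pos c4 Cr by simp
  define C where "C = (D1 / l2 + D2) / C0 powr (3/2)"
  have "stein_error N (nat \<lceil>real N powr \<beta>\<rceil>) (sqrt C0) \<sigma>
      \<le> C * real N powr (1 - 3/2 * \<epsilon> + \<beta>) * ln (real N) powr (1 / \<beta>)"
    if N: "2 \<le> N" and \<sigma>: "0 < \<sigma>" "\<sigma>\<^sup>2 \<le> SV * real N" "C0 * real N powr \<epsilon> \<le> \<sigma>\<^sup>2" for N \<sigma>
  proof -
    define x where "x = real N"
    define K where "K = nat \<lceil>x powr \<beta>\<rceil>"
    define l where "l = ln x powr (1 / \<beta>)"
    define E where "E = x powr (1 + \<beta>) / \<sigma> ^ 3"
    have x: "2 \<le> x" using N by (simp add: x_def)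
    have xb: "1 \<le> x powr \<beta>" using x b by (intro ge_one_powr_ge_zero) auto
    have K: "x powr \<beta> \<le> real K" "real K \<le> x powr \<beta> + 1" using xb unfolding K_def by linarith+
    have K5: "2 * real K + 1 \<le> 5 * x powr \<beta>" using K xb by linarith
    have l: "l2 \<le> l" unfolding l_def l2_def using x b by (intro powr_mono2) auto
    have E0: "0 \<le> E" using \<sigma> by (simp add: E_def)
    have \<sigma>_le: "\<sigma> \<le> sqrt SV * sqrt x"
      using real_sqrt_le_mono[OF \<sigma>(2)] \<sigma>(1) by (simp add: x_def real_sqrt_mult)
    have half: "x powr (1/2 + \<beta>) / \<sigma>\<^sup>2 \<le> sqrt SV * E"
    proof -
      have "x powr (1/2 + \<beta>) / \<sigma>\<^sup>2 = x powr (1/2 + \<beta>) * \<sigma> / \<sigma> ^ 3"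
        using \<sigma> by (simp add: power2_eq_square power3_eq_cube)
      also have "\<dots> \<le> x powr (1/2 + \<beta>) * (sqrt SV * sqrt x) / \<sigma> ^ 3"
        using \<sigma>_le \<sigma>(1) by (intro divide_right_mono mult_left_mono) auto
      also have "x powr (1/2 + \<beta>) * (sqrt SV * sqrt x) = sqrt SV * x powr (1 + \<beta>)"
        using x by (simp add: powr_half_sqrt[symmetric] powr_add[symmetric])
      finally show ?thesis by (simp add: E_def)
    qed
    have T: "SRtail K \<le> CT * x powr (\<beta> - 1/2)"
    proof -
      have "(real K + 1) powr (1 - 1 / (2 * \<beta>)) \<le> (x powr \<beta>) powr (1 - 1 / (2 * \<beta>))"
        using K xb b by (intro powr_mono2') (auto simp: field_simps)
      also have "\<dots> = x powr (\<beta> - 1/2)"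
      proof -
        have "\<beta> * (1 - 1 / (2 * \<beta>)) = \<beta> - 1/2" using b by (simp add: right_diff_distrib)
        then show ?thesis by (simp only: powr_powr)
      qed
      finally show ?thesis using CT(2)[of K] CT(1) mult_left_mono order.trans by blast
    qed
    have RK: "R K \<le> Cr * 3 powr (1 / \<beta>) * (x powr (\<beta> - 1) * l)"
    proof -
      have "(real K + 1) powr (1 - 1 / \<beta>) \<le> (x powr \<beta>) powr (1 - 1 / \<beta>)"
        using K xb b by (intro powr_mono2') (auto simp: field_simps)
      also have "\<dots> = x powr (\<beta> - 1)" using b by (simp add: powr_powr right_diff_distrib)
      finally have 1: "(real K + 1) powr (1 - 1 / \<beta>) \<le> x powr (\<beta> - 1)" .
      \<comment> \<open>A crude bound that gives ln (K + 3) \<le> 3 ln x, hence the factor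
        \<open>3 powr (1 / \<beta>)\<close>.\<close>
      have "real K + 3 \<le> x ^ 3"
      proof -
        have "x powr \<beta> \<le> x" using powr_mono[of \<beta> 1 x] x b by simp
        moreover have "2 * 2 * x \<le> x * x * x" using x by (intro mult_mono) auto
        ultimately show ?thesis using K x unfolding power3_eq_cube by linarith
      qed
      then have "ln (real K + 3) \<le> 3 * ln x"
        using x ln_le_cancel_iff[of "real K + 3" "x ^ 3"] by (simp add: ln_realpow)
      then have "ln (real K + 3) powr (1 / \<beta>) \<le> (3 * ln x) powr (1 / \<beta>)"
        using b ln_add3_ge_1[of K] by (intro powr_mono2) auto
      also have "\<dots> = 3 powr (1 / \<beta>) * l" using x by (simp add: powr_mult l_def)
      finally have "mixing_rate \<beta> K \<le> x powr (\<beta> - 1) * (3 powr (1 / \<beta>) * l)"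
        unfolding mixing_rate_def using 1 by (intro mult_mono) auto
      then show ?thesis using Cr by (simp add: R mult_ac)
    qed
    have t1: "14 * (2 * a * c1 * x * SRtail K + sqrt (c3 * x) * (2 * real K + 1)) / \<sigma>\<^sup>2
        \<le> 14 * (2 * a * c1 * CT + 5 * sqrt c3) * sqrt SV * E"
    proof -
      have "2 * a * c1 * x * SRtail K \<le> 2 * a * c1 * x * (CT * x powr (\<beta> - 1/2))"
        using T pos x by (intro mult_left_mono) auto
      also have "\<dots> = 2 * a * c1 * CT * (x powr 1 * x powr (\<beta> - 1/2))" using x by simp
      also have "x powr 1 * x powr (\<beta> - 1/2) = x powr (1/2 + \<beta>)" by (simp only: powr_add[symmetric]) simp
      finally have 1: "2 * a * c1 * x * SRtail K \<le> 2 * a * c1 * CT * x powr (1/2 + \<beta>)" .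
      have "sqrt (c3 * x) * (2 * real K + 1) \<le> sqrt (c3 * x) * (5 * x powr \<beta>)"
        using K5 c3 x by (intro mult_left_mono) auto
      also have "\<dots> = 5 * sqrt c3 * x powr (1/2 + \<beta>)"
        using x by (simp add: real_sqrt_mult powr_half_sqrt[symmetric] powr_add)
      finally have "14 * (2 * a * c1 * x * SRtail K + sqrt (c3 * x) * (2 * real K + 1)) / \<sigma>\<^sup>2
          \<le> 14 * ((2 * a * c1 * CT + 5 * sqrt c3) * x powr (1/2 + \<beta>)) / \<sigma>\<^sup>2"
        using 1 by (intro divide_right_mono) (auto simp: algebra_simps)
      also have "\<dots> = 14 * (2 * a * c1 * CT + 5 * sqrt c3) * (x powr (1/2 + \<beta>) / \<sigma>\<^sup>2)" by simp
      also have "\<dots> \<le> 14 * (2 * a * c1 * CT + 5 * sqrt c3) * (sqrt SV * E)"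
        using half pos c3 CT by (intro mult_left_mono) auto
      finally show ?thesis by simp
    qed
    have t2: "x * (c4 * R K) / \<sigma> \<le> D2 * l * E"
    proof -
      have "x * (c4 * R K) / \<sigma> \<le> x * (c4 * (Cr * 3 powr (1 / \<beta>) * (x powr (\<beta> - 1) * l))) / \<sigma>"
        using RK c4 x \<sigma> by (intro divide_right_mono mult_left_mono) auto
      also have "\<dots> = c4 * Cr * 3 powr (1 / \<beta>) * l * (x powr 1 * x powr (\<beta> - 1)) / \<sigma>" using x by simp
      also have "x powr 1 * x powr (\<beta> - 1) = x powr \<beta>" by (simp only: powr_add[symmetric]) simp
      also have "c4 * Cr * 3 powr (1 / \<beta>) * l * x powr \<beta> / \<sigma> = c4 * Cr * 3 powr (1 / \<beta>) * l * (x powr \<beta> * \<sigma>\<^sup>2 / \<sigma> ^ 3)"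
        using \<sigma> by (simp add: power2_eq_square power3_eq_cube)
      also have "\<dots> \<le> c4 * Cr * 3 powr (1 / \<beta>) * l * (x powr \<beta> * (SV * x) / \<sigma> ^ 3)"
        using \<sigma> c4 Cr l l2 by (intro mult_left_mono divide_right_mono) (auto simp: x_def)
      also have "x powr \<beta> * (SV * x) / \<sigma> ^ 3 = SV * E"
        using x by (simp add: E_def powr_add)
      finally show ?thesis by (simp add: D2_def mult_ac)
    qed
    have t3: "x * (26 * a * (SV * (2 * real K + 1))) / \<sigma> ^ 3 \<le> 130 * a * SV * E"
    proof -
      have "x * (26 * a * (SV * (2 * real K + 1))) / \<sigma> ^ 3 \<le> x * (26 * a * (SV * (5 * x powr \<beta>))) / \<sigma> ^ 3"
        using K5 x pos \<sigma> by (intro divide_right_mono mult_left_mono) auto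
      also have "\<dots> = 130 * a * SV * E" using x by (simp add: E_def powr_add)
      finally show ?thesis .
    qed
    have "stein_error N K (sqrt C0) \<sigma> \<le> D1 * E + D2 * l * E"
      using t1 t2 t3 unfolding stein_error_def x_def[symmetric] c4_def[symmetric] D1_def by (simp add: distrib_right)
    also have "\<dots> \<le> D1 * (l / l2) * E + D2 * l * E"
      using D1 l l2 E0 by (intro add_right_mono mult_right_mono) (auto simp: mult_le_cancel_left1 le_divide_eq)
    also have "\<dots> = (D1 / l2 + D2) * l * E" by (simp add: algebra_simps)
    also have "\<dots> \<le> (D1 / l2 + D2) * l * (x powr (1 - 3/2 * \<epsilon> + \<beta>) / C0 powr (3/2))"
    proof (rule mult_left_mono)
      have "(C0 * x powr \<epsilon>) powr (3/2) \<le> (\<sigma>\<^sup>2) powr (3/2)"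
        using \<sigma>(3) C0 by (intro powr_mono2) (auto simp: x_def)
      also have "(\<sigma>\<^sup>2) powr (3/2) = \<sigma> ^ 3"
        using \<sigma>(1) by (simp add: powr_powr flip: powr_numeral)
      also have "(C0 * x powr \<epsilon>) powr (3/2) = C0 powr (3/2) * x powr (3/2 * \<epsilon>)"
        using C0 by (simp add: powr_mult powr_powr mult.commute)
      finally have "E \<le> x powr (1 + \<beta>) / (C0 powr (3/2) * x powr (3/2 * \<epsilon>))"
        unfolding E_def using C0 x \<sigma> by (intro divide_left_mono) auto
      also have "\<dots> = x powr (1 + \<beta> - 3/2 * \<epsilon>) / C0 powr (3/2)" by (simp add: powr_diff)
      finally show "E \<le> x powr (1 - 3/2 * \<epsilon> + \<beta>) / C0 powr (3/2)" by (simp add: algebra_simps)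
      show "0 \<le> (D1 / l2 + D2) * l" using D1 D2 l l2 by (intro mult_nonneg_nonneg add_nonneg_nonneg) auto
    qed
    finally show ?thesis by (simp add: C_def x_def K_def l_def mult_ac)
  qed
  moreover have "0 < C" unfolding C_def using D1 D2 l2 C0 by (intro divide_pos_pos add_pos_nonneg) auto
  ultimately show ?thesis by blast
qed

end

section \<open>The central limit theorem\<close>

lemma integral_density_lebesgue01:
  fixes H :: "real \<Rightarrow> real"
  assumes g: "dec_dens g" and [measurable]: "H \<in> borel_measurable borel"
  shows "(\<integral>x. H x \<partial>density lebesgue01 g) = mass (\<lambda>x. H x * g x)"
proof -
  note m = borel_measurable_lebesgue01
  have "(\<integral>x. H x \<partial>density lebesgue01 g) = mass (\<lambda>x. g x *\<^sub>R H x)"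
    by (rule integral_density) (auto intro!: m AE_lebesgue01I dec_densD(1)[OF g] dec_densD(4)[OF g])
  then show ?thesis by (simp add: mult.commute)
qed

text \<open>Cutting g off outside \<open>{0<..1}\<close> gives a Borel function on the line that
  represents the same measure, since 0 is a null point; its mass is 1 because the measure is a
  probability.\<close>

lemma cone_star_density:
  assumes b: "0 < \<beta>" "\<beta> < 1/3" and g: "g \<in> cone_star \<beta>" and p: "prob_space (density lebesgue01 g)"
  obtains u where "dec_dens u" "mass u = 1" "\<And>x. 0 < x \<Longrightarrow> x \<le> 1 \<Longrightarrow> u x \<le> 7/2 * x powr - \<beta>"
    "density lebesgue01 g = density lebesgue01 u"
proof -
  define u where "u = (\<lambda>x. indicator {0<..1} x * g x)"
  have g': "continuous_on {0<..1} g" "integrable lebesgue01 g" "\<And>x. 0 < x \<Longrightarrow> x \<le> 1 \<Longrightarrow> 0 \<le> g x"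
    "\<And>x y. 0 < x \<Longrightarrow> x \<le> y \<Longrightarrow> y \<le> 1 \<Longrightarrow> g y \<le> g x"
    "\<And>x. 0 < x \<Longrightarrow> x \<le> 1 \<Longrightarrow> g x \<le> 2 powr \<beta> * (2 + \<beta>) * x powr (- \<beta>) * mass g"
    using g unfolding cone_star_def by (auto simp: monotone_on_def)
  have u_meas [measurable]: "u \<in> borel_measurable borel"
    using borel_measurable_continuous_on_indicator[OF _ g'(1)] by (simp add: u_def)
  have um: "u \<in> borel_measurable lebesgue01" by (rule borel_measurable_lebesgue01) simp
  have ae: "AE x in lebesgue01. g x = u x" by (rule AE_lebesgue01I) (simp add: u_def)
  have iu: "integrable lebesgue01 u"
    using g'(2) um by (rule integrable_cong_AE_imp) (use ae in \<open>auto elim: eventually_mono\<close>)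
  have du: "dec_dens u" unfolding dec_dens_def using u_meas iu g' by (auto simp: u_def)
  have mg: "mass g = mass u" using g'(2) um ae by (intro integral_cong_AE) auto
  have d: "density lebesgue01 g = density lebesgue01 u"
    using g'(2) um ae by (intro density_cong) (auto elim: eventually_mono)
  have "emeasure (density lebesgue01 u) {0..1} = 1"
    using prob_space.emeasure_space_1[OF p] by (simp add: d)
  then have "(\<integral>\<^sup>+x. ennreal (u x) * indicator {0..1} x \<partial>lebesgue01) = 1"
    using um sets.top[of lebesgue01] by (subst (asm) emeasure_density) auto
  also have "(\<integral>\<^sup>+x. ennreal (u x) * indicator {0..1} x \<partial>lebesgue01) = (\<integral>\<^sup>+x. ennreal (u x) \<partial>lebesgue01)"
    by (intro nn_integral_cong) simp
  finally have mu: "mass u = 1"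
    using um g'(3) by (subst integral_eq_nn_integral) (auto simp: u_def indicator_def)
  \<comment> \<open>2 \<le> (3/2)^3 bounds the cube root of 2 by 3/2, and 2 + \<beta> \<le> 7/3; the
    product is the constant of \<open>tail_transfer\<close>.\<close>
  have "2 powr \<beta> * (2 + \<beta>) \<le> 7/2"
  proof -
    have "2 powr \<beta> \<le> 2 powr (1/3)" using b by (intro powr_mono) auto
    also have "\<dots> \<le> ((3/2) ^ 3) powr (1/3 :: real)" by (intro powr_mono2) (auto simp: power3_eq_cube)
    also have "\<dots> = 3/2" by (simp add: powr_powr flip: powr_numeral)
    finally have "2 powr \<beta> * (2 + \<beta>) \<le> 3/2 * (7/3)" using b by (intro mult_mono) auto
    then show ?thesis by simp
  qed
  note c = this
  have "u x \<le> 7/2 * x powr - \<beta>" if "0 < x" "x \<le> 1" for x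
  proof -
    have "u x \<le> 2 powr \<beta> * (2 + \<beta>) * x powr - \<beta>" using g'(5)[OF that] that mg mu by (simp add: u_def)
    also have "\<dots> \<le> 7/2 * x powr - \<beta>" by (rule mult_right_mono[OF c]) simp
    finally show ?thesis .
  qed
  then show thesis using that[OF du mu _ d] by blast
qed

section \<open>From Lipschitz test functions to weak convergence\<close>

text \<open>The real and imaginary parts are integrals of Lipschitz functions, to which a
  Wasserstein bound applies.\<close>

lemma char_cos_sin:
  assumes "real_distribution M"
  shows "char M t = of_real (\<integral>x. cos (t * x) \<partial>M) + \<i> * of_real (\<integral>x. sin (t * x) \<partial>M)"
proof -
  interpret real_distribution M by fact
  have i: "integrable M (\<lambda>x. cos (t * x))" "integrable M (\<lambda>x. sin (t * x))"
    by (auto intro!: integrable_const_bound[where B = 1])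
  have "char M t = (CLINT x|M. of_real (cos (t * x)) + \<i> * of_real (sin (t * x)))"
    unfolding char_def by (intro Bochner_Integration.integral_cong refl) (simp add: exp_Euler cos_of_real[symmetric] sin_of_real[symmetric])
  also have "\<dots> = of_real (\<integral>x. cos (t * x) \<partial>M) + \<i> * of_real (\<integral>x. sin (t * x) \<partial>M)"
    using i by (subst Bochner_Integration.integral_add) auto
  finally show ?thesis .
qed

lemma cos_diff_le: "\<bar>cos x - cos y\<bar> \<le> \<bar>x - y\<bar>" for x y :: real
proof -
  have "cos x - cos y = 2 * (sin ((x + y) / 2) * sin ((y - x) / 2))" by (simp add: cos_diff_cos)
  also have "\<bar>\<dots>\<bar> \<le> 2 * (1 * \<bar>(y - x) / 2\<bar>)"
    unfolding abs_mult by (intro mult_mono abs_sin_le_one abs_sin_x_le_abs_x) auto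
  finally show ?thesis by simp
qed

lemma sin_diff_le: "\<bar>sin x - sin y\<bar> \<le> \<bar>x - y\<bar>" for x y :: real
  using cos_diff_le[of "pi/2 - x" "pi/2 - y"] by (simp add: cos_diff abs_minus_commute)

text \<open>Levy's continuity theorem, tested on cosine and sine. The assumed bound concerns only h
  that are Lipschitz with constant 1, uniformly in h, and holds from m on.\<close>

lemma weak_conv_normal_lipschitz:
  fixes r :: "nat \<Rightarrow> real"
  assumes M: "\<And>n. real_distribution (M n)" and r: "r \<longlonglongrightarrow> 0"
    and le: "\<And>n h. n \<ge> m \<Longrightarrow> (\<And>x y. \<bar>h x - h y\<bar> \<le> \<bar>x - y\<bar>) \<Longrightarrow>
      \<bar>(\<integral>x. h x \<partial>M n) - (\<integral>x. std_normal_density x * h x \<partial>lborel)\<bar> \<le> r n"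
  shows "weak_conv_m M std_normal_distribution"
proof (rule levy_continuity[OF M real_dist_normal_dist])
  fix t :: real
  have conv: "(\<lambda>n. \<integral>x. k (t * x) \<partial>M n) \<longlonglongrightarrow> (\<integral>x. k (t * x) \<partial>std_normal_distribution)"
    if k: "\<And>x y. \<bar>k x - k y\<bar> \<le> \<bar>x - y\<bar>" for k :: "real \<Rightarrow> real"
  proof -
    \<comment> \<open>Dividing by |t| + 1 instead of |t| brings the Lipschitz constant below 1 and
      includes t = 0.\<close>
    let ?h = "\<lambda>x. k (t * x) / (\<bar>t\<bar> + 1)"
    have [measurable]: "k \<in> borel_measurable borel" using lipschitz_borel[of k 1] k by simp
    have h: "\<bar>?h x - ?h y\<bar> \<le> \<bar>x - y\<bar>" for x y
    proof -
      have "\<bar>k (t * x) - k (t * y)\<bar> \<le> \<bar>t\<bar> * \<bar>x - y\<bar>"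
        using k[of "t * x" "t * y"] by (simp add: right_diff_distrib[symmetric] abs_mult)
      also have "\<dots> \<le> (\<bar>t\<bar> + 1) * \<bar>x - y\<bar>" by (intro mult_right_mono) auto
      finally have "\<bar>k (t * x) - k (t * y)\<bar> / (\<bar>t\<bar> + 1) \<le> \<bar>x - y\<bar>"
        by (simp add: pos_divide_le_eq add_nonneg_pos mult.commute)
      then show ?thesis by (simp add: diff_divide_distrib[symmetric])
    qed
    have eq: "(\<integral>x. k (t * x) \<partial>std_normal_distribution) = (\<bar>t\<bar> + 1) * (\<integral>x. std_normal_density x * ?h x \<partial>lborel)"
      by (subst integral_density) auto
    have "(\<lambda>n. \<integral>x. ?h x \<partial>M n) \<longlonglongrightarrow> (\<integral>x. std_normal_density x * ?h x \<partial>lborel)"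
    proof (rule Lim_transform_bound[THEN Lim_null[THEN iffD2]])
      show "\<forall>\<^sub>F n in sequentially. norm ((\<integral>x. ?h x \<partial>M n) - (\<integral>x. std_normal_density x * ?h x \<partial>lborel)) \<le> norm (r n)"
        using eventually_ge_at_top[of m]
      proof eventually_elim
        case (elim n)
        show ?case using le[OF elim h] by simp
      qed
    qed (rule r)
    then have "(\<lambda>n. (\<bar>t\<bar> + 1) * (\<integral>x. ?h x \<partial>M n)) \<longlonglongrightarrow> (\<bar>t\<bar> + 1) * (\<integral>x. std_normal_density x * ?h x \<partial>lborel)"
      by (intro tendsto_intros)
    then show ?thesis unfolding eq by simp
  qed
  show "(\<lambda>n. char (M n) t) \<longlonglongrightarrow> char std_normal_distribution t"
    unfolding char_cos_sin[OF M] char_cos_sin[OF real_dist_normal_dist]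
    by (intro tendsto_intros conv cos_diff_le sin_diff_le)
qed

text \<open>The rate constant is chosen before the observables, so it is fixed by the measure and
  the maps. The flow \<open>orbit \<alpha> i m\<close> applies i maps from time m on, in the
  argument order expected by \<open>mixing_process\<close>.\<close>

lemma (in admissible) mixing_process_orbit:
  assumes g: "dec_dens g" "mass g = 1" "\<And>x. 0 < x \<Longrightarrow> x \<le> 1 \<Longrightarrow> g x \<le> 7/2 * x powr - \<beta>"
    and p: "prob_space (density lebesgue01 g)"
  shows "\<exists>C>0. \<forall>\<psi> a L. (\<forall>i. \<psi> i \<in> borel_measurable borel) \<longrightarrow> (\<forall>i x. x \<in> {0..1} \<longrightarrow> \<bar>\<psi> i x\<bar> \<le> a) \<longrightarrow>
    (\<forall>i x y. x \<in> {0..1} \<longrightarrow> y \<in> {0..1} \<longrightarrow> \<bar>\<psi> i x - \<psi> i y\<bar> \<le> L * \<bar>x - y\<bar>) \<longrightarrow> 0 < a \<longrightarrow> 0 \<le> L \<longrightarrow>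
    (\<forall>i. (\<integral>x. \<psi> i (orbit \<alpha> i 0 x) \<partial>density lebesgue01 g) = 0) \<longrightarrow>
    mixing_process (density lebesgue01 g) (\<lambda>i. orbit \<alpha> i 0) (orbit \<alpha>) (\<lambda>n. C * mixing_rate \<beta> n) \<psi> a L"
proof -
  let ?\<mu> = "density lebesgue01 g"
  obtain C where C: "C > 0" and loss: "\<And>(\<phi> :: nat \<Rightarrow> real \<Rightarrow> real) l \<Theta> \<Lambda> B p n. 0 \<le> l \<Longrightarrow> 0 \<le> \<Lambda> \<Longrightarrow>
    (\<forall>i. \<phi> i \<in> borel_measurable borel) \<Longrightarrow>
    (\<forall>i x y. x \<in> {0..1} \<longrightarrow> y \<in> {0..1} \<longrightarrow> \<bar>\<phi> i x - \<phi> i y\<bar> \<le> l * \<bar>x - y\<bar>) \<Longrightarrow>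
    case_prod \<Theta> \<in> borel_measurable (borel \<Otimes>\<^sub>M borel) \<Longrightarrow>
    (\<forall>s z. z \<in> {0..1} \<longrightarrow> \<bar>\<Theta> s z\<bar> \<le> B) \<Longrightarrow>
    (\<forall>s t z. z \<in> {0..1} \<longrightarrow> \<bar>\<Theta> s z - \<Theta> t z\<bar> \<le> \<Lambda> * \<bar>s - t\<bar>) \<Longrightarrow>
    (\<forall>t. mass (\<lambda>x. \<Theta> t (orbit \<alpha> (p + n) 0 x) * g x) = 0) \<Longrightarrow>
    \<bar>mass (\<lambda>x. \<Theta> (\<Sum>i<p. \<phi> i (orbit \<alpha> i 0 x)) (orbit \<alpha> (p + n) 0 x) * g x)\<bar>
      \<le> (B + 3 * l * \<Lambda>) * (C * mixing_rate \<beta> n)"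
    using memory_loss[OF g] by blast
  have "mixing_process ?\<mu> (\<lambda>i. orbit \<alpha> i 0) (orbit \<alpha>) (\<lambda>n. C * mixing_rate \<beta> n) \<psi> a L"
    if psi: "\<forall>i. \<psi> i \<in> borel_measurable borel" "\<forall>i x. x \<in> {0..1} \<longrightarrow> \<bar>\<psi> i x\<bar> \<le> a"
      "\<forall>i x y. x \<in> {0..1} \<longrightarrow> y \<in> {0..1} \<longrightarrow> \<bar>\<psi> i x - \<psi> i y\<bar> \<le> L * \<bar>x - y\<bar>" "0 < a" "0 \<le> L"
      "\<forall>i. (\<integral>x. \<psi> i (orbit \<alpha> i 0 x) \<partial>?\<mu>) = 0" for \<psi> :: "nat \<Rightarrow> real \<Rightarrow> real" and a L
  proof (intro mixing_process.intro mixing_process_axioms.intro)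
    fix \<phi> :: "nat \<Rightarrow> real \<Rightarrow> real" and l \<Lambda> B :: real and \<Theta> :: "real \<Rightarrow> real \<Rightarrow> real" and p n :: nat
    assume l: "0 \<le> l" "0 \<le> \<Lambda>" and phi [measurable]: "\<And>i. \<phi> i \<in> borel_measurable borel"
      and phi2: "\<And>i x y. x \<in> {0..1} \<Longrightarrow> y \<in> {0..1} \<Longrightarrow> \<bar>\<phi> i x - \<phi> i y\<bar> \<le> l * \<bar>x - y\<bar>"
      and T [measurable]: "case_prod \<Theta> \<in> borel_measurable (borel \<Otimes>\<^sub>M borel)"
      and T2: "\<And>s z. z \<in> {0..1} \<Longrightarrow> \<bar>\<Theta> s z\<bar> \<le> B"
      "\<And>s t z. z \<in> {0..1} \<Longrightarrow> \<bar>\<Theta> s z - \<Theta> t z\<bar> \<le> \<Lambda> * \<bar>s - t\<bar>"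
      and zero: "\<And>t. (\<integral>w. \<Theta> t (orbit \<alpha> (p + n) 0 w) \<partial>?\<mu>) = 0"
    have [measurable]: "\<Theta> t \<in> borel_measurable borel" for t
      using measurable_compose[OF measurable_Pair1'[of t borel borel] T] by simp
    have "mass (\<lambda>x. \<Theta> t (orbit \<alpha> (p + n) 0 x) * g x) = 0" for t
      using zero[of t] by (subst (asm) integral_density_lebesgue01[OF g(1)]) auto
    moreover have "(\<integral>w. \<Theta> (\<Sum>i<p. \<phi> i (orbit \<alpha> i 0 w)) (orbit \<alpha> (p + n) 0 w) \<partial>?\<mu>) =
        mass (\<lambda>x. \<Theta> (\<Sum>i<p. \<phi> i (orbit \<alpha> i 0 x)) (orbit \<alpha> (p + n) 0 x) * g x)"
      by (rule integral_density_lebesgue01[OF g(1)]) measurable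
    ultimately show "\<bar>\<integral>w. \<Theta> (\<Sum>i<p. \<phi> i (orbit \<alpha> i 0 w)) (orbit \<alpha> (p + n) 0 w) \<partial>?\<mu>\<bar>
        \<le> (B + 3 * l * \<Lambda>) * (C * mixing_rate \<beta> n)"
      using loss[OF l _ _ T, of \<phi> B p n] phi phi2 T2 by simp
  next
    fix i show "orbit \<alpha> i 0 \<in> borel_measurable ?\<mu>"
      using borel_measurable_lebesgue01[OF measurable_orbit[of \<alpha> i 0]] by simp
  next
    show "summable (\<lambda>n. C * mixing_rate \<beta> n)" by (intro summable_mult summable_mixing_rate beta)
    show "0 \<le> C * mixing_rate \<beta> n" for n using C mixing_rate_pos[of \<beta> n] by simp
  qed (use p psi orbit_in orbit_add[of \<alpha> _ _ 0] in auto)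
  then show ?thesis using C by blast
qed

lemma rate_tendsto_0:
  fixes \<delta> p :: real
  assumes "\<delta> < 0" "0 < p"
  shows "(\<lambda>N. C * real N powr \<delta> * ln (real N) powr p) \<longlonglongrightarrow> 0"
  using assms by real_asymp

theorem corollary2p3:
  fixes \<beta> C0 \<epsilon> :: real and \<alpha> :: "nat \<Rightarrow> real"
    and \<mu> :: "real measure" and g f :: "real \<Rightarrow> real"
    and P :: "'a measure" and Z :: "'a \<Rightarrow> real"
  assumes "0 < \<beta>" and "\<beta> < 1/3"
    and "\<And>n. n \<ge> 1 \<Longrightarrow> 0 \<le> \<alpha> n \<and> \<alpha> n \<le> \<beta>"
    and "prob_space P" and "distributed P lborel Z std_normal_density"
    and "prob_space \<mu>" and "\<mu> = density lebesgue01 g" and "g \<in> cone_star \<beta>"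
    and "\<exists>L. L-lipschitz_on {0..1} f"
    and "0 < C0" and "0 \<le> \<epsilon>" and "\<epsilon> \<le> 1"
    and "\<And>N::nat. N \<ge> 2 \<Longrightarrow> var_sum \<mu> \<alpha> f N \<ge> C0 * real N powr \<epsilon>"
  shows "(\<exists>C>0. \<forall>N::nat\<ge>2.
            wasserstein_dist \<mu> (normalised_sum \<mu> \<alpha> f N) P Z
              \<le> ennreal (C * real N powr (1 - 3/2 * \<epsilon> + \<beta>) * ln (real N) powr (1 / \<beta>)))
       \<and> (\<epsilon> > 2/3 * (1 + \<beta>) \<longrightarrow>
            weak_conv_m (\<lambda>N. distr \<mu> borel (normalised_sum \<mu> \<alpha> f N)) std_normal_distribution)"
proof -
  interpret admissible \<beta> \<alpha> by unfold_locales (use assms(1-3) in auto)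
  obtain u where u: "dec_dens u" "mass u = 1" "\<And>x. 0 < x \<Longrightarrow> x \<le> 1 \<Longrightarrow> u x \<le> 7/2 * x powr - \<beta>"
    and \<mu>: "\<mu> = density lebesgue01 u"
    using cone_star_density[OF assms(1,2,8)] assms(6,7) by metis
  interpret mu: prob_space \<mu> by fact
  have sp: "space \<mu> = {0..1}" by (simp add: \<mu>)
  obtain L where L: "0 \<le> L" "\<And>x y. x \<in> {0..1} \<Longrightarrow> y \<in> {0..1} \<Longrightarrow> \<bar>f x - f y\<bar> \<le> L * \<bar>x - y\<bar>"
    using assms(9) unfolding lipschitz_on_def dist_real_def by blast
  \<comment> \<open>f is controlled only on the unit interval; composing with the projection onto it
    yields a Lipschitz, hence Borel, function on the line that agrees with f along orbits.\<close>
  define F where "F = (\<lambda>x. f (max 0 (min 1 x)))"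
  have F_eq: "F x = f x" if "x \<in> {0..1}" for x using that by (simp add: F_def)
  have F_lip: "\<bar>F x - F y\<bar> \<le> L * \<bar>x - y\<bar>" for x y
  proof -
    have "\<bar>F x - F y\<bar> \<le> L * \<bar>max 0 (min 1 x) - max 0 (min 1 y)\<bar>" unfolding F_def by (intro L) auto
    also have "\<dots> \<le> L * \<bar>x - y\<bar>" using L(1) by (intro mult_left_mono) auto
    finally show ?thesis .
  qed
  have [measurable]: "F \<in> borel_measurable borel" using F_lip by (rule lipschitz_borel)
  define b where "b = \<bar>F 0\<bar> + L"
  have F_le: "\<bar>F x\<bar> \<le> b" if "x \<in> {0..1}" for x
    using F_lip[of x 0] that mult_left_le[of x L] L(1) unfolding b_def by (simp add: abs_le_iff mult.commute) linarith
  define m where "m = (\<lambda>i. \<integral>x. F (orbit \<alpha> i 0 x) \<partial>\<mu>)"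
  define \<psi> where "\<psi> = (\<lambda>i x. F x - m i)"
  have orb [measurable]: "orbit \<alpha> i 0 \<in> borel_measurable \<mu>" for i
    unfolding \<mu> using borel_measurable_lebesgue01[OF measurable_orbit[of \<alpha> i 0]] by simp
  have intF: "integrable \<mu> (\<lambda>x. F (orbit \<alpha> i 0 x))" for i
    by (rule mu.integrable_const_bound[where B = b]) (use F_le orbit_in in \<open>auto simp: sp\<close>)
  have m_le: "\<bar>m i\<bar> \<le> b" for i
  proof -
    have "\<bar>m i\<bar> \<le> (\<integral>x. \<bar>F (orbit \<alpha> i 0 x)\<bar> \<partial>\<mu>)" unfolding m_def by (rule integral_abs_bound)
    also have "\<dots> \<le> (\<integral>x. b \<partial>\<mu>)"
      by (rule integral_mono) (use intF F_le orbit_in in \<open>auto simp: sp\<close>)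
    finally show ?thesis by (simp add: mu.prob_space)
  qed
  have b0: "0 \<le> b" using L(1) by (simp add: b_def)
  obtain Cr where Cr: "Cr > 0"
    and mp: "mixing_process \<mu> (\<lambda>i. orbit \<alpha> i 0) (orbit \<alpha>) (\<lambda>n. Cr * mixing_rate \<beta> n) \<psi> (2 * b + 1) L"
  proof -
    obtain C where C: "C > 0" "\<forall>\<psi> a L. (\<forall>i. \<psi> i \<in> borel_measurable borel) \<longrightarrow> (\<forall>i x. x \<in> {0..1} \<longrightarrow> \<bar>\<psi> i x\<bar> \<le> a) \<longrightarrow>
      (\<forall>i x y. x \<in> {0..1} \<longrightarrow> y \<in> {0..1} \<longrightarrow> \<bar>\<psi> i x - \<psi> i y\<bar> \<le> L * \<bar>x - y\<bar>) \<longrightarrow> 0 < a \<longrightarrow> 0 \<le> L \<longrightarrow>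
      (\<forall>i. (\<integral>x. \<psi> i (orbit \<alpha> i 0 x) \<partial>\<mu>) = 0) \<longrightarrow>
      mixing_process \<mu> (\<lambda>i. orbit \<alpha> i 0) (orbit \<alpha>) (\<lambda>n. C * mixing_rate \<beta> n) \<psi> a L"
      using mixing_process_orbit[OF u] assms(6) unfolding \<mu> by blast
    \<comment> \<open>The centred observables are bounded by 2 b; the extra 1 keeps the bound
      positive when f vanishes.\<close>
    have "mixing_process \<mu> (\<lambda>i. orbit \<alpha> i 0) (orbit \<alpha>) (\<lambda>n. C * mixing_rate \<beta> n) \<psi> (2 * b + 1) L"
    proof (rule C(2)[rule_format])
      fix i and x :: real assume "x \<in> {0..1}"
      then show "\<bar>\<psi> i x\<bar> \<le> 2 * b + 1" using F_le[of x] m_le[of i] unfolding \<psi>_def by linarith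
    next
      fix i show "(\<integral>x. \<psi> i (orbit \<alpha> i 0 x) \<partial>\<mu>) = 0"
        unfolding \<psi>_def using intF by (simp add: m_def mu.prob_space)
    qed (use F_lip L b0 in \<open>auto simp: \<psi>_def\<close>)
    then show thesis using that C(1) by blast
  qed
  interpret mp: mixing_process \<mu> "\<lambda>i. orbit \<alpha> i 0" "orbit \<alpha>" "\<lambda>n. Cr * mixing_rate \<beta> n" \<psi> "2 * b + 1" L
    by (rule mp)
  have cs: "centred_sum \<mu> \<alpha> f N x = mp.partial_sum N x" if "x \<in> space \<mu>" for N x
  proof -
    have "(\<integral>y. f (iterated_map \<alpha> i y) \<partial>\<mu>) = m i" for i
      unfolding m_def by (intro Bochner_Integration.integral_cong refl)
        (simp add: iterated_map_eq_orbit F_eq orbit_in sp del: atLeastAtMost_iff)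
    moreover have "mp.partial_sum N x = (\<Sum>i<N. \<psi> i (orbit \<alpha> i 0 x))"
      by (simp add: mp.partial_sum_def mp.F_def)
    ultimately show ?thesis
      using that unfolding centred_sum_def by (simp add: \<psi>_def iterated_map_eq_orbit F_eq orbit_in sp del: atLeastAtMost_iff)
  qed
  define \<sigma> where "\<sigma> = (\<lambda>N. sqrt (var_sum \<mu> \<alpha> f N))"
  have vs: "var_sum \<mu> \<alpha> f N = mu.expectation (\<lambda>w. (mp.partial_sum N w)\<^sup>2)" for N
    unfolding var_sum_def by (intro Bochner_Integration.integral_cong refl) (simp add: cs)
  have vs0: "0 \<le> var_sum \<mu> \<alpha> f N" for N unfolding vs by simp
  have ns: "normalised_sum \<mu> \<alpha> f N x = mp.partial_sum N x / \<sigma> N" if "x \<in> space \<mu>" for N x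
    by (simp add: normalised_sum_def \<sigma>_def cs[OF that])
  define K where "K = (\<lambda>N. nat \<lceil>real N powr \<beta>\<rceil>)"
  obtain C where C: "C > 0" and rate: "\<And>N \<sigma>. 2 \<le> N \<Longrightarrow> 0 < \<sigma> \<Longrightarrow> \<sigma>\<^sup>2 \<le> mp.SV * real N \<Longrightarrow> C0 * real N powr \<epsilon> \<le> \<sigma>\<^sup>2 \<Longrightarrow>
    mp.stein_error N (K N) (sqrt C0) \<sigma> \<le> C * real N powr (1 - 3/2 * \<epsilon> + \<beta>) * ln (real N) powr (1 / \<beta>)"
    using mp.stein_error_rate[OF assms(1,2) Cr refl assms(10), of \<epsilon>] unfolding K_def by blast
  let ?r = "\<lambda>N. C * real N powr (1 - 3/2 * \<epsilon> + \<beta>) * ln (real N) powr (1 / \<beta>)"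
  have bound: "\<bar>(\<integral>w. h (normalised_sum \<mu> \<alpha> f N w) \<partial>\<mu>) - (\<integral>x. std_normal_density x * h x \<partial>lborel)\<bar> \<le> ?r N"
    if N: "2 \<le> N" and h: "\<And>x y. \<bar>h x - h y\<bar> \<le> \<bar>x - y\<bar>" for N and h :: "real \<Rightarrow> real"
  proof -
    have s2: "(\<sigma> N)\<^sup>2 = mu.expectation (\<lambda>w. (mp.partial_sum N w)\<^sup>2)" using vs0[of N] by (simp add: \<sigma>_def vs)
    have lo: "C0 * real N powr \<epsilon> \<le> (\<sigma> N)\<^sup>2" using assms(13)[OF N] vs0[of N] by (simp add: \<sigma>_def)
    \<comment> \<open>Since \<epsilon> \<ge> 0, the standard deviation is at least sqrt C0 for all N
      \<ge> 2, which provides the uniform \<open>\<sigma>0\<close> of the Stein bound.\<close>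
    have "C0 * 1 \<le> C0 * real N powr \<epsilon>"
      using N assms(10,11) by (intro mult_left_mono ge_one_powr_ge_zero) auto
    then have s0: "sqrt C0 \<le> \<sigma> N" using lo vs0[of N] by (simp add: \<sigma>_def)
    have pos: "0 < sqrt C0" using assms(10) by simp
    have up: "(\<sigma> N)\<^sup>2 \<le> mp.SV * real N"
      unfolding s2 using mp.second_moment[of "{..<N}" N] by (simp add: mp.partial_sum_def)
    have "(\<integral>w. h (normalised_sum \<mu> \<alpha> f N w) \<partial>\<mu>) = (\<integral>w. h (mp.partial_sum N w / \<sigma> N) \<partial>\<mu>)"
      by (intro Bochner_Integration.integral_cong refl) (simp add: ns)
    then show ?thesis
      using mp.stein_bound[OF h s2 pos s0, of "K N"] rate[OF N _ up lo] pos s0 by simp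
  qed
  have "wasserstein_dist \<mu> (normalised_sum \<mu> \<alpha> f N) P Z \<le> ennreal (?r N)" if N: "2 \<le> N" for N
    unfolding wasserstein_dist_def
  proof (rule SUP_least)
    fix h :: "real \<Rightarrow> real" assume "h \<in> {h. \<forall>x y. \<bar>h x - h y\<bar> \<le> \<bar>x - y\<bar>}"
    then have h: "\<And>x y. \<bar>h x - h y\<bar> \<le> \<bar>x - y\<bar>" by blast
    have "h \<in> borel_measurable lborel" using lipschitz_borel[of h 1] h by simp
    then have "(\<integral>w. h (Z w) \<partial>P) = (\<integral>x. std_normal_density x * h x \<partial>lborel)"
      by (intro distributed_integral[OF assms(5), symmetric]) auto
    then show "ennreal \<bar>(\<integral>w. h (normalised_sum \<mu> \<alpha> f N w) \<partial>\<mu>) - (\<integral>w. h (Z w) \<partial>P)\<bar> \<le> ennreal (?r N)"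
      using bound[OF N h] by (intro ennreal_leI) simp
  qed
  moreover have "weak_conv_m (\<lambda>N. distr \<mu> borel (normalised_sum \<mu> \<alpha> f N)) std_normal_distribution"
    if e: "\<epsilon> > 2/3 * (1 + \<beta>)"
  proof -
    have Y [measurable]: "normalised_sum \<mu> \<alpha> f N \<in> borel_measurable \<mu>" for N
    proof -
      have "(\<lambda>x. mp.partial_sum N x / \<sigma> N) \<in> borel_measurable \<mu>"
        using mp.bdd_partial_sum[of N] unfolding bdd_rv_def by auto
      then show ?thesis
        using measurable_cong[of \<mu> "normalised_sum \<mu> \<alpha> f N" "\<lambda>x. mp.partial_sum N x / \<sigma> N" borel] ns
        by auto
    qed
    show ?thesis
    proof (rule weak_conv_normal_lipschitz[where r = ?r and m = 2])
      show "real_distribution (distr \<mu> borel (normalised_sum \<mu> \<alpha> f N))" for N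
        by (rule mu.real_distribution_distr) simp
      \<comment> \<open>The condition on \<epsilon> says exactly that the exponent of N is negative,
        and a negative power beats the logarithm.\<close>
      show "?r \<longlonglongrightarrow> 0" by (rule rate_tendsto_0) (use e assms(1) in \<open>auto simp: algebra_simps\<close>)
      fix N :: nat and h :: "real \<Rightarrow> real" assume N: "2 \<le> N" and h: "\<And>x y. \<bar>h x - h y\<bar> \<le> \<bar>x - y\<bar>"
      have [measurable]: "h \<in> borel_measurable borel" using lipschitz_borel[of h 1] h by simp
      show "\<bar>(\<integral>x. h x \<partial>distr \<mu> borel (normalised_sum \<mu> \<alpha> f N)) - (\<integral>x. std_normal_density x * h x \<partial>lborel)\<bar> \<le> ?r N"
        using bound[OF N h] by (subst integral_distr) auto
    qed
  qed
  ultimately show ?thesis using C by blast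
qed

end
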